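(* Let $\Delta\ge 3$ be an integer and let $\boldsymbol\theta=(\theta_0,\ldots,\theta_\Delta)$ be a strictly positive log-convex vector. Define $$\psi_{\boldsymbol\theta} = \max_{k=0,\ldots,\Delta-2}\Big(\big(\Delta-(k+1)\big)\frac{\theta_{k+1}}{\theta_k}\Big),$$ $$\underline{\lambda}_{\boldsymbol\theta} = \Bigg(2\,\psi_{\boldsymbol\theta}\,\theta_0^{-1}\Big(\frac{\theta_\Delta}{\theta_{\Delta-1}}\Big)^{\Delta-2}\bigg(\frac{\theta_\Delta}{\theta_{\Delta-1}} + (\Delta-1)\Big(\frac{\theta_\Delta}{\theta_{\Delta-1}}-\frac{\theta_1}{\theta_0}\Big)\bigg)\Bigg)^{-1},$$ $$\overline{\lambda}_{\boldsymbol\theta} = \frac{3\theta_0}{\Delta}\exp\Big(3\,\frac{\theta_\Delta}{\theta_{\Delta-1}}\,\frac{\theta_0}{\theta_1}\Big)\Big(\frac{\theta_0}{\theta_1}\Big)^{\Delta}.$$ Then $(\lambda,\boldsymbol\theta)$ belongs to the uniqueness regime for all $0<\lambda<\underline{\lambda}_{\boldsymbol\theta}$, and does not belong to the uniqueness regime for all $\lambda>\overline{\lambda}_{\boldsymbol\theta}$.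
   Context: Log-convexity: a strictly positive sequence $(x_0,\ldots,x_n)$ is log-convex if $x_{i+1}/x_i \ge x_i/x_{i-1}$ for all $i \in \{1,\ldots,n-1\}$. Model. $T_\infty$ is the infinite $\Delta$-regular tree, rooted at a node $0$, with graph distance $d(\cdot,\cdot)$; $T_\infty$ also denotes its node set. For $S \subseteq T_\infty$, $\Omega_S = \{0,1\}^S$ and $\Omega=\Omega_{T_\infty}$; for $\omega\in\Omega_S$ write $\omega_{\{i\}}$ for the spin at $i$, $\omega_{S'}$ for the restriction to $S'\subseteq S$, and $|\omega| = \sum_{i\in S}\omega_{\{i\}}$. $\tilde\Omega_S \subseteq \Omega_S$ is the set of $\omega$ with no two adjacent nodes of $S$ both having spin $1$. For disjoint $S_1,S_2$, $\omega^1\cdot\omega^2$ denotes the combined configuration. $\partial S$ is the set of nodes not in $S$ at distance at most $2$ from $S$. For a node $i$, $N(i)$ is the set consisting of $i$ and its $\Delta$ neighbors. For $\lambda>0$ and strictly positive $\boldsymbol\theta$, define for each node $i$ and $\omega\in\Omega_{N(i)}$ the potential $\Phi_{N(i)}(\omega) = -\log\lambda$ if $\omega_{\{i\}}=1$ and $|\omega_{N(i)}|=1$; $\Phi_{N(i)}(\omega)=-\log\theta_k$ if $\omega_{\{i\}}=0$ and $|\omega_{N(i)}|=k$; $\Phi_{N(i)}(\omega)=\infty$ otherwise. All other potentials are zero. This family of potentials is denoted $(\lambda,\boldsymbol\theta)$. For finite $\Lambda\subseteq T_\infty$ and $\omega\in\Omega_{\Lambda\cup\partial\Lambda}$, the Hamiltonian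 is $\mathcal{H}_\Lambda(\omega) = \sum_{i:\,N(i)\cap\Lambda\ne\emptyset}\Phi_{N(i)}(\omega_{N(i)})$. For finite $S\subseteq\Lambda$, $\omega\in\Omega_S$ and $\eta\in\tilde\Omega_{\partial\Lambda}$, $$\mathbb{P}_{\lambda,\boldsymbol\theta,\Lambda}(S=\omega\mid\eta) = \frac{\sum_{\nu\in\Omega_\Lambda:\,\nu_S=\omega}\exp(-\mathcal{H}_\Lambda(\nu\cdot\eta))}{\sum_{\nu\in\Omega_\Lambda}\exp(-\mathcal{H}_\Lambda(\nu\cdot\eta))},\qquad \exp(-\infty)=0.$$ Uniqueness regime. An infinite-volume Gibbs measure consistent with $(\lambda,\boldsymbol\theta)$ is a probability measure $\mu$ on $\Omega$ (product $\sigma$-algebra), concentrated on configurations with no two adjacent nodes both having spin $1$, such that for all finite $S\subseteq\Lambda\subseteq T_\infty$ and $\omega\in\Omega_S$, $\mu(S=\omega) = \sum_{\eta\in\tilde\Omega_{\partial\Lambda}}\mathbb{P}_{\lambda,\boldsymbol\theta,\Lambda}(S=\omega\mid\eta)\,\mu(\partial\Lambda=\eta)$, where $\{S=\omega\}$ is the event that the nodes of $S$ receive the spins $\omega$. $(\lambda,\boldsymbol\theta)$ belongs to the uniqueness regime if there is exactly one such measure. *)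

theory Defs
  imports "HOL-Probability.Probability"
begin

definition log_convex :: "nat \<Rightarrow> (nat \<Rightarrow> real) \<Rightarrow> bool" where
  "log_convex n x \<longleftrightarrow>
     (\<forall>i\<le>n. 0 < x i) \<and> (\<forall>i\<in>{1..n - 1}. x i / x (i - 1) \<le> x (i + 1) / x i)"


text \<open>
  The nodes of the infinite \<open>\<Delta>\<close>-regular tree are the words recording, read from right to
  left, which child is taken at each step from the root \<open>[]\<close>. The root has \<open>\<Delta>\<close> children
  and every other node has \<open>\<Delta> - 1\<close> children.
\<close>

inductive_set tree_nodes :: "nat \<Rightarrow> nat list set" for \<Delta> :: nat where
  root: "[] \<in> tree_nodes \<Delta>"
| child: "x \<in> tree_nodes \<Delta> \<Longrightarrow> a < (if x = [] then \<Delta> else \<Delta> - 1) \<Longrightarrow> a # x \<in> tree_nodes \<Delta>"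

definition tree_edges :: "nat \<Rightarrow> (nat list \<times> nat list) set" where
  "tree_edges \<Delta> =
     {(x, y). x \<in> tree_nodes \<Delta> \<and> y \<in> tree_nodes \<Delta> \<and> (\<exists>a. y = a # x \<or> x = a # y)}"

definition graph_dist :: "nat \<Rightarrow> nat list \<Rightarrow> nat list \<Rightarrow> nat" where
  "graph_dist \<Delta> x y = (LEAST n. (x, y) \<in> tree_edges \<Delta> ^^ n)"

definition closed_nbhd :: "nat \<Rightarrow> nat list \<Rightarrow> nat list set" where
  "closed_nbhd \<Delta> i = insert i {j. (i, j) \<in> tree_edges \<Delta>}"

definition boundary :: "nat \<Rightarrow> nat list set \<Rightarrow> nat list set" where
  "boundary \<Delta> S = {i \<in> tree_nodes \<Delta> - S. \<exists>j\<in>S. graph_dist \<Delta> i j \<le> 2}"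

text \<open>
  The next three facts confirm that this is an infinite \<open>\<Delta>\<close>-regular tree: it is regular of
  degree \<open>\<Delta>\<close>, connected, and has no cycle (every finite nonempty set of nodes induces a
  subgraph with a node of degree at most one).
\<close>

lemma tree_edges_sym: "(x, y) \<in> tree_edges \<Delta> \<Longrightarrow> (y, x) \<in> tree_edges \<Delta>"
  by (auto simp: tree_edges_def)

lemma tree_nodes_Cons_iff:
  "a # x \<in> tree_nodes \<Delta> \<longleftrightarrow> x \<in> tree_nodes \<Delta> \<and> a < (if x = [] then \<Delta> else \<Delta> - 1)"
  by (auto intro: tree_nodes.child elim: tree_nodes.cases)

lemma tree_degree:
  assumes "\<Delta> \<ge> 1" and x: "x \<in> tree_nodes \<Delta>"
  shows "card {y. (x, y) \<in> tree_edges \<Delta>} = \<Delta>"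
proof (cases x)
  case Nil
  have "{y. (x, y) \<in> tree_edges \<Delta>} = (\<lambda>a. [a]) ` {..<\<Delta>}"
    using Nil by (auto simp: tree_edges_def tree_nodes_Cons_iff tree_nodes.root)
  then show ?thesis by (simp add: card_image inj_on_def)
next
  case (Cons b z)
  have eq: "{y. (x, y) \<in> tree_edges \<Delta>} = insert z ((\<lambda>a. a # x) ` {..<\<Delta> - 1})"
    using Cons x by (auto simp: tree_edges_def tree_nodes_Cons_iff split: if_splits)
  have "z \<notin> (\<lambda>a. a # x) ` {..<\<Delta> - 1}"
  proof
    assume "z \<in> (\<lambda>a. a # x) ` {..<\<Delta> - 1}"
    then have "length z = Suc (length x)" by auto
    with Cons show False by simp
  qed
  then show ?thesis using assms(1) by (simp add: eq card_image inj_on_def)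
qed

lemma tree_connected:
  assumes "x \<in> tree_nodes \<Delta>" "y \<in> tree_nodes \<Delta>"
  shows "(x, y) \<in> (tree_edges \<Delta>)\<^sup>*"
proof -
  have up: "([], x) \<in> (tree_edges \<Delta>)\<^sup>*" if "x \<in> tree_nodes \<Delta>" for x
    using that
  proof induction
    case (child x a)
    then have "(x, a # x) \<in> tree_edges \<Delta>" by (auto simp: tree_edges_def tree_nodes_Cons_iff)
    with child.IH show ?case by (rule rtrancl_into_rtrancl)
  qed simp
  have "sym ((tree_edges \<Delta>)\<^sup>*)"
    by (rule sym_rtrancl) (auto intro!: symI dest: tree_edges_sym)
  then have "(x, []) \<in> (tree_edges \<Delta>)\<^sup>*"
    using up[OF assms(1)] by (rule symD)
  then show ?thesis using up[OF assms(2)] by (rule rtrancl_trans)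
qed

lemma tree_acyclic:
  assumes "finite C" "C \<noteq> {}"
  shows "\<exists>x\<in>C. card {y \<in> C. (x, y) \<in> tree_edges \<Delta>} \<le> 1"
proof -
  have "Max (length ` C) \<in> length ` C"
    using assms by (intro Max_in) auto
  then obtain x where "x \<in> C" "length x = Max (length ` C)"
    by (metis imageE)
  with assms have x: "x \<in> C" "\<And>y. y \<in> C \<Longrightarrow> length y \<le> length x"
    by simp_all
  have "{y \<in> C. (x, y) \<in> tree_edges \<Delta>} \<subseteq> {tl x}"
    using x(2) by (fastforce simp: tree_edges_def)
  then have "card {y \<in> C. (x, y) \<in> tree_edges \<Delta>} \<le> card {tl x}"
    by (intro card_mono) auto
  with x(1) show ?thesis by auto
qed


definition configs :: "nat list set \<Rightarrow> (nat list \<Rightarrow> nat) set" where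
  "configs S = S \<rightarrow>\<^sub>E {0, 1}"

definition indep_configs :: "nat \<Rightarrow> nat list set \<Rightarrow> (nat list \<Rightarrow> nat) set" where
  "indep_configs \<Delta> S =
     {\<omega> \<in> configs S. \<forall>i\<in>S. \<forall>j\<in>S. (i, j) \<in> tree_edges \<Delta> \<longrightarrow> \<not> (\<omega> i = 1 \<and> \<omega> j = 1)}"

definition potential ::
  "nat \<Rightarrow> real \<Rightarrow> (nat \<Rightarrow> real) \<Rightarrow> nat list \<Rightarrow> (nat list \<Rightarrow> nat) \<Rightarrow> ereal" where
  "potential \<Delta> lam \<theta> i \<omega> =
     (let k = (\<Sum>j\<in>closed_nbhd \<Delta> i. \<omega> j) in
      if \<omega> i = 1 \<and> k = 1 then ereal (- ln lam)
      else if \<omega> i = 0 then ereal (- ln (\<theta> k))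
      else \<infinity>)"

definition hamiltonian ::
  "nat \<Rightarrow> real \<Rightarrow> (nat \<Rightarrow> real) \<Rightarrow> nat list set \<Rightarrow> (nat list \<Rightarrow> nat) \<Rightarrow> ereal" where
  "hamiltonian \<Delta> lam \<theta> \<Lambda> \<omega> =
     (\<Sum>i\<in>{i \<in> tree_nodes \<Delta>. closed_nbhd \<Delta> i \<inter> \<Lambda> \<noteq> {}}.
        potential \<Delta> lam \<theta> i (restrict \<omega> (closed_nbhd \<Delta> i)))"

text \<open>\<open>exp_neg h\<close> is \<open>exp (-h)\<close> with \<open>exp (-\<infinity>) = 0\<close>; the value \<open>h = -\<infinity>\<close> never arises.\<close>

definition exp_neg :: "ereal \<Rightarrow> real" where
  "exp_neg h = (if h = \<infinity> then 0 else exp (- real_of_ereal h))"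

definition cond_prob_config ::
  "nat \<Rightarrow> real \<Rightarrow> (nat \<Rightarrow> real) \<Rightarrow> nat list set \<Rightarrow> nat list set \<Rightarrow>
     (nat list \<Rightarrow> nat) \<Rightarrow> (nat list \<Rightarrow> nat) \<Rightarrow> real" where
  "cond_prob_config \<Delta> lam \<theta> \<Lambda> S \<omega> \<eta> =
     (\<Sum>\<nu>\<in>{\<nu> \<in> configs \<Lambda>. restrict \<nu> S = \<omega>}.
        exp_neg (hamiltonian \<Delta> lam \<theta> \<Lambda> (merge \<Lambda> (boundary \<Delta> \<Lambda>) (\<nu>, \<eta>)))) /
     (\<Sum>\<nu>\<in>configs \<Lambda>.
        exp_neg (hamiltonian \<Delta> lam \<theta> \<Lambda> (merge \<Lambda> (boundary \<Delta> \<Lambda>) (\<nu>, \<eta>))))"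

definition gibbs_measure ::
  "nat \<Rightarrow> real \<Rightarrow> (nat \<Rightarrow> real) \<Rightarrow> (nat list \<Rightarrow> nat) measure \<Rightarrow> bool" where
  "gibbs_measure \<Delta> lam \<theta> \<mu> \<longleftrightarrow>
     prob_space \<mu> \<and>
     sets \<mu> = sets (Pi\<^sub>M (tree_nodes \<Delta>) (\<lambda>_. count_space {0, 1})) \<and>
     (AE \<omega> in \<mu>. \<omega> \<in> indep_configs \<Delta> (tree_nodes \<Delta>)) \<and>
     (\<forall>\<Lambda> S \<omega>. finite \<Lambda> \<and> \<Lambda> \<subseteq> tree_nodes \<Delta> \<and> S \<subseteq> \<Lambda> \<and> \<omega> \<in> configs S \<longrightarrow>
        measure \<mu> {\<xi> \<in> space \<mu>. restrict \<xi> S = \<omega>} =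
        (\<Sum>\<eta>\<in>indep_configs \<Delta> (boundary \<Delta> \<Lambda>).
           cond_prob_config \<Delta> lam \<theta> \<Lambda> S \<omega> \<eta> *
           measure \<mu> {\<xi> \<in> space \<mu>. restrict \<xi> (boundary \<Delta> \<Lambda>) = \<eta>}))"

definition uniqueness_regime :: "nat \<Rightarrow> real \<Rightarrow> (nat \<Rightarrow> real) \<Rightarrow> bool" where
  "uniqueness_regime \<Delta> lam \<theta> \<longleftrightarrow> (\<exists>!\<mu>. gibbs_measure \<Delta> lam \<theta> \<mu>)"


definition psi :: "nat \<Rightarrow> (nat \<Rightarrow> real) \<Rightarrow> real" where
  "psi \<Delta> \<theta> = (MAX k\<in>{0..\<Delta> - 2}. (real \<Delta> - (real k + 1)) * (\<theta> (k + 1) / \<theta> k))"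

definition lambda_lower :: "nat \<Rightarrow> (nat \<Rightarrow> real) \<Rightarrow> real" where
  "lambda_lower \<Delta> \<theta> =
     inverse (2 * psi \<Delta> \<theta> * inverse (\<theta> 0) * (\<theta> \<Delta> / \<theta> (\<Delta> - 1)) ^ (\<Delta> - 2) *
       (\<theta> \<Delta> / \<theta> (\<Delta> - 1) + (real \<Delta> - 1) * (\<theta> \<Delta> / \<theta> (\<Delta> - 1) - \<theta> 1 / \<theta> 0)))"

definition lambda_upper :: "nat \<Rightarrow> (nat \<Rightarrow> real) \<Rightarrow> real" where
  "lambda_upper \<Delta> \<theta> =
     3 * \<theta> 0 / real \<Delta> * exp (3 * (\<theta> \<Delta> / \<theta> (\<Delta> - 1)) * (\<theta> 0 / \<theta> 1)) * (\<theta> 0 / \<theta> 1) ^ \<Delta>"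

end

theory Submission
  imports Defs
begin

text \<open>
  On a tree, the part of the model beyond a node \<open>i\<close> influences the rest only through the spins of \<open>i\<close> and
  of its parent. Two numbers describe this influence: the weight \<open>x\<close> of an occupied \<open>i\<close> below a vacant
  parent and the weight \<open>y\<close> of a vacant \<open>i\<close> below an occupied parent, both relative to the case that the
  two are vacant. These messages are computed from those of the children. Writing
  \<open>f\<^sub>k(x) = \<Sum>j. (d choose j) \<theta>\<^sub>k\<^sub>+\<^sub>j x\<^sup>j\<close> with \<open>d = \<Delta> - 1\<close>, equal messages of the children give
  \<open>x' = \<lambda> y\<^sup>d / f\<^sub>0(x)\<close> and \<open>y' = f\<^sub>1(x) / f\<^sub>0(x)\<close>.

  Log-convexity of \<open>\<theta>\<close> means that \<open>y'\<close> increases with every \<open>x\<close> of a child (\<open>ns_ratio_mono\<close>). Hence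
  \<open>x'\<close> increases with the messages \<open>x\<close> of the grandchildren and decreases with those of the children, and
  there are extremal boundary conditions. Starting with crude bounds at the boundary, the
  recursion produces nested intervals for the messages at growing distance (\<open>env\<close>), whose limits \<open>a \<le> b\<close>
  satisfy \<open>a = G(a, b)\<close> and \<open>b = G(b, a)\<close>, where \<open>G(u, v) = \<lambda> (f\<^sub>1(u) / f\<^sub>0(u))\<^sup>d / f\<^sub>0(v)\<close>.

  The Gibbs measure is unique if and only if \<open>a = b\<close> (\<open>uniqueness_iff\<close>). If \<open>a = b\<close>, a distant boundary
  has no effect, so all Gibbs measures have the same cylinder probabilities (\<open>gibbs_cylinder\<close>). In any case
  the messages that alternate between \<open>a\<close> and \<open>b\<close> along the levels are consistent and yield a
  Gibbs measure by Kolmogorov's extension theorem (\<open>messages.gibbs_tree_measure\<close>); with \<open>a = b\<close> this is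
  existence, and with \<open>a < b\<close> the two phases of the alternation give different measures.

  It remains to compare \<open>a\<close> and \<open>b\<close>. The logarithmic derivative of \<open>f\<^sub>0\<close> is at most \<open>\<psi>\<close>, and this
  yields \<open>b - a \<le> \<kappa> (b - a)\<close> with \<open>\<kappa> < 1/2\<close> below the lower bound (\<open>small_lam_lim_eq\<close>). Above the
  upper bound, a common value \<open>x = a = b\<close> would exceed \<open>A = 3 \<theta>\<^sub>0 / (\<Delta> \<theta>\<^sub>1)\<close>. Beyond \<open>A\<close> the function
  \<open>f\<^sub>0(s) / s\<close> increases, which makes the recursion overshoot: from \<open>A\<close> and \<open>x\<^sup>2 / A\<close> on alternate levels
  it never returns to \<open>x\<close>, a contradiction (\<open>large_lam_lim_less\<close>).
\<close>

section \<open>Sums over the spins of a set of siblings\<close>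

lemma sum_PiE_insert:
  assumes "finite C" "c \<notin> C"
  shows "(\<Sum>s\<in>insert c C \<rightarrow>\<^sub>E {0,1::nat}. g s) =
    (\<Sum>s\<in>C \<rightarrow>\<^sub>E {0,1}. g (s(c := 0))) + (\<Sum>s\<in>C \<rightarrow>\<^sub>E {0,1}. g (s(c := 1)) :: real)"
proof -
  have "(\<Sum>s\<in>insert c C \<rightarrow>\<^sub>E {0,1::nat}. g s) =
      (\<Sum>p\<in>{0,1} \<times> (C \<rightarrow>\<^sub>E {0,1}). g (case p of (y, h) \<Rightarrow> h(c := y)))"
    unfolding PiE_insert_eq
    by (subst sum.reindex[OF inj_combinator[OF assms(2)]]) (simp add: o_def case_prod_beta)
  also have "\<dots> = (\<Sum>y\<in>{0,1}. \<Sum>h\<in>C \<rightarrow>\<^sub>E {0,1}. g (h(c := y)))"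
    by (simp add: sum.cartesian_product case_prod_beta)
  finally show ?thesis by simp
qed

text \<open>
  The part of a partition function contributed by the children \<open>C\<close> of a vacant node: \<open>x c\<close> is the
  relative weight of \<open>c\<close> being occupied, and \<open>k\<close> counts the occupied neighbours outside \<open>C\<close> (0 or 1,
  for the parent). Keeping \<open>k\<close> general makes adding a sibling the operation
  \<open>\<theta>\<^sub>k \<mapsto> \<theta>\<^sub>k + x \<theta>\<^sub>k\<^sub>+\<^sub>1\<close> on sequences, and every property below is one that this operation
  preserves.
\<close>

definition nbr_sum :: "(nat \<Rightarrow> real) \<Rightarrow> 'a set \<Rightarrow> ('a \<Rightarrow> real) \<Rightarrow> nat \<Rightarrow> real" where
  "nbr_sum \<theta> C x k =
     (\<Sum>s\<in>C \<rightarrow>\<^sub>E {0,1::nat}. \<theta> (k + (\<Sum>c\<in>C. s c)) * (\<Prod>c\<in>C. if s c = 0 then 1 else x c))"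

lemma nbr_sum_empty [simp]: "nbr_sum \<theta> {} x k = \<theta> k"
  by (simp add: nbr_sum_def)

lemma nbr_sum_insert:
  assumes C: "finite C" "c \<notin> C"
  shows "nbr_sum \<theta> (insert c C) x k = nbr_sum \<theta> C x k + x c * nbr_sum \<theta> C x (Suc k)"
proof -
  have s: "(\<Sum>i\<in>C. (s(c := v)) i) = (\<Sum>i\<in>C. s i)" for s :: "'a \<Rightarrow> nat" and v
    using C(2) by (intro sum.cong) auto
  have p: "(\<Prod>i\<in>C. if (s(c := v)) i = 0 then 1 else x i) = (\<Prod>i\<in>C. if s i = 0 then 1 else x i)"
    for s :: "'a \<Rightarrow> nat" and v
    using C(2) by (intro prod.cong) auto
  show ?thesis
    unfolding nbr_sum_def sum_PiE_insert[OF C]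
    using C by (simp add: s p sum_distrib_left mult_ac del: fun_upd_apply) (simp add: mult_ac)
qed

text \<open>
  The value of \<open>nbr_sum\<close> on \<open>n\<close> siblings that all carry the same weight \<open>s\<close>.
\<close>

definition binom_sum :: "(nat \<Rightarrow> real) \<Rightarrow> nat \<Rightarrow> nat \<Rightarrow> real \<Rightarrow> real" where
  "binom_sum \<theta> n k s = (\<Sum>j\<le>n. real (n choose j) * \<theta> (k + j) * s ^ j)"

lemma binom_sum_0 [simp]: "binom_sum \<theta> 0 k s = \<theta> k"
  by (simp add: binom_sum_def)

lemma binom_sum_Suc:
  "binom_sum \<theta> (Suc n) k s = binom_sum \<theta> n k s + s * binom_sum \<theta> n (Suc k) s"
proof -
  have "binom_sum \<theta> (Suc n) k s =
      \<theta> k + (\<Sum>j\<le>n. (real (n choose j) + real (n choose Suc j)) * \<theta> (Suc (k + j)) * (s * s ^ j))"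
    unfolding binom_sum_def by (subst sum.atMost_Suc_shift) simp
  also have "\<dots> = (\<theta> k + (\<Sum>j\<le>n. real (n choose Suc j) * \<theta> (k + Suc j) * s ^ Suc j))
      + s * binom_sum \<theta> n (Suc k) s"
    by (simp add: binom_sum_def sum_distrib_left ring_distribs sum.distrib mult_ac)
  also have "\<theta> k + (\<Sum>j\<le>n. real (n choose Suc j) * \<theta> (k + Suc j) * s ^ Suc j)
      = (\<Sum>j\<le>Suc n. real (n choose j) * \<theta> (k + j) * s ^ j)"
    by (simp add: sum.atMost_Suc_shift del: sum.atMost_Suc)
  also have "\<dots> = binom_sum \<theta> n k s"
    by (simp add: binom_sum_def binomial_eq_0)
  finally show ?thesis .
qed

lemma nbr_sum_const:
  assumes "finite C"
  shows "nbr_sum \<theta> C (\<lambda>_. s) k = binom_sum \<theta> (card C) k s"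
  using assms by (induction C arbitrary: k) (simp_all add: nbr_sum_insert binom_sum_Suc)

lemma nbr_sum_cong:
  assumes "\<And>c. c \<in> C \<Longrightarrow> x c = y c"
  shows "nbr_sum \<theta> C x k = nbr_sum \<theta> C y k"
proof -
  have "(\<Prod>c\<in>C. if s c = 0 then 1 else x c) = (\<Prod>c\<in>C. if s c = 0 then 1 else y c)"
    for s :: "'a \<Rightarrow> nat"
    using assms by (intro prod.cong) auto
  then show ?thesis by (simp add: nbr_sum_def)
qed

lemma nbr_sum_pos:
  assumes "finite C" "\<And>k. 0 < \<theta> k" "\<And>c. c \<in> C \<Longrightarrow> 0 \<le> x c"
  shows "0 < nbr_sum \<theta> C x k"
  using assms(1,3)
proof (induction C arbitrary: k)
  case empty
  then show ?case using assms(2) by simp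
next
  case (insert c C)
  then have "0 < nbr_sum \<theta> C x k" "0 < nbr_sum \<theta> C x (Suc k)" "0 \<le> x c" by auto
  then have "0 < nbr_sum \<theta> C x k + x c * nbr_sum \<theta> C x (Suc k)"
    by (intro add_pos_nonneg mult_nonneg_nonneg) auto
  with insert show ?case by (simp add: nbr_sum_insert)
qed

lemma nbr_sum_mono:
  assumes "finite C" "\<And>k. 0 < \<theta> k" "\<And>c. c \<in> C \<Longrightarrow> 0 \<le> x c \<and> x c \<le> y c"
  shows "nbr_sum \<theta> C x k \<le> nbr_sum \<theta> C y k"
  unfolding nbr_sum_def
  by (intro sum_mono mult_left_mono prod_mono less_imp_le[OF assms(2)]) (use assms(3) in auto)

text \<open>
  The Cauchy--Schwarz inequality for two terms; it keeps sums of log-convex sequences log-convex.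
\<close>

lemma sum_sq_le:
  fixes a0 a1 a2 b0 b1 b2 :: real
  assumes "0 < a0" "0 < a1" "0 < a2" "0 < b0" "0 < b1" "0 < b2" "a1\<^sup>2 \<le> a0 * a2" "b1\<^sup>2 \<le> b0 * b2"
  shows "(a1 + b1)\<^sup>2 \<le> (a0 + b0) * (a2 + b2)"
proof -
  \<comment> \<open>Arithmetic-geometric mean on the two mixed products, whose product dominates that of \<open>a1 * b1\<close> squared.\<close>
  have "(2 * (a1 * b1))\<^sup>2 \<le> 4 * ((a0 * b2) * (b0 * a2))"
    using mult_mono[OF assms(7,8)] assms(1-6) by (simp add: power_mult_distrib mult_ac)
  also have "\<dots> \<le> (a0 * b2 + b0 * a2)\<^sup>2"
    using sum_squares_ge_zero[of "a0 * b2 - b0 * a2" 0]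
    by (simp add: power2_eq_square algebra_simps)
  finally have "2 * (a1 * b1) \<le> a0 * b2 + b0 * a2"
    by (rule power2_le_imp_le) (use assms in simp)
  with assms(7,8) show ?thesis by (simp add: power2_eq_square algebra_simps)
qed

text \<open>
  Only \<open>\<theta>\<^sub>0, \<dots>, \<theta>\<^sub>\<Delta>\<close> enter the model, but a log-convex sequence without an end can be shifted
  freely. A finite log-convex vector is prolonged geometrically with its last ratio, which then
  serves as the upper bound \<open>r\<close> of all ratios; the first ratio \<open>q\<close> is their lower bound.
\<close>

locale weights =
  fixes \<theta> :: "nat \<Rightarrow> real" and q r :: real
  assumes pos: "\<And>k. 0 < \<theta> k"
    and logconv: "\<And>k. (\<theta> (Suc k))\<^sup>2 \<le> \<theta> k * \<theta> (Suc (Suc k))"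
    and q_eq: "\<theta> (Suc 0) = q * \<theta> 0"
    and upper: "\<And>k. \<theta> (Suc k) \<le> r * \<theta> k"
begin

lemma q_pos: "0 < q"
  using pos[of 0] pos[of "Suc 0"] q_eq by (simp add: zero_less_mult_iff)

lemma lower: "q * \<theta> k \<le> \<theta> (Suc k)"
proof (induction k)
  case (Suc k)
  have "(q * \<theta> (Suc k)) * \<theta> k \<le> (\<theta> (Suc k))\<^sup>2"
    using mult_right_mono[OF Suc less_imp_le[OF pos[of "Suc k"]]] by (simp add: power2_eq_square mult_ac)
  also have "\<dots> \<le> \<theta> (Suc (Suc k)) * \<theta> k" using logconv[of k] by (simp add: mult_ac)
  finally show ?case using pos[of k] by simp
qed (simp add: q_eq)

lemma q_le_r: "q \<le> r"
  using order_trans[OF lower[of 0] upper[of 0]] pos[of 0] by simp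

lemma r_pos: "0 < r" using q_pos q_le_r by simp

lemma power_lower: "q ^ k * \<theta> 0 \<le> \<theta> k"
proof (induction k)
  case (Suc k)
  have "q * (q ^ k * \<theta> 0) \<le> q * \<theta> k" using Suc q_pos by simp
  with lower[of k] show ?case by (simp add: mult_ac)
qed simp

lemma power_upper: "\<theta> k \<le> r ^ k * \<theta> 0"
proof (induction k)
  case (Suc k)
  have "r * \<theta> k \<le> r * (r ^ k * \<theta> 0)" using Suc r_pos by simp
  with upper[of k] show ?case by (simp add: mult_ac)
qed simp

abbreviation ns :: "'a set \<Rightarrow> ('a \<Rightarrow> real) \<Rightarrow> nat \<Rightarrow> real" where "ns \<equiv> nbr_sum \<theta>"

lemma ns_pos: "finite C \<Longrightarrow> (\<And>c. c \<in> C \<Longrightarrow> 0 \<le> x c) \<Longrightarrow> 0 < ns C x k"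
  by (rule nbr_sum_pos) (auto simp: pos)

lemma ns_logconv:
  assumes "finite C" "\<And>c. c \<in> C \<Longrightarrow> 0 \<le> x c"
  shows "(ns C x (Suc k))\<^sup>2 \<le> ns C x k * ns C x (Suc (Suc k))"
  using assms
proof (induction C arbitrary: k)
  case (insert c C)
  have IH: "(ns C x (Suc k))\<^sup>2 \<le> ns C x k * ns C x (Suc (Suc k))" for k
    using insert.IH[of k] insert.prems by blast
  show ?case
  proof (cases "x c = 0")
    case True
    with IH[of k] insert.hyps show ?thesis by (simp add: nbr_sum_insert)
  next
    case False
    with insert.prems[of c] have u: "0 < x c" by simp
    have p: "0 < ns C x k" for k by (rule ns_pos) (use insert.hyps insert.prems in auto)
    have xp: "0 < x c * ns C x k" for k using u p[of k] by (rule mult_pos_pos)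
    have xs: "(x c * ns C x (Suc (Suc k)))\<^sup>2 \<le> (x c * ns C x (Suc k)) * (x c * ns C x (Suc (Suc (Suc k))))"
      using mult_left_mono[OF IH[of "Suc k"], of "x c * x c"] u
      by (simp add: power2_eq_square mult_ac)
    show ?thesis
      unfolding nbr_sum_insert[OF insert.hyps(1,2)]
      by (rule sum_sq_le[OF p p p xp xp xp IH xs])
  qed
qed (simp add: logconv)

lemma ns_lower_upper:
  assumes "finite C" "\<And>c. c \<in> C \<Longrightarrow> 0 \<le> x c"
  shows "q * ns C x k \<le> ns C x (Suc k) \<and> ns C x (Suc k) \<le> r * ns C x k"
  using assms
proof (induction C arbitrary: k)
  case (insert c C)
  have IH: "q * ns C x k \<le> ns C x (Suc k)" "ns C x (Suc k) \<le> r * ns C x k" for k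
    using insert.IH[of k] insert.prems by simp_all
  have "x c * (q * ns C x (Suc k)) \<le> x c * ns C x (Suc (Suc k))"
    "x c * ns C x (Suc (Suc k)) \<le> x c * (r * ns C x (Suc k))"
    using IH[of "Suc k"] insert.prems by (simp_all add: mult_left_mono)
  with IH[of k] show ?case
    using insert.hyps by (simp add: nbr_sum_insert distrib_left) (simp add: mult_ac)
qed (simp add: lower upper)

text \<open>
  The difference of the two sides is \<open>v - u\<close> times the log-convexity defect of the sum over the other
  siblings. This is the point where log-convexity produces monotonicity.
\<close>

lemma ns_cross_step:
  assumes C: "finite C" "c \<notin> C" "\<And>i. i \<in> C \<Longrightarrow> 0 \<le> x i" and u: "0 \<le> u" "u \<le> v"
  shows "ns (insert c C) (x(c := u)) (Suc k) * ns (insert c C) (x(c := v)) k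
       \<le> ns (insert c C) (x(c := v)) (Suc k) * ns (insert c C) (x(c := u)) k"
proof -
  have e: "ns C (x(c := w)) j = ns C x j" for w j
    using C(2) by (intro nbr_sum_cong) auto
  have "0 \<le> (v - u) * (ns C x k * ns C x (Suc (Suc k)) - (ns C x (Suc k))\<^sup>2)"
    using ns_logconv[of C x k, OF C(1,3)] u by (intro mult_nonneg_nonneg) auto
  then show ?thesis
    unfolding nbr_sum_insert[OF C(1,2)] e by (simp add: algebra_simps power2_eq_square)
qed

lemma ns_ratio_step:
  assumes C: "finite C" "c \<in> C" "\<And>i. i \<in> C \<Longrightarrow> 0 \<le> x i" and u: "x c \<le> v"
  shows "ns C x (Suc k) / ns C x k \<le> ns C (x(c := v)) (Suc k) / ns C (x(c := v)) k"
proof -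
  have "0 < ns C x k" using C by (intro ns_pos)
  moreover have "0 \<le> v" using C u by force
  then have "0 < ns C (x(c := v)) k" using C by (intro ns_pos) auto
  moreover have "ns C x (Suc k) * ns C (x(c := v)) k \<le> ns C (x(c := v)) (Suc k) * ns C x k"
    using ns_cross_step[of "C - {c}" c x "x c" v k] C u by (simp add: insert_absorb)
  ultimately show ?thesis by (simp add: divide_simps mult_ac)
qed

lemma ns_ratio_mono:
  assumes C: "finite C" "\<And>i. i \<in> C \<Longrightarrow> 0 \<le> x i \<and> x i \<le> y i"
  shows "ns C x (Suc k) / ns C x k \<le> ns C y (Suc k) / ns C y k"
proof -
  \<comment> \<open>Replace the coordinates of \<open>x\<close> by those of \<open>y\<close> one after the other.\<close>
  have "ns C x (Suc k) / ns C x k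
      \<le> ns C (override_on x y D) (Suc k) / ns C (override_on x y D) k" if "D \<subseteq> C" for D
    using finite_subset[OF that C(1)] that
  proof (induction D)
    case empty
    then show ?case by simp
  next
    case (insert c D)
    have eq: "override_on x y (insert c D) = (override_on x y D)(c := y c)"
      by (auto simp: override_on_def)
    have "ns C (override_on x y D) (Suc k) / ns C (override_on x y D) k
        \<le> ns C (override_on x y (insert c D)) (Suc k) / ns C (override_on x y (insert c D)) k"
      unfolding eq using insert.prems insert.hyps C
      by (intro ns_ratio_step) (force simp: override_on_def)+
    with insert show ?case by auto
  qed
  from this[of C] have "ns C x (Suc k) / ns C x k
      \<le> ns C (override_on x y C) (Suc k) / ns C (override_on x y C) k" by simp
  also have "ns C (override_on x y C) j = ns C y j" for j
    by (intro nbr_sum_cong) auto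
  then have "ns C (override_on x y C) (Suc k) / ns C (override_on x y C) k = ns C y (Suc k) / ns C y k"
    by simp
  finally show ?thesis .
qed

abbreviation bs :: "nat \<Rightarrow> nat \<Rightarrow> real \<Rightarrow> real" where "bs \<equiv> binom_sum \<theta>"

lemma bs_eq_ns: "bs n k s = ns {..<n} (\<lambda>_. s) k"
  by (simp add: nbr_sum_const)

lemma bs_pos: "0 \<le> s \<Longrightarrow> 0 < bs n k s"
  unfolding bs_eq_ns by (rule ns_pos) auto

lemma bs_mono: "0 \<le> s \<Longrightarrow> s \<le> t \<Longrightarrow> bs n k s \<le> bs n k t"
  unfolding bs_eq_ns by (rule nbr_sum_mono) (auto simp: pos)

lemma bs_at_0: "bs n k 0 = \<theta> k"
  by (induction n arbitrary: k) (simp_all add: binom_sum_Suc)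

lemma bs_ge: "0 \<le> s \<Longrightarrow> \<theta> k \<le> bs n k s"
  using bs_mono[of 0 s n k] by (simp add: bs_at_0)

text \<open>
  The factor by which the partition function at a vacant node with \<open>n\<close> children of weight \<open>s\<close> changes
  when its parent becomes occupied.
\<close>

definition tilt :: "nat \<Rightarrow> real \<Rightarrow> real" where
  "tilt n s = bs n 1 s / bs n 0 s"

lemma tilt_mono: "0 \<le> s \<Longrightarrow> s \<le> t \<Longrightarrow> tilt n s \<le> tilt n t"
  unfolding tilt_def bs_eq_ns One_nat_def by (rule ns_ratio_mono) auto

lemma tilt_bounds:
  assumes "0 \<le> s"
  shows "q \<le> tilt n s" "tilt n s \<le> r"
  using ns_lower_upper[of "{..<n}" "\<lambda>_. s" 0] bs_pos[OF assms, of n 0] assms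
  by (auto simp: tilt_def bs_eq_ns divide_simps mult_ac)

text \<open>
  The logarithmic derivative of \<open>bs n 0\<close> is at most \<open>\<psi>\<close>, because the coefficient of \<open>s\<^sup>j\<close> in the
  derivative is \<open>(n - j) \<theta>\<^sub>j\<^sub>+\<^sub>1 / \<theta>\<^sub>j\<close> times that in \<open>bs n 0\<close>. The bound
  \<open>b\<^sup>j - a\<^sup>j \<le> j b\<^sup>j\<^sup>-\<^sup>1 (b - a)\<close> takes the place of differentiation.
\<close>

lemma bs_diff_le:
  assumes psi: "\<And>k. k < n \<Longrightarrow> real (n - k) * \<theta> (Suc k) \<le> \<psi> * \<theta> k" and "0 \<le> \<psi>" and ab: "0 \<le> a" "a \<le> b"
  shows "bs n 0 b - bs n 0 a \<le> \<psi> * (b - a) * bs n 0 b"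
proof (cases n)
  case 0
  then show ?thesis using assms pos[of 0] by simp
next
  case (Suc m)
  have pw: "b ^ j - a ^ j \<le> real j * b ^ (j - 1) * (b - a)" for j
  proof (induction j)
    case (Suc j)
    have "b ^ Suc j - a ^ Suc j = b * (b ^ j - a ^ j) + a ^ j * (b - a)"
      by (simp add: algebra_simps)
    also have "\<dots> \<le> b * (real j * b ^ (j - 1) * (b - a)) + b ^ j * (b - a)"
      using Suc ab by (intro add_mono mult_left_mono mult_right_mono power_mono) auto
    also have "\<dots> = real (Suc j) * b ^ (Suc j - 1) * (b - a)"
      by (cases j) (auto simp: algebra_simps)
    finally show ?case .
  qed simp
  have "bs n 0 b - bs n 0 a = (\<Sum>j\<le>n. real (n choose j) * \<theta> j * (b ^ j - a ^ j))"
    by (simp add: binom_sum_def sum_subtractf algebra_simps)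
  also have "\<dots> \<le> (\<Sum>j\<le>n. real (n choose j) * \<theta> j * (real j * b ^ (j - 1) * (b - a)))"
    by (intro sum_mono mult_left_mono pw) (simp add: less_imp_le[OF pos])
  also have "\<dots> = (b - a) * (\<Sum>j\<le>m. real (Suc j * (n choose Suc j)) * \<theta> (Suc j) * b ^ j)"
    unfolding Suc by (subst sum.atMost_Suc_shift) (simp add: sum_distrib_left mult_ac del: binomial_Suc_Suc mult_Suc)
  also have "\<dots> = (b - a) * (\<Sum>j\<le>m. real (n choose j) * (real (n - j) * \<theta> (Suc j)) * b ^ j)"
  proof -
    have "Suc j * (n choose Suc j) = (n choose j) * (n - j)" for j
      using binomial_absorb_comp[of "Suc m" j] Suc_times_binomial[of j m]
      unfolding Suc by (simp only: diff_Suc_1 mult.commute[of "_ choose _" "_ - _"])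
    then have "real (Suc j * (n choose Suc j)) = real (n choose j) * real (n - j)" for j
      by (simp only: of_nat_mult)
    then show ?thesis by (simp only: mult.assoc)
  qed
  also have "\<dots> \<le> (b - a) * (\<Sum>j\<le>m. real (n choose j) * (\<psi> * \<theta> j) * b ^ j)"
    using ab Suc by (intro mult_left_mono sum_mono mult_right_mono psi) auto
  also have "\<dots> = \<psi> * (b - a) * (\<Sum>j\<le>m. real (n choose j) * \<theta> j * b ^ j)"
    by (simp add: sum_distrib_left mult_ac)
  also have "\<dots> \<le> \<psi> * (b - a) * bs n 0 b"
    unfolding binom_sum_def using ab assms(2) Suc
    by (intro mult_left_mono sum_mono2) (auto simp: less_imp_le[OF pos])
  finally show ?thesis .
qed

text \<open>
  Since every ratio is at most \<open>r\<close>, the numerator of \<open>tilt\<close> grows at most \<open>r\<close> times as fast as its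
  denominator, so the quotient grows only by the gap between \<open>r\<close> and its present value, and that gap
  is at most \<open>r - q\<close>.
\<close>

lemma tilt_diff_le:
  assumes psi: "\<And>k. k < n \<Longrightarrow> real (n - k) * \<theta> (Suc k) \<le> \<psi> * \<theta> k" and "0 \<le> \<psi>" and ab: "0 \<le> a" "a \<le> b"
  shows "tilt n b - tilt n a \<le> (r - q) * \<psi> * (b - a)"
proof -
  note p = bs_pos[OF ab(1), of n 0] bs_pos[OF order_trans[OF ab], of n 0]
  have "bs n 1 b - bs n 1 a = (\<Sum>j\<le>n. real (n choose j) * \<theta> (Suc j) * (b ^ j - a ^ j))"
    by (simp add: binom_sum_def sum_subtractf algebra_simps)
  also have "\<dots> \<le> (\<Sum>j\<le>n. real (n choose j) * (r * \<theta> j) * (b ^ j - a ^ j))"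
    using ab by (intro sum_mono mult_right_mono mult_left_mono upper) (auto simp: power_mono)
  also have "\<dots> = r * (bs n 0 b - bs n 0 a)"
    by (simp add: binom_sum_def sum_subtractf algebra_simps sum_distrib_left)
  finally have *: "bs n 1 b \<le> bs n 1 a + r * (bs n 0 b - bs n 0 a)" by simp
  have a: "bs n 1 a = tilt n a * bs n 0 a" using p by (simp add: tilt_def)
  have "(tilt n b - tilt n a) * bs n 0 b = bs n 1 b - tilt n a * bs n 0 b"
    using p by (simp add: tilt_def algebra_simps)
  also have "\<dots> \<le> (r - tilt n a) * (bs n 0 b - bs n 0 a)"
    using * a by (simp add: algebra_simps)
  also have "\<dots> \<le> (r - q) * (\<psi> * (b - a) * bs n 0 b)"
    using tilt_bounds[OF ab(1), of n] q_le_r bs_diff_le[OF psi assms(2) ab] bs_mono[OF ab, of n 0]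
    by (intro mult_mono) auto
  finally have "(tilt n b - tilt n a) * bs n 0 b \<le> ((r - q) * \<psi> * (b - a)) * bs n 0 b"
    by (simp add: mult_ac)
  then show ?thesis using p(2) by simp
qed

text \<open>
  With \<open>f = bs n 0\<close> the sum is \<open>s f'(s) - f(s)\<close>. Only the summand \<open>j = 0\<close> is negative, and replacing \<open>\<theta>\<^sub>j\<close> by \<open>q\<^sup>j \<theta>\<^sub>0\<close> leaves it
  unchanged while lowering the others; what remains is explicit by the binomial theorem.
\<close>

lemma bs_superlinear_derivative:
  assumes z: "1 \<le> (real n - 1) * (q * s)" and s: "0 \<le> s"
  shows "0 \<le> (\<Sum>j\<le>n. (real j - 1) * (real (n choose j) * \<theta> j * s ^ j))"
proof -
  define z where "z = q * s"
  have z0: "0 \<le> z" using s q_pos by (simp add: z_def)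
  obtain m where n: "n = Suc m" using z z0 by (cases n) (auto simp: z_def)
  have "(\<Sum>j\<le>n. real j * (real (n choose j) * z ^ j)) = real n * z * (1 + z) ^ m"
  proof -
    have "(\<Sum>j\<le>n. real j * (real (n choose j) * z ^ j))
        = (\<Sum>j\<le>m. real (Suc j * (n choose Suc j)) * (z * z ^ j))"
      unfolding n by (subst sum.atMost_Suc_shift) (simp add: mult_ac del: binomial_Suc_Suc mult_Suc)
    also have "\<dots> = (\<Sum>j\<le>m. real n * z * (real (m choose j) * z ^ j))"
      unfolding n Suc_times_binomial of_nat_mult by (intro sum.cong refl) (simp only: mult_ac)
    also have "\<dots> = real n * z * (1 + z) ^ m"
      unfolding sum_distrib_left[symmetric] using binomial_ring[of z 1 m] by (simp add: add.commute)
    finally show ?thesis .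
  qed
  moreover have "(\<Sum>j\<le>n. real (n choose j) * z ^ j) = (1 + z) ^ n"
    using binomial_ring[of z 1 n] by (simp add: add.commute)
  ultimately have "(\<Sum>j\<le>n. (real j - 1) * (real (n choose j) * z ^ j)) = (1 + z) ^ m * (real n * z - (1 + z))"
    by (simp add: left_diff_distrib sum_subtractf n algebra_simps)
  also have "0 \<le> \<dots>"
    using z z0 by (intro mult_nonneg_nonneg) (auto simp: z_def[symmetric] algebra_simps)
  finally have "0 \<le> \<theta> 0 * (\<Sum>j\<le>n. (real j - 1) * (real (n choose j) * z ^ j))"
    using pos[of 0] by simp
  also have "\<dots> = (\<Sum>j\<le>n. (real j - 1) * (real (n choose j) * (q ^ j * \<theta> 0) * s ^ j))"
    by (simp add: sum_distrib_left z_def power_mult_distrib mult_ac)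
  also have "\<dots> \<le> (\<Sum>j\<le>n. (real j - 1) * (real (n choose j) * \<theta> j * s ^ j))"
  proof (rule sum_mono)
    fix j
    show "(real j - 1) * (real (n choose j) * (q ^ j * \<theta> 0) * s ^ j)
        \<le> (real j - 1) * (real (n choose j) * \<theta> j * s ^ j)"
      by (cases j) (use s power_lower[of j] in \<open>auto intro!: mult_left_mono mult_right_mono\<close>)
  qed
  finally show ?thesis .
qed

text \<open>
  Bernoulli's inequality turns the bound on the
  derivative at \<open>s\<close> into a bound at \<open>t\<close>.
\<close>

lemma bs_superlinear:
  assumes z: "1 \<le> (real n - 1) * (q * s)" and s: "0 < s" "s \<le> t"
  shows "t * bs n 0 s \<le> s * bs n 0 t"
proof -
  define u where "u = t / s - 1"
  have u: "0 \<le> u" "t = s * (1 + u)" using s by (auto simp: u_def)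
  have "0 \<le> u * (\<Sum>j\<le>n. (real j - 1) * (real (n choose j) * \<theta> j * s ^ j))"
    using bs_superlinear_derivative[OF z] s u by simp
  then have "(1 + u) * bs n 0 s \<le> (\<Sum>j\<le>n. (1 + real j * u) * (real (n choose j) * \<theta> j * s ^ j))"
    by (simp add: binom_sum_def algebra_simps sum_subtractf sum.distrib sum_distrib_left)
  also have "\<dots> \<le> (\<Sum>j\<le>n. (1 + u) ^ j * (real (n choose j) * \<theta> j * s ^ j))"
    using u s by (intro sum_mono mult_right_mono Bernoulli_inequality) (auto simp: less_imp_le[OF pos])
  also have "\<dots> = bs n 0 t"
    by (simp add: binom_sum_def u(2) power_mult_distrib mult_ac)
  finally have "s * ((1 + u) * bs n 0 s) \<le> s * bs n 0 t" using s by simp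
  then show ?thesis by (simp add: u(2) mult_ac)
qed

lemma bs_exp_le:
  assumes "0 \<le> s"
  shows "bs n 0 s \<le> \<theta> 0 * exp (real n * r * s)"
proof -
  have "bs n 0 s \<le> (\<Sum>j\<le>n. real (n choose j) * (r ^ j * \<theta> 0) * s ^ j)"
    unfolding binom_sum_def using assms power_upper
    by (intro sum_mono mult_right_mono mult_left_mono) auto
  also have "\<dots> = \<theta> 0 * (1 + r * s) ^ n"
    using binomial_ring[of "r * s" 1 n]
    by (simp add: sum_distrib_left power_mult_distrib mult_ac add.commute)
  also have "\<dots> \<le> \<theta> 0 * exp (r * s) ^ n"
    using pos[of 0] assms r_pos by (intro mult_left_mono power_mono) (auto simp: less_imp_le)
  finally show ?thesis using exp_of_nat_mult[of n "r * s"] by (simp add: mult.assoc)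
qed

end

section \<open>The interval recursion and its limits\<close>

locale tree_weights = weights +
  fixes d :: nat and lam :: real
  assumes d_ge: "2 \<le> d" and lam_pos: "0 < lam"
begin

text \<open>
  The first component of a node's message when all its \<open>d\<close> children send \<open>(x, y)\<close>; the second
  component is \<open>tilt d x\<close>. It increases in \<open>y\<close> and decreases
  in \<open>x\<close>, so the model is monotone once the tree is split into even and odd levels.
\<close>

definition gain :: "real \<Rightarrow> real \<Rightarrow> real" where
  "gain y x = lam * y ^ d / bs d 0 x"

lemma gain_mono:
  assumes "0 \<le> y" "y \<le> y'" "0 \<le> x'" "x' \<le> x"
  shows "gain y x \<le> gain y' x'"
  unfolding gain_def using assms lam_pos bs_pos[of x' d 0] bs_mono[of x' x d 0]
  by (intro frac_le mult_left_mono power_mono) auto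

lemma gain_nonneg: "0 \<le> y \<Longrightarrow> 0 \<le> x \<Longrightarrow> 0 \<le> gain y x"
  unfolding gain_def using lam_pos bs_pos[of x d 0] by simp

text \<open>
  One step of the recursion is a contraction for small \<open>lam\<close>: the change through the grandchildren costs
  the factor \<open>d (r - q)\<close>, the change through the children the factor \<open>r\<close>.
\<close>

lemma gain_diff_le:
  assumes psi: "\<And>k. k < d \<Longrightarrow> real (d - k) * \<theta> (Suc k) \<le> \<psi> * \<theta> k" and psi0: "0 \<le> \<psi>"
    and ab: "0 \<le> a" "a \<le> b"
  shows "gain (tilt d b) a - gain (tilt d a) b
    \<le> lam * \<psi> / \<theta> 0 * r ^ (d - 1) * (r + real d * (r - q)) * (b - a)"
proof -
  let ?f = "bs d 0" and ?A = "tilt d a" and ?B = "tilt d b"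
  have b: "0 \<le> b" using ab by simp
  note p = bs_pos[OF ab(1), of d 0] bs_pos[OF b, of d 0]
  note A = tilt_bounds[OF ab(1), of d] and B = tilt_bounds[OF b, of d]
  have AB: "?A \<le> ?B" using tilt_mono[OF ab] .
  have A0: "0 \<le> ?A" using A q_pos by simp
  have fa: "\<theta> 0 \<le> ?f a" by (rule bs_ge[OF ab(1)])
  obtain m where d: "d = Suc m" using d_ge by (cases d) auto
  have "?B ^ d - ?A ^ d = (?B - ?A) * (\<Sum>i<d. ?A ^ (d - Suc i) * ?B ^ i)"
    by (rule power_diff_sumr2)
  also have "\<dots> \<le> (?B - ?A) * (\<Sum>i<d. r ^ (d - Suc i) * r ^ i)"
    using A0 AB A B by (intro mult_left_mono sum_mono mult_mono power_mono) auto
  also have "(\<Sum>i<d. r ^ (d - Suc i) * r ^ i) = (\<Sum>i<d. r ^ (d - 1))"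
    by (intro sum.cong refl) (simp add: power_add[symmetric])
  also have "(?B - ?A) * \<dots> \<le> ((r - q) * \<psi> * (b - a)) * (\<Sum>i<d. r ^ (d - 1))"
    using tilt_diff_le[OF psi psi0 ab] r_pos by (intro mult_right_mono sum_nonneg) auto
  finally have pow: "?B ^ d - ?A ^ d \<le> (real d * (r - q)) * (\<psi> * r ^ (d - 1) * (b - a))"
    by (simp add: mult_ac)
  have pow0: "0 \<le> ?B ^ d - ?A ^ d" using power_mono[OF AB A0] by simp
  have inv: "1 / ?f a - 1 / ?f b \<le> \<psi> * (b - a) / \<theta> 0"
  proof -
    have "1 / ?f a - 1 / ?f b = (?f b - ?f a) / ?f b / ?f a"
      using p by (simp add: divide_simps)
    also have "\<dots> \<le> (\<psi> * (b - a) * ?f b) / ?f b / ?f a"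
      using p bs_diff_le[OF psi psi0 ab] by (intro divide_right_mono) auto
    also have "\<dots> = \<psi> * (b - a) / ?f a" using p by simp
    also have "\<dots> \<le> \<psi> * (b - a) / \<theta> 0"
      using p fa pos[of 0] ab psi0 by (intro divide_left_mono) auto
    finally show ?thesis .
  qed
  have inv0: "0 \<le> 1 / ?f a - 1 / ?f b"
    using p bs_mono[OF ab, of d 0] by (simp add: frac_le)
  have "gain ?B a - gain ?A b = lam * ((?B ^ d - ?A ^ d) / ?f a + ?A ^ d * (1 / ?f a - 1 / ?f b))"
    using p by (simp add: gain_def field_simps)
  also have "\<dots> \<le> lam * ((real d * (r - q)) * (\<psi> * r ^ (d - 1) * (b - a)) / \<theta> 0
      + r ^ d * (\<psi> * (b - a) / \<theta> 0))"
    using lam_pos pow inv inv0 pow0 fa pos[of 0] A A0 r_pos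
    by (intro mult_left_mono add_mono frac_le mult_mono power_mono) auto
  also have "\<dots> = lam * \<psi> / \<theta> 0 * r ^ (d - 1) * (r + real d * (r - q)) * (b - a)"
    unfolding d using pos[of 0] by (simp add: field_simps)
  finally show ?thesis .
qed

text \<open>
  Intervals that contain the pair of messages of a node whose distance to the boundary is \<open>n\<close>, whatever
  the boundary condition. The endpoints are paired crosswise because \<open>gain\<close> decreases in its second
  argument.
\<close>

primrec env :: "nat \<Rightarrow> (real \<times> real) \<times> (real \<times> real)" where
  "env 0 = ((0, gain r 0), (q, r))"
| "env (Suc n) = (case env n of ((xl, xh), (yl, yh)) \<Rightarrow>
     ((gain yl xh, gain yh xl), (tilt d xl, tilt d xh)))"

definition xlo :: "nat \<Rightarrow> real" where "xlo n = fst (fst (env n))"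
definition xhi :: "nat \<Rightarrow> real" where "xhi n = snd (fst (env n))"
definition ylo :: "nat \<Rightarrow> real" where "ylo n = fst (snd (env n))"
definition yhi :: "nat \<Rightarrow> real" where "yhi n = snd (snd (env n))"

lemmas env_defs = xlo_def xhi_def ylo_def yhi_def

lemma env_0: "xlo 0 = 0" "xhi 0 = gain r 0" "ylo 0 = q" "yhi 0 = r"
  by (simp_all add: env_defs)

lemma env_Suc: "xlo (Suc n) = gain (ylo n) (xhi n)" "xhi (Suc n) = gain (yhi n) (xlo n)"
  "ylo (Suc n) = tilt d (xlo n)" "yhi (Suc n) = tilt d (xhi n)"
  by (simp_all add: env_defs case_prod_beta)

lemma env_bounds: "0 \<le> xlo n \<and> xlo n \<le> xhi n \<and> q \<le> ylo n \<and> ylo n \<le> yhi n \<and> yhi n \<le> r"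
proof (induction n)
  case 0
  then show ?case using q_pos q_le_r r_pos by (simp add: env_0 gain_nonneg)
next
  case (Suc n)
  then show ?case
    using q_pos by (auto simp: env_Suc intro!: gain_nonneg gain_mono tilt_mono tilt_bounds)
qed

lemma env_nested: "xlo n \<le> xlo (Suc n) \<and> xhi (Suc n) \<le> xhi n \<and> ylo n \<le> ylo (Suc n) \<and> yhi (Suc n) \<le> yhi n"
proof (induction n)
  case 0
  show ?case using env_bounds[of 0] r_pos q_pos
    by (auto simp: env_0 env_Suc intro!: gain_nonneg gain_mono tilt_bounds)
next
  case (Suc n)
  have "0 \<le> xlo n" "0 \<le> ylo n" "0 \<le> xhi (Suc n)" "0 \<le> yhi (Suc n)"
    using env_bounds[of n] env_bounds[of "Suc n"] q_pos by linarith+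
  with Suc have "gain (ylo n) (xhi n) \<le> gain (ylo (Suc n)) (xhi (Suc n))"
    "gain (yhi (Suc n)) (xlo (Suc n)) \<le> gain (yhi n) (xlo n)"
    "tilt d (xlo n) \<le> tilt d (xlo (Suc n))" "tilt d (xhi (Suc n)) \<le> tilt d (xhi n)"
    by (auto intro!: gain_mono tilt_mono)
  then show ?case by (simp only: env_Suc simp_thms)
qed

definition xl_lim :: real where "xl_lim = lim xlo"
definition xh_lim :: real where "xh_lim = lim xhi"

lemma xlo_tendsto: "xlo \<longlonglongrightarrow> xl_lim"
proof -
  have "incseq xlo" using env_nested by (intro incseq_SucI) auto
  moreover have "decseq xhi" using env_nested by (intro decseq_SucI) auto
  then have "xlo n \<le> xhi 0" for n
    using env_bounds[of n] decseqD[of xhi 0 n] by simp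
  ultimately obtain L where "xlo \<longlonglongrightarrow> L"
    using incseq_convergent[of xlo "xhi 0"] by blast
  then show ?thesis by (simp add: xl_lim_def limI)
qed

lemma xhi_tendsto: "xhi \<longlonglongrightarrow> xh_lim"
proof -
  have "decseq xhi" using env_nested by (intro decseq_SucI) auto
  moreover have "0 \<le> xhi n" for n using env_bounds[of n] by linarith
  ultimately obtain L where "xhi \<longlonglongrightarrow> L"
    using decseq_convergent[of xhi 0] by blast
  then show ?thesis by (simp add: xh_lim_def limI)
qed

lemma lim_bounds: "0 \<le> xl_lim" "xl_lim \<le> xh_lim"
proof -
  show "0 \<le> xl_lim"
    by (rule LIMSEQ_le_const[OF xlo_tendsto]) (use env_bounds in blast)
  show "xl_lim \<le> xh_lim"
    by (rule LIMSEQ_le[OF xlo_tendsto xhi_tendsto]) (use env_bounds in blast)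
qed

lemma tendsto_bs: "f \<longlonglongrightarrow> x \<Longrightarrow> (\<lambda>n. bs m k (f n)) \<longlonglongrightarrow> bs m k x"
  unfolding binom_sum_def by (intro tendsto_intros)

lemma tendsto_tilt: "f \<longlonglongrightarrow> x \<Longrightarrow> 0 \<le> x \<Longrightarrow> (\<lambda>n. tilt m (f n)) \<longlonglongrightarrow> tilt m x"
  unfolding tilt_def using bs_pos[of x m 0] by (intro tendsto_divide tendsto_bs) auto

lemma tendsto_gain:
  "g \<longlonglongrightarrow> y \<Longrightarrow> f \<longlonglongrightarrow> x \<Longrightarrow> 0 \<le> x \<Longrightarrow> (\<lambda>n. gain (g n) (f n)) \<longlonglongrightarrow> gain y x"
  unfolding gain_def using bs_pos[of x d 0] by (intro tendsto_intros tendsto_bs) auto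

lemma ylo_tendsto: "ylo \<longlonglongrightarrow> tilt d xl_lim"
proof -
  have "(\<lambda>n. ylo (Suc n)) \<longlonglongrightarrow> tilt d xl_lim"
    unfolding env_Suc using xlo_tendsto lim_bounds by (intro tendsto_tilt)
  then show ?thesis by (rule LIMSEQ_imp_Suc)
qed

lemma yhi_tendsto: "yhi \<longlonglongrightarrow> tilt d xh_lim"
proof -
  have "(\<lambda>n. yhi (Suc n)) \<longlonglongrightarrow> tilt d xh_lim"
    unfolding env_Suc using xhi_tendsto lim_bounds by (intro tendsto_tilt) auto
  then show ?thesis by (rule LIMSEQ_imp_Suc)
qed

lemma lim_fixed: "xl_lim = gain (tilt d xl_lim) xh_lim" "xh_lim = gain (tilt d xh_lim) xl_lim"
proof -
  have "(\<lambda>n. xlo (Suc n)) \<longlonglongrightarrow> gain (tilt d xl_lim) xh_lim"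
    unfolding env_Suc using ylo_tendsto xhi_tendsto lim_bounds by (intro tendsto_gain) auto
  then show "xl_lim = gain (tilt d xl_lim) xh_lim"
    using LIMSEQ_unique[OF LIMSEQ_Suc[OF xlo_tendsto]] by blast
  have "(\<lambda>n. xhi (Suc n)) \<longlonglongrightarrow> gain (tilt d xh_lim) xl_lim"
    unfolding env_Suc using yhi_tendsto xlo_tendsto lim_bounds by (intro tendsto_gain) auto
  then show "xh_lim = gain (tilt d xh_lim) xl_lim"
    using LIMSEQ_unique[OF LIMSEQ_Suc[OF xhi_tendsto]] by blast
qed

text \<open>
  The length of the limiting interval is at most a factor below one times itself.
\<close>

lemma small_lam_lim_eq:
  assumes psi: "\<And>k. k < d \<Longrightarrow> real (d - k) * \<theta> (Suc k) \<le> \<psi> * \<theta> k" and psi0: "0 \<le> \<psi>"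
    and small: "lam * \<psi> / \<theta> 0 * r ^ (d - 1) * (r + real d * (r - q)) < 1"
  shows "xl_lim = xh_lim"
proof (rule ccontr)
  assume "xl_lim \<noteq> xh_lim"
  then have lt: "0 < xh_lim - xl_lim" using lim_bounds by simp
  have "xh_lim - xl_lim \<le> lam * \<psi> / \<theta> 0 * r ^ (d - 1) * (r + real d * (r - q)) * (xh_lim - xl_lim)"
    using gain_diff_le[OF psi psi0 lim_bounds] lim_fixed by simp
  also have "\<dots> < 1 * (xh_lim - xl_lim)"
    using lt small by (intro mult_strict_right_mono)
  finally show False by simp
qed

text \<open>
  A pair \<open>A \<le> B\<close> that one step of the recursion pushes apart stays inside all the intervals.
\<close>

lemma env_trapped:
  assumes AB: "0 \<le> A" "A \<le> B" and lowA: "gain (tilt d A) B \<le> A" and highB: "B \<le> gain (tilt d B) A"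
  shows "xlo n \<le> A \<and> B \<le> xhi n \<and> ylo n \<le> tilt d A \<and> tilt d B \<le> yhi n"
proof (induction n)
  case 0
  have "gain (tilt d B) A \<le> gain r 0"
    using AB tilt_bounds[of B d] q_pos by (intro gain_mono) auto
  then show ?case using AB highB tilt_bounds[of A d] tilt_bounds[of B d] by (simp add: env_0)
next
  case (Suc n)
  have p: "0 \<le> xlo n" "0 \<le> ylo n" "0 \<le> tilt d B" "0 \<le> B"
    using env_bounds[of n] q_pos tilt_bounds[of B d] AB by linarith+
  have "gain (ylo n) (xhi n) \<le> gain (tilt d A) B" "gain (tilt d B) A \<le> gain (yhi n) (xlo n)"
    using Suc p by (auto intro!: gain_mono)
  moreover have "tilt d (xlo n) \<le> tilt d A" "tilt d B \<le> tilt d (xhi n)"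
    using Suc p by (auto intro!: tilt_mono)
  ultimately show ?case using lowA highB by (simp add: env_Suc)
qed

text \<open>
  If the limits had a common value \<open>x\<close>, then \<open>x\<close> would be a fixed point of the one-variable recursion. For
  large \<open>lam\<close> it exceeds the point \<open>A\<close> beyond which \<open>bs d 0\<close> grows faster than linearly, so the
  recursion repels from \<open>x\<close> in an alternating way, and \<open>A\<close> together with its mirror image
  \<open>x\<^sup>2 / A\<close> forms a pair as in \<open>env_trapped\<close>.
\<close>

lemma large_lam_lim_less:
  assumes large: "3 * \<theta> 0 / real (Suc d) * exp (3 * r / q) < lam * q ^ Suc d"
  shows "xl_lim < xh_lim"
proof (rule ccontr)
  assume "\<not> xl_lim < xh_lim"
  define x where "x = xl_lim"
  with lim_bounds \<open>\<not> xl_lim < xh_lim\<close> have "xh_lim = x" by simp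
  then have fx: "x = gain (tilt d x) x" and x0: "0 \<le> x"
    using lim_fixed(1) lim_bounds by (simp_all add: x_def)
  define A where "A = 3 / real (Suc d) / q"
  have A0: "0 < A" using q_pos by (simp add: A_def)
  have A_eq: "real (Suc d) * A = 3 / q" and qA: "q * A = 3 / real (Suc d)"
    using q_pos by (simp_all add: A_def del: of_nat_Suc)
  \<comment> \<open>This is where the constant 3 comes from: \<open>3 (d - 1) \<ge> d + 1\<close> as soon as \<open>d \<ge> 2\<close>.\<close>
  have A1: "1 \<le> (real d - 1) * (q * A)"
    unfolding qA using d_ge by (simp add: le_divide_eq)
  have "A < x"
  proof (rule ccontr)
    assume "\<not> A < x"
    have "bs d 0 A \<le> \<theta> 0 * exp (real d * r * A)" by (rule bs_exp_le) (use A0 in simp)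
    also have "\<dots> \<le> \<theta> 0 * exp (3 * r / q)"
    proof -
      have "r * (real d * A) \<le> r * (real (Suc d) * A)" using A0 r_pos by simp
      then show ?thesis unfolding A_eq using pos[of 0] by (simp add: mult_ac)
    qed
    finally have bA: "bs d 0 A \<le> \<theta> 0 * exp (3 * r / q)" .
    have "q * (A * bs d 0 A) \<le> q * (A * (\<theta> 0 * exp (3 * r / q)))"
      using A0 q_pos bA by simp
    also have "\<dots> = 3 * \<theta> 0 / real (Suc d) * exp (3 * r / q)"
      unfolding mult.assoc[symmetric] qA by (simp del: of_nat_Suc)
    also have "\<dots> < q * (lam * q ^ d)" using large by (simp add: mult_ac)
    finally have "A * bs d 0 A < lam * q ^ d" using q_pos by simp
    then have "A < gain q A"
      using bs_pos[of A d 0] A0 by (simp add: gain_def pos_less_divide_eq)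
    also have "\<dots> \<le> gain (tilt d x) x"
      using \<open>\<not> A < x\<close> x0 q_pos tilt_bounds[OF x0] by (intro gain_mono) auto
    finally show False using fx \<open>\<not> A < x\<close> by simp
  qed
  define B where "B = x * x / A"
  have xB: "x \<le> B" using \<open>A < x\<close> A0 by (simp add: B_def field_simps)
  have "A < B" using \<open>A < x\<close> xB by simp
  let ?f = "bs d 0" and ?c = "lam * tilt d x ^ d"
  have fp: "0 < ?f A" "0 < ?f B" "0 < ?f x" using A0 x0 xB by (auto intro!: bs_pos)
  have c: "?c = x * ?f x" using fx fp by (simp add: gain_def field_simps)
  \<comment> \<open>Substituting \<open>B = x * x / A\<close> reduces both trapping inequalities to superlinearity,
    between \<open>A\<close> and \<open>x\<close> and between \<open>x\<close> and \<open>B\<close>.\<close>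
  have up: "x * ?f A \<le> A * ?f x" by (rule bs_superlinear[OF A1 A0]) (use \<open>A < x\<close> in simp)
  have "1 \<le> (real d - 1) * (q * x)"
  proof -
    have "(real d - 1) * (q * A) \<le> (real d - 1) * (q * x)"
      using \<open>A < x\<close> q_pos d_ge by (intro mult_left_mono) auto
    with A1 show ?thesis by simp
  qed
  then have down: "B * ?f x \<le> x * ?f B" using xB \<open>A < x\<close> A0 by (intro bs_superlinear) auto
  have "gain (tilt d A) B \<le> ?c / ?f B"
    unfolding gain_def using A0 \<open>A < x\<close> fp lam_pos tilt_mono[of A x d] tilt_bounds[of A d] q_pos
    by (intro divide_right_mono mult_left_mono power_mono) auto
  also have "\<dots> \<le> A"
  proof -
    have "x * ?f x * x = A * (B * ?f x)" using A0 by (simp add: B_def field_simps)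
    also have "\<dots> \<le> A * (x * ?f B)" using down A0 by simp
    finally have "x * ?f x \<le> A * ?f B" using \<open>A < x\<close> A0 by (simp add: mult_ac)
    then show ?thesis using c fp by (simp add: pos_divide_le_eq)
  qed
  finally have lowA: "gain (tilt d A) B \<le> A" .
  have "B \<le> ?c / ?f A"
  proof -
    have "A * (B * ?f A) = x * (x * ?f A)" using A0 by (simp add: B_def)
    also have "\<dots> \<le> x * (A * ?f x)" using up x0 by (intro mult_left_mono)
    finally have "A * (B * ?f A) \<le> A * (x * ?f x)" by (simp add: mult_ac)
    then have "B * ?f A \<le> x * ?f x" using A0 by simp
    then show ?thesis using c fp by (simp add: pos_le_divide_eq)
  qed
  also have "\<dots> \<le> gain (tilt d B) A"
    unfolding gain_def using x0 xB fp lam_pos tilt_mono[of x B d] tilt_bounds[OF x0, of d] q_pos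
    by (intro divide_right_mono mult_left_mono power_mono) auto
  finally have highB: "B \<le> gain (tilt d B) A" .
  have tr: "xlo n \<le> A \<and> B \<le> xhi n" for n
    using env_trapped[OF _ _ lowA highB, of n] A0 \<open>A < B\<close> by auto
  have "xl_lim \<le> A" by (rule LIMSEQ_le_const2[OF xlo_tendsto]) (use tr in blast)
  then show False using \<open>A < x\<close> x_def by simp
qed

end

section \<open>Weights on balls of the tree and removal of the last level\<close>

lemma sum_PiE_Un:
  fixes h :: "('a \<Rightarrow> 'b) \<Rightarrow> real"
  assumes "A \<inter> B = {}"
  shows "(\<Sum>s\<in>A \<union> B \<rightarrow>\<^sub>E D. h s) = (\<Sum>s\<in>A \<rightarrow>\<^sub>E D. \<Sum>t\<in>B \<rightarrow>\<^sub>E D. h (merge A B (s, t)))"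
proof -
  have "(\<Sum>s\<in>A \<union> B \<rightarrow>\<^sub>E D. h s) = (\<Sum>p\<in>(A \<rightarrow>\<^sub>E D) \<times> (B \<rightarrow>\<^sub>E D). h (merge A B p))"
  proof (rule sum.reindex_bij_witness[where i = "merge A B" and j = "\<lambda>s. (restrict s A, restrict s B)"])
    fix s assume s: "s \<in> A \<union> B \<rightarrow>\<^sub>E D"
    show *: "merge A B (restrict s A, restrict s B) = s"
      using s by (auto simp: merge_def fun_eq_iff PiE_def extensional_def)
    show "(restrict s A, restrict s B) \<in> (A \<rightarrow>\<^sub>E D) \<times> (B \<rightarrow>\<^sub>E D)" using s by auto
    show "h (merge A B (restrict s A, restrict s B)) = h s" by (simp only: *)
  next
    fix p assume p: "p \<in> (A \<rightarrow>\<^sub>E D) \<times> (B \<rightarrow>\<^sub>E D)"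
    show "(restrict (merge A B p) A, restrict (merge A B p) B) = p"
      using p assms by (cases p) (auto simp: merge_def fun_eq_iff PiE_def extensional_def restrict_def)
    show "merge A B p \<in> A \<union> B \<rightarrow>\<^sub>E D" using p by (cases p) (auto simp: merge_def PiE_iff extensional_def)
  qed
  then show ?thesis by (simp add: sum.cartesian_product case_prod_beta)
qed

lemma sum_PiE_UN_prod:
  fixes g :: "'i \<Rightarrow> ('a \<Rightarrow> 'b) \<Rightarrow> real"
  assumes "finite I" and "disjoint_family_on C I"
    and "\<And>i s t. i \<in> I \<Longrightarrow> (\<And>c. c \<in> C i \<Longrightarrow> s c = t c) \<Longrightarrow> g i s = g i t"
  shows "(\<Sum>s\<in>(\<Union>i\<in>I. C i) \<rightarrow>\<^sub>E D. \<Prod>i\<in>I. g i s) = (\<Prod>i\<in>I. \<Sum>s\<in>C i \<rightarrow>\<^sub>E D. g i s)"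
  using assms
proof (induction I)
  case (insert j I)
  let ?B = "\<Union>i\<in>I. C i"
  have disj: "C j \<inter> ?B = {}"
    using insert.prems(1) insert.hyps by (auto simp: disjoint_family_on_def)
  have gj: "g j (merge (C j) ?B (s, t)) = g j s" for s t
    by (rule insert.prems(2)) (auto simp: merge_def)
  have gi: "g i (merge (C j) ?B (s, t)) = g i t" if "i \<in> I" for i s t
    by (rule insert.prems(2)) (use that disj in \<open>auto simp: merge_def\<close>)
  have IH: "(\<Sum>s\<in>?B \<rightarrow>\<^sub>E D. \<Prod>i\<in>I. g i s) = (\<Prod>i\<in>I. \<Sum>s\<in>C i \<rightarrow>\<^sub>E D. g i s)"
  proof (rule insert.IH)
    show "disjoint_family_on C I" using insert.prems(1) by (simp add: disjoint_family_on_def)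
    show "g i s = g i t" if "i \<in> I" "\<And>c. c \<in> C i \<Longrightarrow> s c = t c" for i s t
      by (rule insert.prems(2)) (use that in simp_all)
  qed
  have "(\<Sum>s\<in>(\<Union>i\<in>insert j I. C i) \<rightarrow>\<^sub>E D. \<Prod>i\<in>insert j I. g i s)
      = (\<Sum>s\<in>C j \<rightarrow>\<^sub>E D. \<Sum>t\<in>?B \<rightarrow>\<^sub>E D. g j s * (\<Prod>i\<in>I. g i t))"
    using insert.hyps by (simp add: sum_PiE_Un[OF disj] gj gi cong: prod.cong)
  also have "\<dots> = (\<Sum>s\<in>C j \<rightarrow>\<^sub>E D. g j s) * (\<Sum>t\<in>?B \<rightarrow>\<^sub>E D. \<Prod>i\<in>I. g i t)"
    by (simp add: sum_product)
  finally show ?case using insert.hyps IH by simp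
qed simp

lemma exp_neg_sum:
  assumes "finite K" "\<And>i. i \<in> K \<Longrightarrow> f i \<noteq> -\<infinity>"
  shows "exp_neg (\<Sum>i\<in>K. f i) = (\<Prod>i\<in>K. exp_neg (f i))"
proof -
  have "(\<Sum>i\<in>K. f i) \<noteq> -\<infinity> \<and> exp_neg (\<Sum>i\<in>K. f i) = (\<Prod>i\<in>K. exp_neg (f i))"
    using assms
  proof (induction K)
    case (insert i K)
    then have "f i \<noteq> -\<infinity>" "(\<Sum>i\<in>K. f i) \<noteq> -\<infinity>"
      and "exp_neg (\<Sum>i\<in>K. f i) = (\<Prod>i\<in>K. exp_neg (f i))" by auto
    with insert.hyps show ?case
      by (cases "f i"; cases "\<Sum>i\<in>K. f i") (auto simp: exp_neg_def exp_add exp_minus exp_diff divide_inverse)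
  qed (simp add: exp_neg_def)
  then show ?thesis ..
qed

definition children :: "nat \<Rightarrow> nat list \<Rightarrow> nat list set" where
  "children \<Delta> i = (\<lambda>a. a # i) ` {..<(if i = [] then \<Delta> else \<Delta> - 1)}"

definition tree_level :: "nat \<Rightarrow> nat \<Rightarrow> nat list set" where
  "tree_level \<Delta> n = {i \<in> tree_nodes \<Delta>. length i = n}"

definition tree_ball :: "nat \<Rightarrow> nat \<Rightarrow> nat list set" where
  "tree_ball \<Delta> n = {i \<in> tree_nodes \<Delta>. length i \<le> n}"

lemma finite_children [simp]: "finite (children \<Delta> i)"
  by (simp add: children_def)

lemma card_children: "card (children \<Delta> i) = (if i = [] then \<Delta> else \<Delta> - 1)"
  by (simp add: children_def card_image inj_on_def)

lemma children_iff: "i \<in> tree_nodes \<Delta> \<Longrightarrow> c \<in> children \<Delta> i \<longleftrightarrow> c \<in> tree_nodes \<Delta> \<and> c \<noteq> [] \<and> tl c = i"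
  by (cases c) (auto simp: children_def tree_nodes_Cons_iff)

lemma childrenD: "c \<in> children \<Delta> i \<Longrightarrow> tl c = i \<and> c \<noteq> [] \<and> length c = Suc (length i)"
  by (auto simp: children_def)

lemma tl_node: "i \<in> tree_nodes \<Delta> \<Longrightarrow> tl i \<in> tree_nodes \<Delta>"
  by (cases i) (auto simp: tree_nodes_Cons_iff)

lemma closed_nbhd_eq:
  assumes "i \<in> tree_nodes \<Delta>"
  shows "closed_nbhd \<Delta> i = insert i (children \<Delta> i \<union> (if i = [] then {} else {tl i}))"
proof -
  have "(i, j) \<in> tree_edges \<Delta> \<longleftrightarrow> j \<in> children \<Delta> i \<or> (i \<noteq> [] \<and> j = tl i)" for j
    using assms tl_node[OF assms] unfolding children_iff[OF assms] tree_edges_def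
    by (cases i; cases j) auto
  then show ?thesis by (auto simp: closed_nbhd_def)
qed

lemma closed_nbhd_nodes: "i \<in> tree_nodes \<Delta> \<Longrightarrow> closed_nbhd \<Delta> i \<subseteq> tree_nodes \<Delta>"
  by (auto simp: closed_nbhd_eq children_iff tl_node)

lemma tree_level_Suc: "tree_level \<Delta> (Suc n) = (\<Union>i\<in>tree_level \<Delta> n. children \<Delta> i)"
proof (intro set_eqI iffI)
  fix c assume "c \<in> tree_level \<Delta> (Suc n)"
  then have "tl c \<in> tree_level \<Delta> n \<and> c \<in> children \<Delta> (tl c)"
    using tl_node[of c \<Delta>] by (auto simp: tree_level_def children_iff)
  then show "c \<in> (\<Union>i\<in>tree_level \<Delta> n. children \<Delta> i)" by auto
next
  fix c assume "c \<in> (\<Union>i\<in>tree_level \<Delta> n. children \<Delta> i)"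
  then show "c \<in> tree_level \<Delta> (Suc n)"
    by (auto simp: tree_level_def children_iff dest: childrenD)
qed

lemma disjoint_children: "disjoint_family_on (children \<Delta>) I"
  by (auto simp: disjoint_family_on_def dest: childrenD)

lemma finite_tree_level [simp]: "finite (tree_level \<Delta> n)"
proof (induction n)
  case 0
  have "tree_level \<Delta> 0 \<subseteq> {[]}" by (auto simp: tree_level_def)
  then show ?case by (rule finite_subset) simp
qed (simp add: tree_level_Suc)

lemma tree_ball_Suc: "tree_ball \<Delta> (Suc n) = tree_ball \<Delta> n \<union> tree_level \<Delta> (Suc n)"
  by (auto simp: tree_ball_def tree_level_def)

lemma tree_ball_level_disjoint: "tree_ball \<Delta> n \<inter> tree_level \<Delta> (Suc n) = {}"
  by (auto simp: tree_ball_def tree_level_def)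

lemma tree_ball_0: "tree_ball \<Delta> 0 = {[]}"
  by (auto simp: tree_ball_def tree_nodes.root)

lemma finite_tree_ball [simp]: "finite (tree_ball \<Delta> n)"
  by (induction n) (simp_all add: tree_ball_0 tree_ball_Suc)

lemma tree_ball_mono: "m \<le> n \<Longrightarrow> tree_ball \<Delta> m \<subseteq> tree_ball \<Delta> n"
  by (auto simp: tree_ball_def)

lemma finite_configs [simp]: "finite S \<Longrightarrow> finite (configs S)"
  by (simp add: configs_def finite_PiE)

lemma configs_01: "\<omega> \<in> configs S \<Longrightarrow> i \<in> S \<Longrightarrow> \<omega> i = 0 \<or> \<omega> i = 1"
  by (auto simp: configs_def PiE_iff)

lemma restrict_configs: "\<omega> \<in> configs S \<Longrightarrow> T \<subseteq> S \<Longrightarrow> restrict \<omega> T \<in> configs T"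
  by (auto simp: configs_def PiE_iff)

lemma merge_configs: "\<nu> \<in> configs A \<Longrightarrow> \<eta> \<in> configs B \<Longrightarrow> merge A B (\<nu>, \<eta>) \<in> configs (A \<union> B)"
  by (auto simp: configs_def PiE_iff merge_def extensional_def)

context tree_weights
begin

abbreviation nodes where "nodes \<equiv> tree_nodes (Suc d)"
abbreviation ch where "ch \<equiv> children (Suc d)"
abbreviation level where "level \<equiv> tree_level (Suc d)"
abbreviation tball where "tball \<equiv> tree_ball (Suc d)"

text \<open>
  The Boltzmann weight of a node with spin \<open>b\<close> and \<open>k\<close> occupied neighbours; it vanishes where the potential
  is infinite.
\<close>

definition wt :: "nat \<Rightarrow> nat \<Rightarrow> real" where
  "wt b k = (if b = 1 then if k = 0 then lam else 0 else \<theta> k)"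

text \<open>
  The value 0 at the root lets the count of occupied neighbours have the same form at every node.
\<close>

definition par :: "nat list \<Rightarrow> (nat list \<Rightarrow> nat) \<Rightarrow> nat" where
  "par i \<nu> = (if i = [] then 0 else \<nu> (tl i))"

definition node_weight :: "nat list \<Rightarrow> (nat list \<Rightarrow> nat) \<Rightarrow> real" where
  "node_weight i \<nu> = wt (\<nu> i) (par i \<nu> + (\<Sum>c\<in>ch i. \<nu> c))"

lemma wt_nonneg: "0 \<le> wt b k"
  using pos[of k] lam_pos by (simp add: wt_def)

lemma node_weight_nonneg: "0 \<le> node_weight i \<nu>"
  by (simp add: node_weight_def wt_nonneg)

lemma node_weight_cong:
  assumes "i \<in> nodes" "\<And>j. j \<in> closed_nbhd (Suc d) i \<Longrightarrow> \<nu> j = \<nu>' j"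
  shows "node_weight i \<nu> = node_weight i \<nu>'"
proof -
  have "\<nu> i = \<nu>' i" "par i \<nu> = par i \<nu>'" "(\<Sum>c\<in>ch i. \<nu> c) = (\<Sum>c\<in>ch i. \<nu>' c)"
    using assms by (auto simp: closed_nbhd_eq par_def intro!: sum.cong)
  then show ?thesis by (simp add: node_weight_def)
qed

lemma exp_neg_potential:
  assumes i: "i \<in> nodes" and 01: "\<omega> i = 0 \<or> \<omega> i = 1"
  shows "potential (Suc d) lam \<theta> i (restrict \<omega> (closed_nbhd (Suc d) i)) \<noteq> -\<infinity>"
    and "exp_neg (potential (Suc d) lam \<theta> i (restrict \<omega> (closed_nbhd (Suc d) i))) = node_weight i \<omega>"
proof -
  have *: "i \<notin> ch i" "i \<noteq> [] \<Longrightarrow> tl i \<notin> ch i" "i \<noteq> [] \<Longrightarrow> tl i \<noteq> i"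
    by (auto dest!: childrenD) (cases i; simp)
  have "(\<Sum>j\<in>closed_nbhd (Suc d) i. restrict \<omega> (closed_nbhd (Suc d) i) j)
      = (\<Sum>j\<in>closed_nbhd (Suc d) i. \<omega> j)" by (intro sum.cong) auto
  also have "\<dots> = \<omega> i + (par i \<omega> + (\<Sum>c\<in>ch i. \<omega> c))"
    using * by (auto simp: closed_nbhd_eq[OF i] par_def)
  finally have k: "(\<Sum>j\<in>closed_nbhd (Suc d) i. restrict \<omega> (closed_nbhd (Suc d) i) j)
      = \<omega> i + (par i \<omega> + (\<Sum>c\<in>ch i. \<omega> c))" .
  have ii: "restrict \<omega> (closed_nbhd (Suc d) i) i = \<omega> i" by (simp add: closed_nbhd_def)
  show "potential (Suc d) lam \<theta> i (restrict \<omega> (closed_nbhd (Suc d) i)) \<noteq> -\<infinity>"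
    by (simp add: potential_def Let_def)
  show "exp_neg (potential (Suc d) lam \<theta> i (restrict \<omega> (closed_nbhd (Suc d) i))) = node_weight i \<omega>"
    unfolding potential_def Let_def k ii using 01 pos lam_pos
    by (auto simp: exp_neg_def node_weight_def wt_def)
qed

text \<open>
  The nodes whose potential enters the Hamiltonian of \<open>\<Lambda>\<close>.
\<close>

definition touching :: "nat list set \<Rightarrow> nat list set" where
  "touching \<Lambda> = {i \<in> nodes. closed_nbhd (Suc d) i \<inter> \<Lambda> \<noteq> {}}"

lemma exp_neg_hamiltonian:
  assumes "finite (touching \<Lambda>)" "\<And>i. i \<in> touching \<Lambda> \<Longrightarrow> \<omega> i = 0 \<or> \<omega> i = 1"
  shows "exp_neg (hamiltonian (Suc d) lam \<theta> \<Lambda> \<omega>) = (\<Prod>i\<in>touching \<Lambda>. node_weight i \<omega>)"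
proof -
  have "exp_neg (hamiltonian (Suc d) lam \<theta> \<Lambda> \<omega>)
      = (\<Prod>i\<in>touching \<Lambda>. exp_neg (potential (Suc d) lam \<theta> i (restrict \<omega> (closed_nbhd (Suc d) i))))"
    unfolding hamiltonian_def touching_def[symmetric]
    using assms by (intro exp_neg_sum exp_neg_potential(1)) (auto simp: touching_def)
  also have "\<dots> = (\<Prod>i\<in>touching \<Lambda>. node_weight i \<omega>)"
    using assms by (intro prod.cong exp_neg_potential(2)) (auto simp: touching_def)
  finally show ?thesis .
qed

text \<open>
  The partition function of the subtree at a node, as a function of the spin \<open>a\<close> of its parent and its own
  spin \<open>b\<close>, normalised to 1 at \<open>(0, 0)\<close>. The normalisation cancels in all conditional probabilities, so
  the pair \<open>(x, y)\<close> is all that the rest of the tree can see of the subtree.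
\<close>

definition msg :: "real \<Rightarrow> real \<Rightarrow> nat \<Rightarrow> nat \<Rightarrow> real" where
  "msg x y a b = (if b = 0 then if a = 0 then 1 else y else if a = 0 then x else 0)"

lemma msg_simps [simp]: "msg x y 0 b = (if b = 0 then 1 else x)" "msg x y (Suc 0) b = (if b = 0 then y else 0)"
  by (simp_all add: msg_def)

text \<open>
  An occupied node forces all its children to be vacant.
\<close>

lemma node_sum_occupied:
  assumes "finite C"
  shows "(\<Sum>s\<in>C \<rightarrow>\<^sub>E {0,1}. wt 1 (a + (\<Sum>c\<in>C. s c)) * (\<Prod>c\<in>C. msg (X c) (Y c) 1 (s c)))
    = (if a = 0 then lam * (\<Prod>c\<in>C. Y c) else 0)"
proof -
  let ?z = "\<lambda>c\<in>C. 0::nat"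
  let ?t = "\<lambda>s. wt 1 (a + (\<Sum>c\<in>C. s c)) * (\<Prod>c\<in>C. msg (X c) (Y c) 1 (s c))"
  have "(\<Sum>s\<in>C \<rightarrow>\<^sub>E {0,1}. ?t s) = (\<Sum>s\<in>{?z}. ?t s)"
  proof (rule sum.mono_neutral_right)
    show "finite (C \<rightarrow>\<^sub>E {0, 1::nat})" using assms by (simp add: finite_PiE)
    show "{?z} \<subseteq> C \<rightarrow>\<^sub>E {0, 1}" by auto
    show "\<forall>s\<in>(C \<rightarrow>\<^sub>E {0, 1}) - {?z}. ?t s = 0"
    proof
      fix s assume s: "s \<in> (C \<rightarrow>\<^sub>E {0, 1::nat}) - {?z}"
      have "\<exists>c\<in>C. s c \<noteq> 0"
      proof (rule ccontr)
        assume "\<not> (\<exists>c\<in>C. s c \<noteq> 0)"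
        with s have "s = ?z" by (auto simp: fun_eq_iff PiE_def extensional_def)
        with s show False by simp
      qed
      then obtain c where "c \<in> C" "s c \<noteq> 0" by blast
      then have "(\<Prod>c\<in>C. msg (X c) (Y c) 1 (s c)) = 0"
        by (intro prod_zero[OF assms] bexI[of _ c]) simp_all
      then show "?t s = 0" by simp
    qed
  qed
  then show ?thesis by (simp add: wt_def)
qed

lemma node_sum_vacant:
  "(\<Sum>s\<in>C \<rightarrow>\<^sub>E {0,1}. wt 0 (a + (\<Sum>c\<in>C. s c)) * (\<Prod>c\<in>C. msg (X c) (Y c) 0 (s c))) = ns C X a"
  by (simp add: nbr_sum_def wt_def)

text \<open>
  The message of \<open>i\<close> is the one that results from the messages of its children.
\<close>

definition consistent :: "(nat list \<Rightarrow> real) \<Rightarrow> (nat list \<Rightarrow> real) \<Rightarrow> nat list \<Rightarrow> bool" where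
  "consistent X Y i \<longleftrightarrow> X i = lam * (\<Prod>c\<in>ch i. Y c) / ns (ch i) X 0 \<and>
     Y i = ns (ch i) X 1 / ns (ch i) X 0"

lemma node_sum:
  assumes "consistent X Y i" "a = 0 \<or> a = 1" "b = 0 \<or> b = 1" "ns (ch i) X 0 \<noteq> 0"
  shows "(\<Sum>s\<in>configs (ch i). wt b (a + (\<Sum>c\<in>ch i. s c)) * (\<Prod>c\<in>ch i. msg (X c) (Y c) b (s c)))
    = ns (ch i) X 0 * msg (X i) (Y i) a b"
  using assms(3)
proof
  assume "b = 0"
  then show ?thesis using assms
    by (auto simp: configs_def node_sum_vacant[simplified] consistent_def)
next
  assume "b = 1"
  then show ?thesis using assms node_sum_occupied[of "ch i" a X Y]
    by (auto simp: configs_def consistent_def)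
qed

text \<open>
  The weight of a configuration on the ball of radius \<open>n + 1\<close>: the nodes up to level \<open>n\<close> see all their
  neighbours, and the leaves on level \<open>n + 1\<close> are represented by messages.
\<close>

definition W :: "nat \<Rightarrow> (nat list \<Rightarrow> real) \<Rightarrow> (nat list \<Rightarrow> real) \<Rightarrow> (nat list \<Rightarrow> nat) \<Rightarrow> real" where
  "W n X Y \<nu> = (\<Prod>i\<in>tball n. node_weight i \<nu>) *
     (\<Prod>i\<in>level (Suc n). msg (X i) (Y i) (\<nu> (tl i)) (\<nu> i))"

lemma closed_nbhd_ball: "i \<in> tball n \<Longrightarrow> closed_nbhd (Suc d) i \<subseteq> tball (Suc n)"
  by (auto simp: tree_ball_def closed_nbhd_eq children_iff tl_node dest: childrenD)

text \<open>
  Given the spins up to level \<open>n + 1\<close>, the families of siblings on level \<open>n + 2\<close> are independent, so the sum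
  over that level factors into the sums of \<open>node_sum\<close>.
\<close>

lemma W_peel:
  assumes \<nu>: "\<nu> \<in> configs (tball (Suc n))"
    and cons: "\<And>i. i \<in> level (Suc n) \<Longrightarrow> consistent X Y i"
    and nz: "\<And>i. i \<in> level (Suc n) \<Longrightarrow> ns (ch i) X 0 \<noteq> 0"
  shows "(\<Sum>s\<in>configs (level (Suc (Suc n))). W (Suc n) X Y (merge (tball (Suc n)) (level (Suc (Suc n))) (\<nu>, s)))
    = (\<Prod>i\<in>level (Suc n). ns (ch i) X 0) * W n X Y \<nu>"
proof -
  let ?B = "tball (Suc n)" and ?L = "level (Suc (Suc n))"
  let ?m = "\<lambda>s. merge ?B ?L (\<nu>, s)"
  let ?g = "\<lambda>i s. wt (\<nu> i) (par i \<nu> + (\<Sum>c\<in>ch i. s c)) * (\<Prod>c\<in>ch i. msg (X c) (Y c) (\<nu> i) (s c))"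
  have split: "W (Suc n) X Y (?m s) = (\<Prod>i\<in>tball n. node_weight i \<nu>) * (\<Prod>i\<in>level (Suc n). ?g i s)" for s
  proof -
    have inner: "node_weight i (?m s) = node_weight i \<nu>" if "i \<in> tball n" for i
      using that closed_nbhd_ball[OF that]
      by (intro node_weight_cong) (auto simp: merge_def tree_ball_def)
    have last: "node_weight i (?m s) = wt (\<nu> i) (par i \<nu> + (\<Sum>c\<in>ch i. s c))" if "i \<in> level (Suc n)" for i
    proof -
      have "?m s i = \<nu> i" "par i (?m s) = par i \<nu>"
        using that tl_node[of i] by (auto simp: merge_def tree_ball_def tree_level_def par_def)
      moreover have "?m s c = s c" if "c \<in> ch i" for c
      proof -
        have "c \<in> ?L" using that \<open>i \<in> level (Suc n)\<close> by (auto simp: tree_level_Suc[of _ "Suc n"])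
        then show ?thesis using tree_ball_level_disjoint[of "Suc d" "Suc n"] by (auto simp: merge_def)
      qed
      ultimately show ?thesis by (simp add: node_weight_def)
    qed
    have leaf: "(\<Prod>c\<in>?L. msg (X c) (Y c) (?m s (tl c)) (?m s c))
        = (\<Prod>i\<in>level (Suc n). \<Prod>c\<in>ch i. msg (X c) (Y c) (\<nu> i) (s c))"
    proof -
      have "(\<Prod>c\<in>?L. msg (X c) (Y c) (?m s (tl c)) (?m s c))
          = (\<Prod>i\<in>level (Suc n). \<Prod>c\<in>ch i. msg (X c) (Y c) (?m s (tl c)) (?m s c))"
        unfolding tree_level_Suc[of _ "Suc n"]
        by (rule prod.UNION_disjoint) (use disjoint_children in \<open>auto simp: disjoint_family_on_def\<close>)
      also have "\<dots> = (\<Prod>i\<in>level (Suc n). \<Prod>c\<in>ch i. msg (X c) (Y c) (\<nu> i) (s c))"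
      proof (intro prod.cong refl)
        fix i c assume i: "i \<in> level (Suc n)" and c: "c \<in> ch i"
        have "c \<in> ?L" "i \<in> ?B" "tl c = i" using i c childrenD[OF c]
          by (auto simp: tree_level_Suc[of _ "Suc n"]) (auto simp: tree_ball_def tree_level_def)
        then show "msg (X c) (Y c) (?m s (tl c)) (?m s c) = msg (X c) (Y c) (\<nu> i) (s c)"
          using tree_ball_level_disjoint[of "Suc d" "Suc n"] by (auto simp: merge_def)
      qed
      finally show ?thesis .
    qed
    have "(\<Prod>i\<in>?B. node_weight i (?m s))
        = (\<Prod>i\<in>tball n. node_weight i \<nu>) * (\<Prod>i\<in>level (Suc n). wt (\<nu> i) (par i \<nu> + (\<Sum>c\<in>ch i. s c)))"
    proof -
      have "(\<Prod>i\<in>?B. node_weight i (?m s))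
          = (\<Prod>i\<in>tball n. node_weight i (?m s)) * (\<Prod>i\<in>level (Suc n). node_weight i (?m s))"
        by (subst (2) tree_ball_Suc) (simp add: prod.union_disjoint tree_ball_level_disjoint)
      then show ?thesis using inner last by (simp cong: prod.cong)
    qed
    then show ?thesis unfolding W_def leaf by (simp add: prod.distrib mult_ac)
  qed
  have "(\<Sum>s\<in>configs ?L. \<Prod>i\<in>level (Suc n). ?g i s) = (\<Prod>i\<in>level (Suc n). \<Sum>s\<in>configs (ch i). ?g i s)"
    unfolding configs_def tree_level_Suc[of _ "Suc n"]
    by (rule sum_PiE_UN_prod) (auto intro!: disjoint_children arg_cong2[of _ _ _ _ wt] arg_cong2[of _ _ _ _ "(*)"] sum.cong prod.cong)
  also have "\<dots> = (\<Prod>i\<in>level (Suc n). ns (ch i) X 0 * msg (X i) (Y i) (\<nu> (tl i)) (\<nu> i))"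
  proof (rule prod.cong[OF refl])
    fix i assume i: "i \<in> level (Suc n)"
    then have "i \<in> ?B" "tl i \<in> ?B" "par i \<nu> = \<nu> (tl i)"
      using tl_node[of i "Suc d"] by (auto simp: tree_ball_def tree_level_def par_def)
    then show "(\<Sum>s\<in>configs (ch i). ?g i s) = ns (ch i) X 0 * msg (X i) (Y i) (\<nu> (tl i)) (\<nu> i)"
      using node_sum[OF cons[OF i], of "\<nu> (tl i)" "\<nu> i"] nz[OF i] configs_01[OF \<nu>] by simp
  qed
  finally have sum_g: "(\<Sum>s\<in>configs ?L. \<Prod>i\<in>level (Suc n). ?g i s)
      = (\<Prod>i\<in>level (Suc n). ns (ch i) X 0) * (\<Prod>i\<in>level (Suc n). msg (X i) (Y i) (\<nu> (tl i)) (\<nu> i))"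
    by (simp add: prod.distrib)
  have "(\<Sum>s\<in>configs ?L. W (Suc n) X Y (?m s))
      = (\<Prod>i\<in>tball n. node_weight i \<nu>) * (\<Sum>s\<in>configs ?L. \<Prod>i\<in>level (Suc n). ?g i s)"
    by (simp only: split sum_distrib_left)
  also have "\<dots> = (\<Prod>i\<in>level (Suc n). ns (ch i) X 0) * W n X Y \<nu>"
    unfolding sum_g W_def by (simp only: mult_ac)
  finally show ?thesis .
qed

lemma W_marginal_step:
  assumes cons: "\<And>i. i \<in> level (Suc n) \<Longrightarrow> consistent X Y i"
    and nz: "\<And>i. i \<in> level (Suc n) \<Longrightarrow> ns (ch i) X 0 \<noteq> 0"
  shows "(\<Sum>\<nu>\<in>configs (tball (Suc (Suc n))). W (Suc n) X Y \<nu> * g (restrict \<nu> (tball (Suc n))))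
    = (\<Prod>i\<in>level (Suc n). ns (ch i) X 0) * (\<Sum>\<nu>\<in>configs (tball (Suc n)). W n X Y \<nu> * g \<nu>)"
proof -
  let ?B = "tball (Suc n)" and ?L = "level (Suc (Suc n))"
  have rs: "restrict (merge ?B ?L (\<nu>, s)) ?B = \<nu>" if "\<nu> \<in> configs ?B" for \<nu> s
    using that by (auto simp: configs_def fun_eq_iff merge_def PiE_def extensional_def restrict_def)
  have "(\<Sum>\<nu>\<in>configs (tball (Suc (Suc n))). W (Suc n) X Y \<nu> * g (restrict \<nu> ?B))
      = (\<Sum>\<nu>\<in>configs ?B. \<Sum>s\<in>configs ?L. W (Suc n) X Y (merge ?B ?L (\<nu>, s)) * g \<nu>)"
    unfolding tree_ball_Suc[of _ "Suc n"] configs_def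
    by (subst sum_PiE_Un[OF tree_ball_level_disjoint]) (simp add: rs[unfolded configs_def])
  also have "\<dots> = (\<Sum>\<nu>\<in>configs ?B. (\<Prod>i\<in>level (Suc n). ns (ch i) X 0) * W n X Y \<nu> * g \<nu>)"
    using W_peel[OF _ cons nz] by (intro sum.cong refl) (simp add: sum_distrib_right[symmetric])
  finally show ?thesis by (simp add: sum_distrib_left mult.assoc)
qed

end

section \<open>The spatial Markov property\<close>

lemma graph_dist_le: "(i, j) \<in> tree_edges \<Delta> ^^ n \<Longrightarrow> graph_dist \<Delta> i j \<le> n"
  unfolding graph_dist_def by (rule Least_le)

lemma relpow_length:
  "(i, j) \<in> tree_edges \<Delta> ^^ n \<Longrightarrow> length i \<le> length j + n"
proof (induction n arbitrary: j)
  case (Suc n)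
  then obtain k where "(i, k) \<in> tree_edges \<Delta> ^^ n" "(k, j) \<in> tree_edges \<Delta>" by auto
  with Suc.IH[of k] show ?case by (auto simp: tree_edges_def)
qed simp

lemma graph_dist_length:
  assumes "i \<in> tree_nodes \<Delta>" "j \<in> tree_nodes \<Delta>"
  shows "length i \<le> length j + graph_dist \<Delta> i j"
proof -
  obtain n where "(i, j) \<in> tree_edges \<Delta> ^^ n"
    using tree_connected[OF assms] rtrancl_imp_relpow by metis
  then have "(i, j) \<in> tree_edges \<Delta> ^^ graph_dist \<Delta> i j"
    unfolding graph_dist_def by (rule LeastI)
  then show ?thesis by (rule relpow_length)
qed

lemma boundary_length:
  assumes "i \<in> boundary \<Delta> \<Lambda>" "\<Lambda> \<subseteq> tree_ball \<Delta> n"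
  shows "i \<in> tree_ball \<Delta> (n + 2)"
proof -
  obtain j where j: "j \<in> \<Lambda>" "graph_dist \<Delta> i j \<le> 2" and i: "i \<in> tree_nodes \<Delta>"
    using assms(1) by (auto simp: boundary_def)
  with assms(2) have "j \<in> tree_nodes \<Delta>" "length j \<le> n" by (auto simp: tree_ball_def)
  with graph_dist_length[OF i, of j] j i show ?thesis by (simp add: tree_ball_def)
qed

lemma finite_subset_tree_ball:
  assumes "finite \<Lambda>" "\<Lambda> \<subseteq> tree_nodes \<Delta>"
  obtains n where "\<Lambda> \<subseteq> tree_ball \<Delta> n"
proof
  show "\<Lambda> \<subseteq> tree_ball \<Delta> (Max (length ` \<Lambda>))"
    using assms by (auto simp: tree_ball_def)
qed

lemma finite_boundary:
  assumes "finite \<Lambda>" "\<Lambda> \<subseteq> tree_nodes \<Delta>"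
  shows "finite (boundary \<Delta> \<Lambda>)"
proof -
  obtain n where "\<Lambda> \<subseteq> tree_ball \<Delta> n" by (rule finite_subset_tree_ball[OF assms])
  then have "boundary \<Delta> \<Lambda> \<subseteq> tree_ball \<Delta> (n + 2)" using boundary_length by blast
  then show ?thesis by (rule finite_subset) simp
qed

lemma closed_nbhd_boundary:
  assumes i: "i \<in> tree_nodes \<Delta>" and touch: "closed_nbhd \<Delta> i \<inter> \<Lambda> \<noteq> {}"
  shows "closed_nbhd \<Delta> i \<subseteq> \<Lambda> \<union> boundary \<Delta> \<Lambda>"
proof
  fix j assume j: "j \<in> closed_nbhd \<Delta> i"
  obtain k where k: "k \<in> closed_nbhd \<Delta> i" "k \<in> \<Lambda>" using touch by blast
  have e: "i = j \<or> (j, i) \<in> tree_edges \<Delta>" "i = k \<or> (i, k) \<in> tree_edges \<Delta>"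
    using j k by (auto simp: closed_nbhd_def tree_edges_sym)
  have "graph_dist \<Delta> j k \<le> 2"
  proof -
    have "\<exists>n\<le>2. (j, k) \<in> tree_edges \<Delta> ^^ n"
      using e
    proof (elim disjE)
      assume "i = j" "i = k" then show ?thesis by (intro exI[of _ 0]) simp
    next
      assume "i = j" "(i, k) \<in> tree_edges \<Delta>" then show ?thesis by (intro exI[of _ 1]) simp
    next
      assume "(j, i) \<in> tree_edges \<Delta>" "i = k" then show ?thesis by (intro exI[of _ 1]) simp
    next
      assume "(j, i) \<in> tree_edges \<Delta>" "(i, k) \<in> tree_edges \<Delta>"
      then show ?thesis by (intro exI[of _ 2]) (auto simp: numeral_2_eq_2)
    qed
    then obtain n where "n \<le> 2" "(j, k) \<in> tree_edges \<Delta> ^^ n" by blast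
    then show ?thesis using graph_dist_le[of j k n \<Delta>] by simp
  qed
  then show "j \<in> \<Lambda> \<union> boundary \<Delta> \<Lambda>"
    using j k closed_nbhd_nodes[OF i] by (auto simp: boundary_def)
qed

lemma finite_indep_configs: "finite S \<Longrightarrow> finite (indep_configs \<Delta> S)"
  by (rule finite_subset[of _ "configs S"]) (auto simp: indep_configs_def)

lemma indep_configs_subset: "\<eta> \<in> indep_configs \<Delta> S \<Longrightarrow> \<eta> \<in> configs S"
  by (simp add: indep_configs_def)

context tree_weights
begin

lemma touching_subset: "touching \<Lambda> \<subseteq> \<Lambda> \<union> boundary (Suc d) \<Lambda>"
proof
  fix i assume "i \<in> touching \<Lambda>"
  then show "i \<in> \<Lambda> \<union> boundary (Suc d) \<Lambda>"
    using closed_nbhd_boundary[of i "Suc d" \<Lambda>] by (auto simp: touching_def closed_nbhd_def)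
qed

lemma finite_touching:
  assumes "finite \<Lambda>" "\<Lambda> \<subseteq> nodes"
  shows "finite (touching \<Lambda>)"
  using finite_subset[OF touching_subset] finite_boundary[OF assms] assms by simp

lemma node_weight_zero:
  assumes "(i, j) \<in> tree_edges (Suc d)" "\<nu> i = 1" "\<nu> j = 1"
  shows "node_weight i \<nu> = 0"
proof -
  have i: "i \<in> nodes" using assms(1) by (auto simp: tree_edges_def)
  have "j \<in> closed_nbhd (Suc d) i" "j \<noteq> i" using assms(1) by (auto simp: closed_nbhd_def tree_edges_def)
  then have "j \<in> ch i \<or> i \<noteq> [] \<and> j = tl i" by (auto simp: closed_nbhd_eq[OF i] split: if_splits)
  then have "par i \<nu> + (\<Sum>c\<in>ch i. \<nu> c) \<noteq> 0"
  proof
    assume "j \<in> ch i"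
    then have "\<nu> j \<le> (\<Sum>c\<in>ch i. \<nu> c)" by (intro member_le_sum) auto
    with assms(3) show ?thesis by linarith
  qed (use assms(3) in \<open>simp add: par_def\<close>)
  then show ?thesis unfolding node_weight_def wt_def using assms(2) by (simp only: if_False simp_thms if_True)
qed

text \<open>
  Any weight that splits into the interactions touching \<open>\<Lambda>\<close> and a factor that ignores \<open>\<Lambda>\<close> satisfies the
  Gibbs identity: for fixed spins outside \<open>\<Lambda>\<close> the second factor cancels from the conditional
  probability. The same argument covers a boundary configuration of total weight zero, since then every
  single weight is zero too.
\<close>

lemma spatial_markov:
  assumes \<Lambda>: "finite \<Lambda>" "\<Lambda> \<subseteq> nodes" and R: "finite R" "\<Lambda> \<union> boundary (Suc d) \<Lambda> \<subseteq> R" and S: "S \<subseteq> \<Lambda>"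
    and V: "\<And>\<nu>. \<nu> \<in> configs R \<Longrightarrow> V \<nu> = (\<Prod>i\<in>touching \<Lambda>. node_weight i \<nu>) * rest \<nu>"
    and rest: "\<And>\<nu> \<nu>'. (\<And>i. i \<in> R - \<Lambda> \<Longrightarrow> \<nu> i = \<nu>' i) \<Longrightarrow> rest \<nu> = rest \<nu>'"
    and indep: "\<And>\<nu>. \<nu> \<in> configs R \<Longrightarrow> restrict \<nu> (boundary (Suc d) \<Lambda>) \<notin> indep_configs (Suc d) (boundary (Suc d) \<Lambda>) \<Longrightarrow> V \<nu> = 0"
  shows "(\<Sum>\<nu>\<in>configs R. V \<nu> * of_bool (restrict \<nu> S = \<omega>))
    = (\<Sum>\<eta>\<in>indep_configs (Suc d) (boundary (Suc d) \<Lambda>). cond_prob_config (Suc d) lam \<theta> \<Lambda> S \<omega> \<eta>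
        * (\<Sum>\<nu>\<in>configs R. V \<nu> * of_bool (restrict \<nu> (boundary (Suc d) \<Lambda>) = \<eta>)))"
proof -
  let ?bd = "boundary (Suc d) \<Lambda>" and ?C = "R - \<Lambda>"
  let ?I = "indep_configs (Suc d) ?bd" and ?cp = "cond_prob_config (Suc d) lam \<theta> \<Lambda> S \<omega>"
  let ?m = "\<lambda>t \<xi>. merge \<Lambda> ?C (t, \<xi>)"
  have bd: "?bd \<subseteq> ?C" "finite ?bd" using R finite_subset by (auto simp: boundary_def)
  have split: "(\<Sum>\<nu>\<in>configs R. h \<nu>) = (\<Sum>\<xi>\<in>configs ?C. \<Sum>t\<in>configs \<Lambda>. h (?m t \<xi>))" for h :: "_ \<Rightarrow> real"
  proof -
    have "R = \<Lambda> \<union> ?C" using R by auto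
    then have "(\<Sum>\<nu>\<in>configs R. h \<nu>) = (\<Sum>t\<in>configs \<Lambda>. \<Sum>\<xi>\<in>configs ?C. h (?m t \<xi>))"
      unfolding configs_def using sum_PiE_Un[of \<Lambda> ?C h "{0,1}"] by auto
    then show ?thesis by (subst (asm) sum.swap)
  qed
  have m_conf: "?m t \<xi> \<in> configs R" if "t \<in> configs \<Lambda>" "\<xi> \<in> configs ?C" for t \<xi>
  proof -
    have "\<Lambda> \<union> (R - \<Lambda>) = R" using R by auto
    with merge_configs[OF that] show ?thesis by simp
  qed
  have mS: "restrict (?m t \<xi>) S = restrict t S" for t \<xi>
    using S by (auto simp: fun_eq_iff merge_def restrict_def)
  have mb: "restrict (?m t \<xi>) ?bd = restrict \<xi> ?bd" for t \<xi>
    using bd by (auto simp: fun_eq_iff merge_def restrict_def)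
  let ?H = "\<lambda>\<xi> t. exp_neg (hamiltonian (Suc d) lam \<theta> \<Lambda> (merge \<Lambda> ?bd (t, restrict \<xi> ?bd)))"
  have H: "?H \<xi> t = (\<Prod>i\<in>touching \<Lambda>. node_weight i (?m t \<xi>))"
    if t: "t \<in> configs \<Lambda>" and \<xi>: "\<xi> \<in> configs ?C" for t \<xi>
  proof -
    have agree: "merge \<Lambda> ?bd (t, restrict \<xi> ?bd) j = ?m t \<xi> j" if "j \<in> \<Lambda> \<union> ?bd" for j
      using that bd by (auto simp: merge_def)
    have "?H \<xi> t = (\<Prod>i\<in>touching \<Lambda>. node_weight i (merge \<Lambda> ?bd (t, restrict \<xi> ?bd)))"
    proof (rule exp_neg_hamiltonian)
      show "finite (touching \<Lambda>)" by (rule finite_touching[OF \<Lambda>])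
      fix i assume "i \<in> touching \<Lambda>"
      then have "i \<in> \<Lambda> \<union> ?bd" using touching_subset by blast
      then show "merge \<Lambda> ?bd (t, restrict \<xi> ?bd) i = 0 \<or> merge \<Lambda> ?bd (t, restrict \<xi> ?bd) i = 1"
        using configs_01[OF m_conf[OF t \<xi>], of i] R(2) unfolding agree[OF \<open>i \<in> \<Lambda> \<union> ?bd\<close>] by blast
    qed
    also have "\<dots> = (\<Prod>i\<in>touching \<Lambda>. node_weight i (?m t \<xi>))"
    proof (intro prod.cong refl node_weight_cong)
      fix i j assume "i \<in> touching \<Lambda>" and j: "j \<in> closed_nbhd (Suc d) i"
      then have "j \<in> \<Lambda> \<union> ?bd"
        using closed_nbhd_boundary[of i "Suc d" \<Lambda>] by (auto simp: touching_def)
      then show "merge \<Lambda> ?bd (t, restrict \<xi> ?bd) j = ?m t \<xi> j" by (rule agree)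
    qed (auto simp: touching_def)
    finally show ?thesis .
  qed
  have VH: "V (?m t \<xi>) = ?H \<xi> t * rest \<xi>" if "t \<in> configs \<Lambda>" "\<xi> \<in> configs ?C" for t \<xi>
  proof -
    have "rest (?m t \<xi>) = rest \<xi>" by (rule rest) (auto simp: merge_def)
    then show ?thesis using V[OF m_conf[OF that]] H[OF that] by simp
  qed
  have inner: "(\<Sum>t\<in>configs \<Lambda>. V (?m t \<xi>) * of_bool (restrict t S = \<omega>))
      = ?cp (restrict \<xi> ?bd) * (\<Sum>t\<in>configs \<Lambda>. V (?m t \<xi>))" if \<xi>: "\<xi> \<in> configs ?C" for \<xi>
  proof -
    let ?N = "\<Sum>t\<in>configs \<Lambda>. ?H \<xi> t * of_bool (restrict t S = \<omega>)" and ?D = "\<Sum>t\<in>configs \<Lambda>. ?H \<xi> t"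
    have H0: "0 \<le> ?H \<xi> t" for t by (simp add: exp_neg_def)
    have "0 \<le> ?N" "?N \<le> ?D" using H0 by (auto intro!: sum_nonneg sum_mono)
    moreover have "?cp (restrict \<xi> ?bd) = ?N / ?D"
      using \<Lambda>(1) by (simp add: cond_prob_config_def sum.inter_filter[symmetric] of_bool_def if_distrib cong: if_cong)
    ultimately have ND: "?N = ?cp (restrict \<xi> ?bd) * ?D" by (cases "?D = 0") auto
    have "(\<Sum>t\<in>configs \<Lambda>. V (?m t \<xi>) * of_bool (restrict t S = \<omega>)) = ?N * rest \<xi>"
      using VH[OF _ \<xi>] by (simp add: sum_distrib_left sum_distrib_right mult_ac)
    moreover have "(\<Sum>t\<in>configs \<Lambda>. V (?m t \<xi>)) = ?D * rest \<xi>"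
      using VH[OF _ \<xi>] by (simp add: sum_distrib_right)
    ultimately show ?thesis by (simp only: ND mult.assoc)
  qed
  have fin: "finite ?I" by (rule finite_indep_configs[OF bd(2)])
  have "(\<Sum>\<nu>\<in>configs R. V \<nu> * of_bool (restrict \<nu> S = \<omega>))
      = (\<Sum>\<xi>\<in>configs ?C. \<Sum>t\<in>configs \<Lambda>. ?cp (restrict \<xi> ?bd) * V (?m t \<xi>))"
    unfolding split mS using inner by (simp add: sum_distrib_left)
  also have "\<dots> = (\<Sum>\<xi>\<in>configs ?C. \<Sum>t\<in>configs \<Lambda>. \<Sum>\<eta>\<in>?I. ?cp \<eta> * (V (?m t \<xi>) * of_bool (restrict \<xi> ?bd = \<eta>)))"
  proof (intro sum.cong refl)
    fix \<xi> t assume \<xi>: "\<xi> \<in> configs ?C" and t: "t \<in> configs \<Lambda>"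
    have "(\<Sum>\<eta>\<in>?I. ?cp \<eta> * (V (?m t \<xi>) * of_bool (restrict \<xi> ?bd = \<eta>)))
        = (\<Sum>\<eta>\<in>?I. if restrict \<xi> ?bd = \<eta> then ?cp \<eta> * V (?m t \<xi>) else 0)"
      by (intro sum.cong) auto
    also have "\<dots> = (if restrict \<xi> ?bd \<in> ?I then ?cp (restrict \<xi> ?bd) * V (?m t \<xi>) else 0)"
      by (subst sum.delta'[OF fin]) simp
    also have "\<dots> = ?cp (restrict \<xi> ?bd) * V (?m t \<xi>)"
      using indep[OF m_conf[OF t \<xi>]] by (simp add: mb)
    finally show "?cp (restrict \<xi> ?bd) * V (?m t \<xi>)
        = (\<Sum>\<eta>\<in>?I. ?cp \<eta> * (V (?m t \<xi>) * of_bool (restrict \<xi> ?bd = \<eta>)))" by simp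
  qed
  also have "\<dots> = (\<Sum>\<xi>\<in>configs ?C. \<Sum>\<eta>\<in>?I. \<Sum>t\<in>configs \<Lambda>. ?cp \<eta> * (V (?m t \<xi>) * of_bool (restrict \<xi> ?bd = \<eta>)))"
    by (intro sum.cong refl sum.swap)
  also have "\<dots> = (\<Sum>\<eta>\<in>?I. \<Sum>\<xi>\<in>configs ?C. \<Sum>t\<in>configs \<Lambda>. ?cp \<eta> * (V (?m t \<xi>) * of_bool (restrict \<xi> ?bd = \<eta>)))"
    by (rule sum.swap)
  also have "\<dots> = (\<Sum>\<eta>\<in>?I. ?cp \<eta> * (\<Sum>\<nu>\<in>configs R. V \<nu> * of_bool (restrict \<nu> ?bd = \<eta>)))"
    unfolding split mb by (simp add: sum_distrib_left)
  finally show ?thesis .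
qed

definition cyl :: "nat \<Rightarrow> (nat list \<Rightarrow> real) \<Rightarrow> (nat list \<Rightarrow> real) \<Rightarrow> nat list set \<Rightarrow> (nat list \<Rightarrow> nat) \<Rightarrow> real" where
  "cyl n X Y S \<omega> = (\<Sum>\<nu>\<in>configs (tball (Suc n)). W n X Y \<nu> * of_bool (restrict \<nu> S = \<omega>))"

definition mass :: "nat \<Rightarrow> (nat list \<Rightarrow> real) \<Rightarrow> (nat list \<Rightarrow> real) \<Rightarrow> real" where
  "mass n X Y = (\<Sum>\<nu>\<in>configs (tball (Suc n)). W n X Y \<nu>)"

definition cprob :: "nat \<Rightarrow> (nat list \<Rightarrow> real) \<Rightarrow> (nat list \<Rightarrow> real) \<Rightarrow> nat list set \<Rightarrow> (nat list \<Rightarrow> nat) \<Rightarrow> real" where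
  "cprob n X Y S \<omega> = cyl n X Y S \<omega> / mass n X Y"

lemma W_nonneg:
  assumes "\<And>i. 0 \<le> X i" "\<And>i. 0 \<le> Y i"
  shows "0 \<le> W n X Y \<nu>"
  unfolding W_def using assms by (intro mult_nonneg_nonneg prod_nonneg) (auto simp: node_weight_nonneg msg_def)

lemma W_mono:
  assumes "\<And>i. i \<in> level (Suc n) \<Longrightarrow> 0 \<le> X i \<and> X i \<le> X' i" "\<And>i. i \<in> level (Suc n) \<Longrightarrow> 0 \<le> Y i \<and> Y i \<le> Y' i"
  shows "W n X Y \<nu> \<le> W n X' Y' \<nu>"
proof -
  have "0 \<le> msg (X i) (Y i) a b \<and> msg (X i) (Y i) a b \<le> msg (X' i) (Y' i) a b" if "i \<in> level (Suc n)" for i a b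
    using assms(1)[OF that] assms(2)[OF that] by (auto simp: msg_def)
  then show ?thesis
    unfolding W_def by (intro mult_left_mono prod_mono prod_nonneg) (auto simp: node_weight_nonneg)
qed

lemma mass_pos:
  assumes "\<And>i. 0 \<le> X i" "\<And>i. 0 \<le> Y i"
  shows "0 < mass n X Y"
proof -
  let ?z = "\<lambda>i\<in>tball (Suc n). 0::nat"
  have z: "?z \<in> configs (tball (Suc n))" by (auto simp: configs_def)
  have par0: "par i ?z = 0" "(\<Sum>c\<in>ch i. ?z c) = 0" "?z i = 0" if "i \<in> tball n" for i
  proof -
    show "?z i = 0" using that by (simp add: tree_ball_def)
    have "c \<in> tball (Suc n)" if "c \<in> ch i" for c
      using closed_nbhd_ball[OF \<open>i \<in> tball n\<close>] that \<open>i \<in> tball n\<close>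
      by (auto simp: tree_ball_def closed_nbhd_eq)
    then show "(\<Sum>c\<in>ch i. ?z c) = 0" by simp
    show "par i ?z = 0" using that tl_node[of i "Suc d"] by (auto simp: par_def tree_ball_def)
  qed
  have leaf: "?z i = 0" "?z (tl i) = 0" if "i \<in> level (Suc n)" for i
    using that tl_node[of i "Suc d"] by (auto simp: tree_level_def tree_ball_def)
  have "0 < W n X Y ?z"
    unfolding W_def by (intro mult_pos_pos prod_pos) (simp_all add: node_weight_def par0 leaf wt_def pos msg_def del: restrict_apply)
  also have "W n X Y ?z \<le> mass n X Y"
    unfolding mass_def by (rule member_le_sum[OF z]) (auto intro!: W_nonneg assms)
  finally show ?thesis .
qed

lemma cyl_nonneg: "(\<And>i. 0 \<le> X i) \<Longrightarrow> (\<And>i. 0 \<le> Y i) \<Longrightarrow> 0 \<le> cyl n X Y S \<omega>"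
  unfolding cyl_def by (intro sum_nonneg mult_nonneg_nonneg W_nonneg) auto

lemma cyl_mono:
  assumes "\<And>i. i \<in> level (Suc n) \<Longrightarrow> 0 \<le> X i \<and> X i \<le> X' i" "\<And>i. i \<in> level (Suc n) \<Longrightarrow> 0 \<le> Y i \<and> Y i \<le> Y' i"
  shows "cyl n X Y S \<omega> \<le> cyl n X' Y' S \<omega>" "mass n X Y \<le> mass n X' Y'"
  unfolding cyl_def mass_def using W_mono[OF assms] by (auto intro!: sum_mono mult_right_mono)

lemma cprob_Suc:
  assumes nn: "\<And>i. 0 \<le> X i" and cons: "\<And>i. i \<in> level (Suc n) \<Longrightarrow> consistent X Y i"
    and S: "S \<subseteq> tball (Suc n)"
  shows "cprob (Suc n) X Y S \<omega> = cprob n X Y S \<omega>"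
proof -
  have p: "0 < ns (ch i) X 0" for i by (rule ns_pos) (simp_all add: nn)
  define C where "C = (\<Prod>i\<in>level (Suc n). ns (ch i) X 0)"
  have C: "0 < C" unfolding C_def by (intro prod_pos) (simp add: p)
  have rr: "restrict (restrict \<nu> (tball (Suc n))) S = restrict \<nu> S" for \<nu> :: "nat list \<Rightarrow> nat"
    using S by (simp add: Int_absorb1)
  have nz: "ns (ch i) X 0 \<noteq> 0" for i using p[of i] by simp
  have "cyl (Suc n) X Y S \<omega> = C * cyl n X Y S \<omega>"
    using W_marginal_step[where n = n and X = X and Y = Y, OF cons nz, where g = "\<lambda>\<nu>. of_bool (restrict \<nu> S = \<omega>)"]
    unfolding rr by (simp add: cyl_def C_def)
  moreover have "mass (Suc n) X Y = C * mass n X Y"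
    using W_marginal_step[where n = n and X = X and Y = Y, OF cons nz, where g = "\<lambda>\<nu>. 1"] by (simp add: mass_def C_def)
  ultimately show ?thesis using C by (simp add: cprob_def)
qed

text \<open>
  Consistency of the weights for growing balls: this makes Kolmogorov's extension theorem applicable, and it
  also carries the effect of a distant boundary inwards as a change of messages.
\<close>

lemma cprob_stable:
  assumes nn: "\<And>i. 0 \<le> X i" and "M \<le> n"
    and cons: "\<And>i. i \<in> nodes \<Longrightarrow> M < length i \<Longrightarrow> length i \<le> n \<Longrightarrow> consistent X Y i"
    and S: "S \<subseteq> tball (Suc M)"
  shows "cprob n X Y S \<omega> = cprob M X Y S \<omega>"
  using assms(2) cons
proof (induction n rule: dec_induct)
  case (step n)
  have "cprob (Suc n) X Y S \<omega> = cprob n X Y S \<omega>"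
    using step S tree_ball_mono[of "Suc M" "Suc n" "Suc d"]
    by (intro cprob_Suc nn) (auto simp: tree_level_def)
  with step show ?case by simp
qed simp

lemma W_indep:
  assumes "\<nu> \<in> configs (tball (Suc n))" "T \<subseteq> tball n" "restrict \<nu> T \<notin> indep_configs (Suc d) T"
  shows "W n X Y \<nu> = 0"
proof -
  have "T \<subseteq> tball (Suc n)" using assms(2) by (auto simp: tree_ball_def)
  then have "restrict \<nu> T \<in> configs T" by (rule restrict_configs[OF assms(1)])
  with assms(3) obtain i j where "i \<in> T" "j \<in> T" "(i, j) \<in> tree_edges (Suc d)" "\<nu> i = 1" "\<nu> j = 1"
    by (auto simp: indep_configs_def)
  then have "i \<in> tball n" "node_weight i \<nu> = 0" using assms(2) by (auto intro: node_weight_zero)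
  then have "(\<Prod>i\<in>tball n. node_weight i \<nu>) = 0" by (intro prod_zero) auto
  then show ?thesis by (simp add: W_def)
qed

lemma cprob_gibbs:
  assumes \<Lambda>: "\<Lambda> \<union> boundary (Suc d) \<Lambda> \<subseteq> tball n" and S: "S \<subseteq> \<Lambda>"
  shows "cprob n X Y S \<omega> = (\<Sum>\<eta>\<in>indep_configs (Suc d) (boundary (Suc d) \<Lambda>).
     cond_prob_config (Suc d) lam \<theta> \<Lambda> S \<omega> \<eta> * cprob n X Y (boundary (Suc d) \<Lambda>) \<eta>)"
proof -
  let ?bd = "boundary (Suc d) \<Lambda>" and ?R = "tball (Suc n)"
  have fin: "finite \<Lambda>" "\<Lambda> \<subseteq> nodes" using \<Lambda> finite_subset[OF _ finite_tree_ball] by (auto simp: tree_ball_def)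
  have sub: "\<Lambda> \<union> ?bd \<subseteq> ?R" using \<Lambda> tree_ball_mono[of n "Suc n" "Suc d"] by auto
  have tch: "touching \<Lambda> \<subseteq> tball n" using touching_subset \<Lambda> by blast
  define rest where "rest \<nu> = (\<Prod>i\<in>tball n - touching \<Lambda>. node_weight i \<nu>) *
     (\<Prod>i\<in>level (Suc n). msg (X i) (Y i) (\<nu> (tl i)) (\<nu> i))" for \<nu>
  have "cyl n X Y S \<omega> = (\<Sum>\<eta>\<in>indep_configs (Suc d) ?bd. cond_prob_config (Suc d) lam \<theta> \<Lambda> S \<omega> \<eta> * cyl n X Y ?bd \<eta>)"
    unfolding cyl_def
  proof (rule spatial_markov[OF fin _ sub S, where rest = rest])
    show "finite ?R" by simp
    fix \<nu> :: "nat list \<Rightarrow> nat"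
    show "W n X Y \<nu> = (\<Prod>i\<in>touching \<Lambda>. node_weight i \<nu>) * rest \<nu>"
      unfolding W_def rest_def using prod.subset_diff[OF tch, of "\<lambda>i. node_weight i \<nu>"] by (simp add: mult_ac)
    show "W n X Y \<nu> = 0" if "\<nu> \<in> configs ?R" "restrict \<nu> ?bd \<notin> indep_configs (Suc d) ?bd"
      using W_indep[OF that(1) _ that(2)] \<Lambda> by blast
  next
    fix \<nu> \<nu>' :: "nat list \<Rightarrow> nat" assume eq: "\<And>i. i \<in> ?R - \<Lambda> \<Longrightarrow> \<nu> i = \<nu>' i"
    have "node_weight i \<nu> = node_weight i \<nu>'" if "i \<in> tball n - touching \<Lambda>" for i
    proof (rule node_weight_cong)
      show i: "i \<in> nodes" using that by (simp add: tree_ball_def)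
      show "\<nu> j = \<nu>' j" if "j \<in> closed_nbhd (Suc d) i" for j
        using \<open>i \<in> tball n - touching \<Lambda>\<close> that closed_nbhd_ball[of i n] i by (intro eq) (auto simp: touching_def)
    qed
    moreover have "msg (X i) (Y i) (\<nu> (tl i)) (\<nu> i) = msg (X i) (Y i) (\<nu>' (tl i)) (\<nu>' i)" if i: "i \<in> level (Suc n)" for i
    proof -
      have n: "i \<in> nodes" "i \<noteq> []" "i \<in> ?R" "tl i \<in> ?R" "i \<notin> tball n"
        using i tl_node[of i "Suc d"] by (auto simp: tree_level_def tree_ball_def)
      have "{i, tl i} \<subseteq> closed_nbhd (Suc d) i" using n by (simp add: closed_nbhd_eq)
      then have "i \<notin> \<Lambda>" "tl i \<notin> \<Lambda>" using n tch by (auto simp: touching_def)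
      then show ?thesis using n eq by simp
    qed
    ultimately show "rest \<nu> = rest \<nu>'"
      unfolding rest_def by (intro arg_cong2[where f = "(*)"] prod.cong refl) blast+
  qed
  then show ?thesis by (simp add: cprob_def sum_divide_distrib)
qed

end

section \<open>Boundary conditions as messages\<close>

context tree_weights
begin

lemma gain_at_zero: "gain r 0 = lam * r ^ d / \<theta> 0"
  by (simp add: gain_def bs_at_0)

text \<open>
  The weights of a leaf \<open>i\<close> of a ball and of its children, when the spins of the two levels of descendants
  are fixed to \<open>\<eta>\<close>, as a function of the parent's spin \<open>a\<close> and the leaf's spin \<open>b\<close>.
\<close>

definition leaf_weight :: "(nat list \<Rightarrow> nat) \<Rightarrow> nat list \<Rightarrow> nat \<Rightarrow> nat \<Rightarrow> real" where
  "leaf_weight \<eta> i a b = wt b (a + (\<Sum>c\<in>ch i. \<eta> c)) * (\<Prod>c\<in>ch i. wt (\<eta> c) (b + (\<Sum>g\<in>ch c. \<eta> g)))"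

text \<open>
  Up to a factor the frozen descendants act as a message within the first of the intervals \<open>env\<close>. An
  occupied child excludes an occupied leaf; otherwise each of the \<open>d\<close> vacant children gains at most
  a factor \<open>r\<close>.
\<close>

lemma leaf_weight_msg:
  assumes i: "i \<noteq> []"
    and 01: "\<And>c. c \<in> ch i \<Longrightarrow> \<eta> c = 0 \<or> \<eta> c = 1"
    and ind: "\<And>c. c \<in> ch i \<Longrightarrow> \<eta> c = 1 \<Longrightarrow> (\<Sum>g\<in>ch c. \<eta> g) = 0"
  shows "0 < leaf_weight \<eta> i 0 0"
    and "\<exists>x y. 0 \<le> x \<and> x \<le> gain r 0 \<and> q \<le> y \<and> y \<le> r \<and>
      (\<forall>a b. (a = 0 \<or> a = 1) \<and> (b = 0 \<or> b = 1) \<longrightarrow> leaf_weight \<eta> i a b = leaf_weight \<eta> i 0 0 * msg x y a b)"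
proof -
  let ?k = "\<Sum>c\<in>ch i. \<eta> c" and ?K = "\<lambda>c. \<Sum>g\<in>ch c. \<eta> g"
  let ?P = "\<Prod>c\<in>ch i. wt (\<eta> c) (?K c)"
  have wp: "0 < wt (\<eta> c) (?K c)" if "c \<in> ch i" for c
    using 01[OF that] ind[OF that] pos lam_pos by (auto simp: wt_def)
  then have P: "0 < ?P" by (intro prod_pos) auto
  then show h00: "0 < leaf_weight \<eta> i 0 0"
    using pos by (simp add: leaf_weight_def wt_def[of 0])
  define y where "y = \<theta> (Suc ?k) / \<theta> ?k"
  have y: "q \<le> y" "y \<le> r"
    using lower[of ?k] upper[of ?k] pos[of ?k] by (simp_all add: y_def le_divide_eq divide_le_eq)
  define x where "x = leaf_weight \<eta> i 0 1 / leaf_weight \<eta> i 0 0"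
  have x0: "0 \<le> x"
    unfolding x_def leaf_weight_def by (intro divide_nonneg_nonneg mult_nonneg_nonneg prod_nonneg) (auto simp: wt_nonneg)
  have x1: "x \<le> gain r 0"
  proof (cases "?k = 0")
    case True
    then have e0: "\<eta> c = 0" if "c \<in> ch i" for c using that by simp
    have "x = lam * (\<Prod>c\<in>ch i. \<theta> (Suc (?K c))) / (\<theta> 0 * (\<Prod>c\<in>ch i. \<theta> (?K c)))"
      unfolding x_def leaf_weight_def True using e0 by (simp add: wt_def cong: prod.cong)
    also have "\<dots> \<le> lam * (\<Prod>c\<in>ch i. r * \<theta> (?K c)) / (\<theta> 0 * (\<Prod>c\<in>ch i. \<theta> (?K c)))"
      using lam_pos pos by (intro divide_right_mono mult_left_mono prod_mono mult_nonneg_nonneg prod_nonneg)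
        (auto simp: upper less_imp_le)
    also have "\<dots> = gain r 0"
    proof -
      have "(\<Prod>c\<in>ch i. \<theta> (?K c)) \<noteq> 0" using pos by (simp add: less_imp_neq[symmetric])
      then show ?thesis using i by (simp add: prod.distrib gain_at_zero card_children)
    qed
    finally show ?thesis .
  next
    case False
    then have "leaf_weight \<eta> i 0 1 = 0" unfolding leaf_weight_def wt_def[of 1] by (simp only: add_0 if_False simp_thms if_True mult_zero_left)
    then show ?thesis using r_pos by (simp add: x_def gain_nonneg)
  qed
  have "leaf_weight \<eta> i 1 0 = y * leaf_weight \<eta> i 0 0"
    using pos[of ?k] by (simp add: leaf_weight_def wt_def[of 0] y_def)
  moreover have "leaf_weight \<eta> i 1 1 = 0" using wt_def[of 1 "1 + ?k"] by (simp add: leaf_weight_def)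
  moreover have "leaf_weight \<eta> i 0 1 = x * leaf_weight \<eta> i 0 0" using h00 by (simp add: x_def)
  ultimately show "\<exists>x y. 0 \<le> x \<and> x \<le> gain r 0 \<and> q \<le> y \<and> y \<le> r \<and>
      (\<forall>a b. (a = 0 \<or> a = 1) \<and> (b = 0 \<or> b = 1) \<longrightarrow> leaf_weight \<eta> i a b = leaf_weight \<eta> i 0 0 * msg x y a b)"
    using x0 x1 y by (intro exI[of _ x] exI[of _ y]) (auto simp: msg_def mult.commute)
qed

lemma touching_ball: "touching (tball (Suc n)) = tball (Suc (Suc n))"
proof
  show "touching (tball (Suc n)) \<subseteq> tball (Suc (Suc n))"
  proof
    fix i assume "i \<in> touching (tball (Suc n))"
    then obtain j where n: "i \<in> nodes" and j: "j \<in> closed_nbhd (Suc d) i" "length j \<le> Suc n"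
      by (auto simp: touching_def tree_ball_def)
    have "j = i \<or> j \<in> ch i \<or> j = tl i" using j(1) by (auto simp: closed_nbhd_eq[OF n] split: if_splits)
    then have "length i \<le> Suc (length j)" by (auto dest: childrenD)
    with n j(2) show "i \<in> tball (Suc (Suc n))" by (simp add: tree_ball_def)
  qed
  show "tball (Suc (Suc n)) \<subseteq> touching (tball (Suc n))"
  proof
    fix i assume i: "i \<in> tball (Suc (Suc n))"
    then have n: "i \<in> nodes" by (simp add: tree_ball_def)
    show "i \<in> touching (tball (Suc n))"
    proof (cases "i = []")
      case True
      then show ?thesis using n by (auto simp: touching_def tree_ball_def closed_nbhd_def)
    next
      case False
      then have "tl i \<in> closed_nbhd (Suc d) i \<inter> tball (Suc n)"
        using i n tl_node[OF n] by (auto simp: closed_nbhd_eq tree_ball_def)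
      then show ?thesis using n by (auto simp: touching_def)
    qed
  qed
qed

lemma ball_hamiltonian:
  fixes \<eta> :: "nat list \<Rightarrow> nat"
  assumes \<eta>: "\<eta> \<in> indep_configs (Suc d) (boundary (Suc d) (tball (Suc n)))" and \<nu>: "\<nu> \<in> configs (tball (Suc n))"
  shows "exp_neg (hamiltonian (Suc d) lam \<theta> (tball (Suc n)) (merge (tball (Suc n)) (boundary (Suc d) (tball (Suc n))) (\<nu>, \<eta>)))
    = (\<Prod>i\<in>tball n. node_weight i \<nu>) * (\<Prod>i\<in>level (Suc n). leaf_weight \<eta> i (\<nu> (tl i)) (\<nu> i))"
proof -
  let ?\<Lambda> = "tball (Suc n)" and ?bd = "boundary (Suc d) (tball (Suc n))"
  let ?m = "merge ?\<Lambda> ?bd (\<nu>, \<eta>)"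
  have bd: "c \<in> ?bd" if "c \<in> nodes" "length c = n + 2 \<or> length c = n + 3" for c
  proof -
    have p: "tl c \<in> touching ?\<Lambda>" unfolding touching_ball using that tl_node[OF that(1)] by (auto simp: tree_ball_def)
    have "c \<in> closed_nbhd (Suc d) (tl c)"
      using that tl_node[OF that(1)] by (auto simp: closed_nbhd_eq children_iff)
    then have "c \<in> ?\<Lambda> \<union> ?bd" using closed_nbhd_boundary[of "tl c" "Suc d" ?\<Lambda>] p by (auto simp: touching_def)
    then show ?thesis using that by (auto simp: tree_ball_def)
  qed
  have m_in: "?m i = \<nu> i" if "i \<in> ?\<Lambda>" for i using that by (simp add: merge_def)
  have m_out: "?m c = \<eta> c" if "c \<in> nodes" "length c = n + 2 \<or> length c = n + 3" for c
    using bd[OF that] that by (auto simp: merge_def tree_ball_def)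
  have mconf: "?m \<in> configs (?\<Lambda> \<union> ?bd)" using \<nu> indep_configs_subset[OF \<eta>] by (rule merge_configs)
  have "exp_neg (hamiltonian (Suc d) lam \<theta> ?\<Lambda> ?m) = (\<Prod>i\<in>touching ?\<Lambda>. node_weight i ?m)"
  proof (rule exp_neg_hamiltonian)
    show "finite (touching ?\<Lambda>)" by (simp add: touching_ball)
    show "?m i = 0 \<or> ?m i = 1" if "i \<in> touching ?\<Lambda>" for i
      using that touching_subset configs_01[OF mconf] by blast
  qed
  also have "\<dots> = (\<Prod>i\<in>?\<Lambda>. node_weight i ?m) * (\<Prod>i\<in>level (Suc (Suc n)). node_weight i ?m)"
    unfolding touching_ball
    by (subst tree_ball_Suc) (simp add: prod.union_disjoint tree_ball_level_disjoint)
  also have "(\<Prod>i\<in>?\<Lambda>. node_weight i ?m) = (\<Prod>i\<in>tball n. node_weight i ?m) * (\<Prod>i\<in>level (Suc n). node_weight i ?m)"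
    by (subst (2) tree_ball_Suc) (simp add: prod.union_disjoint tree_ball_level_disjoint)
  also have "(\<Prod>i\<in>tball n. node_weight i ?m) = (\<Prod>i\<in>tball n. node_weight i \<nu>)"
  proof (intro prod.cong refl node_weight_cong)
    fix i assume i: "i \<in> tball n"
    then show "i \<in> nodes" by (simp add: tree_ball_def)
    show "?m j = \<nu> j" if "j \<in> closed_nbhd (Suc d) i" for j
      using that closed_nbhd_ball[OF i] by (intro m_in) blast
  qed
  also have "(\<Prod>i\<in>level (Suc n). node_weight i ?m) = (\<Prod>i\<in>level (Suc n). wt (\<nu> i) (\<nu> (tl i) + (\<Sum>c\<in>ch i. \<eta> c)))"
  proof (intro prod.cong refl)
    fix i assume i: "i \<in> level (Suc n)"
    then have a: "i \<in> nodes" "i \<in> ?\<Lambda>" "tl i \<in> ?\<Lambda>" "i \<noteq> []"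
      using tl_node[of i "Suc d"] by (auto simp: tree_level_def tree_ball_def)
    moreover have "?m c = \<eta> c" if "c \<in> ch i" for c
      using that i a childrenD[OF that] by (intro m_out) (auto simp: children_iff tree_level_def)
    ultimately show "node_weight i ?m = wt (\<nu> i) (\<nu> (tl i) + (\<Sum>c\<in>ch i. \<eta> c))"
      by (simp add: node_weight_def par_def m_in)
  qed
  also have "(\<Prod>c\<in>level (Suc (Suc n)). node_weight c ?m)
      = (\<Prod>i\<in>level (Suc n). \<Prod>c\<in>ch i. node_weight c ?m)"
    unfolding tree_level_Suc[of _ "Suc n"]
    by (rule prod.UNION_disjoint) (use disjoint_children in \<open>auto simp: disjoint_family_on_def\<close>)
  also have "\<dots> = (\<Prod>i\<in>level (Suc n). \<Prod>c\<in>ch i. wt (\<eta> c) (\<nu> i + (\<Sum>g\<in>ch c. \<eta> g)))"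
  proof (intro prod.cong refl)
    fix i c assume i: "i \<in> level (Suc n)" and c: "c \<in> ch i"
    have n: "i \<in> nodes" "i \<in> ?\<Lambda>" "length i = Suc n" using i by (auto simp: tree_level_def tree_ball_def)
    have cn: "c \<in> nodes" "tl c = i" "c \<noteq> []" "length c = n + 2" using c n childrenD[OF c] by (auto simp: children_iff)
    have "?m c = \<eta> c" using cn by (intro m_out) auto
    moreover have "?m g = \<eta> g" if "g \<in> ch c" for g
      using that cn childrenD[OF that] by (intro m_out) (auto simp: children_iff)
    ultimately show "node_weight c ?m = wt (\<eta> c) (\<nu> i + (\<Sum>g\<in>ch c. \<eta> g))"
      using cn n by (simp add: node_weight_def par_def m_in)
  qed
  finally show ?thesis by (simp add: leaf_weight_def prod.distrib mult_ac)
qed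

lemma cond_prob_ball:
  assumes \<eta>: "\<eta> \<in> indep_configs (Suc d) (boundary (Suc d) (tball (Suc n)))"
  obtains x y where "\<And>i. i \<in> level (Suc n) \<Longrightarrow> 0 \<le> x i \<and> x i \<le> gain r 0 \<and> q \<le> y i \<and> y i \<le> r"
    and "\<And>S \<omega>. cond_prob_config (Suc d) lam \<theta> (tball (Suc n)) S \<omega> \<eta> = cprob n x y S \<omega>"
proof -
  let ?\<Lambda> = "tball (Suc n)" and ?bd = "boundary (Suc d) (tball (Suc n))"
  let ?h = "leaf_weight \<eta>"
  have lw: "0 < ?h i 0 0 \<and> (\<exists>x y. 0 \<le> x \<and> x \<le> gain r 0 \<and> q \<le> y \<and> y \<le> r \<and>
      (\<forall>a b. (a = 0 \<or> a = 1) \<and> (b = 0 \<or> b = 1) \<longrightarrow> ?h i a b = ?h i 0 0 * msg x y a b))"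
    if i: "i \<in> level (Suc n)" for i
  proof -
    have n: "i \<in> nodes" "i \<noteq> []" "length i = Suc n" using i by (auto simp: tree_level_def)
    have nb: "closed_nbhd (Suc d) c \<subseteq> ?\<Lambda> \<union> ?bd" if "c \<in> nodes" "length c \<le> n + 2" for c
    proof -
      have "c \<in> touching ?\<Lambda>" unfolding touching_ball using that by (simp add: tree_ball_def)
      then show ?thesis using closed_nbhd_boundary by (auto simp: touching_def)
    qed
    have ci: "c \<in> nodes" "c \<in> ?bd" if "c \<in> ch i" for c
    proof -
      show c: "c \<in> nodes" using that n by (simp add: children_iff)
      have "c \<in> ?\<Lambda> \<union> ?bd" using nb[OF n(1)] n that by (auto simp: closed_nbhd_eq)
      then show "c \<in> ?bd" using childrenD[OF that] n by (auto simp: tree_ball_def)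
    qed
    have gi: "g \<in> ?bd" "(c, g) \<in> tree_edges (Suc d)" if c: "c \<in> ch i" and g: "g \<in> ch c" for c g
    proof -
      have cl: "length c = n + 2" using childrenD[OF c] n by simp
      have "g \<in> ?\<Lambda> \<union> ?bd" using nb[OF ci(1)[OF c]] cl g by (auto simp: closed_nbhd_eq[OF ci(1)[OF c]])
      then show "g \<in> ?bd" using childrenD[OF g] cl by (auto simp: tree_ball_def)
      show "(c, g) \<in> tree_edges (Suc d)"
        using g ci(1)[OF c] by (cases g) (auto simp: tree_edges_def children_iff)
    qed
    have 01: "\<eta> j = 0 \<or> \<eta> j = 1" if "j \<in> ?bd" for j
      using configs_01[OF indep_configs_subset[OF \<eta>] that] .
    have ind: "(\<Sum>g\<in>ch c. \<eta> g) = 0" if c: "c \<in> ch i" and "\<eta> c = 1" for c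
    proof -
      have "\<eta> g = 0" if g: "g \<in> ch c" for g
        using \<eta> gi[OF c g] ci(2)[OF c] \<open>\<eta> c = 1\<close> 01[OF gi(1)[OF c g]] unfolding indep_configs_def by blast
      then show ?thesis by simp
    qed
    show ?thesis using leaf_weight_msg[of i \<eta>, OF n(2) 01[OF ci(2)] ind] by blast
  qed
  then have "\<forall>i. \<exists>x y. i \<in> level (Suc n) \<longrightarrow> 0 \<le> x \<and> x \<le> gain r 0 \<and> q \<le> y \<and> y \<le> r \<and>
      (\<forall>a b. (a = 0 \<or> a = 1) \<and> (b = 0 \<or> b = 1) \<longrightarrow> ?h i a b = ?h i 0 0 * msg x y a b)" by blast
  then obtain x y where xy: "\<And>i. i \<in> level (Suc n) \<Longrightarrow> 0 \<le> x i \<and> x i \<le> gain r 0 \<and> q \<le> y i \<and> y i \<le> r \<and>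
      (\<forall>a b. (a = 0 \<or> a = 1) \<and> (b = 0 \<or> b = 1) \<longrightarrow> ?h i a b = ?h i 0 0 * msg (x i) (y i) a b)"
    by metis
  define C where "C = (\<Prod>i\<in>level (Suc n). ?h i 0 0)"
  have C: "0 < C" unfolding C_def using lw by (intro prod_pos) auto
  have H: "exp_neg (hamiltonian (Suc d) lam \<theta> ?\<Lambda> (merge ?\<Lambda> ?bd (\<nu>, \<eta>))) = C * W n x y \<nu>"
    if \<nu>: "\<nu> \<in> configs ?\<Lambda>" for \<nu>
  proof -
    have "?h i (\<nu> (tl i)) (\<nu> i) = ?h i 0 0 * msg (x i) (y i) (\<nu> (tl i)) (\<nu> i)" if i: "i \<in> level (Suc n)" for i
    proof -
      have "i \<in> ?\<Lambda>" "tl i \<in> ?\<Lambda>" using i tl_node[of i "Suc d"] by (auto simp: tree_level_def tree_ball_def)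
      then show ?thesis using configs_01[OF \<nu>] xy[OF i] by blast
    qed
    then have "(\<Prod>i\<in>level (Suc n). ?h i (\<nu> (tl i)) (\<nu> i))
        = C * (\<Prod>i\<in>level (Suc n). msg (x i) (y i) (\<nu> (tl i)) (\<nu> i))"
      unfolding C_def prod.distrib[symmetric] by (rule prod.cong[OF refl])
    then show ?thesis unfolding ball_hamiltonian[OF \<eta> \<nu>] W_def by (simp add: mult_ac)
  qed
  show thesis
  proof (rule that)
    show "0 \<le> x i \<and> x i \<le> gain r 0 \<and> q \<le> y i \<and> y i \<le> r" if "i \<in> level (Suc n)" for i
      using xy[OF that] by blast
    fix S \<omega>
    have "cond_prob_config (Suc d) lam \<theta> ?\<Lambda> S \<omega> \<eta> = (C * cyl n x y S \<omega>) / (C * mass n x y)"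
      unfolding cond_prob_config_def
    proof (intro arg_cong2[where f = "(/)"])
      have "(\<Sum>\<nu>\<in>{\<nu> \<in> configs ?\<Lambda>. restrict \<nu> S = \<omega>}. exp_neg (hamiltonian (Suc d) lam \<theta> ?\<Lambda> (merge ?\<Lambda> ?bd (\<nu>, \<eta>))))
          = (\<Sum>\<nu>\<in>{\<nu> \<in> configs ?\<Lambda>. restrict \<nu> S = \<omega>}. C * W n x y \<nu>)"
        using H by (intro sum.cong) auto
      also have "\<dots> = (\<Sum>\<nu>\<in>configs ?\<Lambda>. C * (W n x y \<nu> * of_bool (restrict \<nu> S = \<omega>)))"
        by (subst sum.inter_filter) (auto intro!: sum.cong)
      finally show "(\<Sum>\<nu>\<in>{\<nu> \<in> configs ?\<Lambda>. restrict \<nu> S = \<omega>}. exp_neg (hamiltonian (Suc d) lam \<theta> ?\<Lambda> (merge ?\<Lambda> ?bd (\<nu>, \<eta>))))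
          = C * cyl n x y S \<omega>" by (simp add: cyl_def sum_distrib_left del: sum_of_bool_mult_eq sum_mult_of_bool_eq)
      show "(\<Sum>\<nu>\<in>configs ?\<Lambda>. exp_neg (hamiltonian (Suc d) lam \<theta> ?\<Lambda> (merge ?\<Lambda> ?bd (\<nu>, \<eta>)))) = C * mass n x y"
        using H by (simp add: mass_def sum_distrib_left)
    qed
    then show "cond_prob_config (Suc d) lam \<theta> ?\<Lambda> S \<omega> \<eta> = cprob n x y S \<omega>"
      using C by (simp add: cprob_def)
  qed
qed

text \<open>
  The messages that \<open>z\<close> induces \<open>k\<close> levels further up.
\<close>

primrec pull :: "(nat list \<Rightarrow> real \<times> real) \<Rightarrow> nat \<Rightarrow> nat list \<Rightarrow> real \<times> real" where
  "pull z 0 i = z i"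
| "pull z (Suc k) i =
    (lam * (\<Prod>c\<in>ch i. snd (pull z k c)) / ns (ch i) (\<lambda>c. fst (pull z k c)) 0,
     ns (ch i) (\<lambda>c. fst (pull z k c)) 1 / ns (ch i) (\<lambda>c. fst (pull z k c)) 0)"

lemma pull_nonneg:
  assumes "\<And>i. 0 \<le> fst (z i) \<and> 0 \<le> snd (z i)"
  shows "0 \<le> fst (pull z k i) \<and> 0 \<le> snd (pull z k i)"
proof (induction k arbitrary: i)
  case (Suc k)
  have "0 < ns (ch i) (\<lambda>c. fst (pull z k c)) j" for j
    by (rule ns_pos) (use Suc in auto)
  then show ?case using Suc lam_pos by (auto intro!: divide_nonneg_nonneg mult_nonneg_nonneg prod_nonneg simp: less_imp_le)
qed (use assms in simp)

text \<open>
  The sums over the children are monotone in each message separately, so unequal messages can be replaced by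
  the common endpoints of the interval.
\<close>

lemma pull_bounds:
  assumes "\<And>i. i \<in> nodes \<Longrightarrow> i \<noteq> [] \<Longrightarrow> 0 \<le> fst (z i) \<and> fst (z i) \<le> gain r 0 \<and> q \<le> snd (z i) \<and> snd (z i) \<le> r"
    and "i \<in> nodes" "i \<noteq> []"
  shows "xlo k \<le> fst (pull z k i) \<and> fst (pull z k i) \<le> xhi k \<and> ylo k \<le> snd (pull z k i) \<and> snd (pull z k i) \<le> yhi k"
  using assms(2,3)
proof (induction k arbitrary: i)
  case 0
  with assms(1)[of i] show ?case by (simp add: env_0)
next
  case (Suc k)
  let ?x = "\<lambda>c. fst (pull z k c)" and ?y = "\<lambda>c. snd (pull z k c)"
  have card: "card (ch i) = d" using Suc.prems by (simp add: card_children)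
  have IH: "xlo k \<le> ?x c \<and> ?x c \<le> xhi k \<and> ylo k \<le> ?y c \<and> ?y c \<le> yhi k" if "c \<in> ch i" for c
    using that Suc.prems by (intro Suc.IH) (auto simp: children_iff)
  have e: "0 \<le> xlo k" "0 \<le> xhi k" "0 \<le> ylo k" "0 \<le> yhi k" using env_bounds[of k] q_pos by linarith+
  have lo: "ns (ch i) (\<lambda>_. xlo k) j = bs d j (xlo k)" and hi: "ns (ch i) (\<lambda>_. xhi k) j = bs d j (xhi k)" for j
    by (simp_all add: nbr_sum_const card)
  have f: "bs d 0 (xlo k) \<le> ns (ch i) ?x 0" "ns (ch i) ?x 0 \<le> bs d 0 (xhi k)"
    unfolding lo[symmetric] hi[symmetric] using IH e
    by (auto intro!: nbr_sum_mono pos) (meson order_trans)+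
  have p: "0 < bs d 0 (xlo k)" using e by (intro bs_pos)
  have t: "tilt d (xlo k) \<le> ns (ch i) ?x 1 / ns (ch i) ?x 0" "ns (ch i) ?x 1 / ns (ch i) ?x 0 \<le> tilt d (xhi k)"
    unfolding tilt_def lo[symmetric] hi[symmetric] One_nat_def using IH e
    by (auto intro!: ns_ratio_mono) (meson order_trans)+
  have "ylo k ^ d \<le> (\<Prod>c\<in>ch i. ?y c)" "(\<Prod>c\<in>ch i. ?y c) \<le> yhi k ^ d"
    using prod_mono[of "ch i" "\<lambda>_. ylo k" ?y] prod_mono[of "ch i" ?y "\<lambda>_. yhi k"] IH e
    by (auto simp: card) (meson order_trans)+
  then have "gain (ylo k) (xhi k) \<le> lam * (\<Prod>c\<in>ch i. ?y c) / ns (ch i) ?x 0"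
    "lam * (\<Prod>c\<in>ch i. ?y c) / ns (ch i) ?x 0 \<le> gain (yhi k) (xlo k)"
    unfolding gain_def using f p lam_pos e order_trans[OF zero_le_power[OF e(3), of d]]
    by (auto intro!: frac_le mult_left_mono mult_nonneg_nonneg)
  with t show ?case by (simp add: env_Suc)
qed

text \<open>
  Weights are nonnegative and increasing in the messages; bounding numerator and denominator separately gives
  bounds that depend on the boundary condition only through its distance.
\<close>

lemma cprob_sandwich:
  assumes xy: "\<And>i. i \<in> level (Suc n) \<Longrightarrow> 0 \<le> x i \<and> x i \<le> gain r 0 \<and> q \<le> y i \<and> y i \<le> r"
    and Mn: "M \<le> n" and S: "S \<subseteq> tball (Suc M)"
  defines "k \<equiv> n - M"
  shows "cyl M (\<lambda>_. xlo k) (\<lambda>_. ylo k) S \<omega> / mass M (\<lambda>_. xhi k) (\<lambda>_. yhi k) \<le> cprob n x y S \<omega>"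
    and "cprob n x y S \<omega> \<le> cyl M (\<lambda>_. xhi k) (\<lambda>_. yhi k) S \<omega> / mass M (\<lambda>_. xlo k) (\<lambda>_. ylo k)"
proof -
  define z where "z i = (if i \<in> level (Suc n) then (x i, y i) else (0, q))" for i
  define X where "X i = fst (pull z (Suc n - length i) i)" for i
  define Y where "Y i = snd (pull z (Suc n - length i) i)" for i
  have zb: "0 \<le> fst (z i) \<and> fst (z i) \<le> gain r 0 \<and> q \<le> snd (z i) \<and> snd (z i) \<le> r" for i
    using xy[of i] q_pos q_le_r r_pos gain_nonneg[of r 0] by (auto simp: z_def)
  have "0 \<le> fst (z i) \<and> 0 \<le> snd (z i)" for i using zb[of i] q_pos by linarith
  then have nn: "0 \<le> X i" "0 \<le> Y i" for i unfolding X_def Y_def using pull_nonneg by blast+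
  have cons: "consistent X Y i" if "length i \<le> n" for i
  proof -
    have l: "Suc n - length i = Suc (n - length i)" using that by simp
    have "X c = fst (pull z (n - length i) c)" "Y c = snd (pull z (n - length i) c)" if "c \<in> ch i" for c
      using childrenD[OF that] by (simp_all add: X_def Y_def)
    then have "ns (ch i) X j = ns (ch i) (\<lambda>c. fst (pull z (n - length i) c)) j"
      "(\<Prod>c\<in>ch i. Y c) = (\<Prod>c\<in>ch i. snd (pull z (n - length i) c))" for j
      by (auto intro!: nbr_sum_cong prod.cong)
    then show ?thesis unfolding consistent_def by (simp add: X_def[of i] Y_def[of i] l)
  qed
  have W_eq: "W n x y \<nu> = W n X Y \<nu>" for \<nu>
    unfolding W_def by (intro arg_cong2[where f = "(*)"] prod.cong refl)
      (auto simp: X_def Y_def z_def tree_level_def)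
  have "cprob n x y S \<omega> = cprob n X Y S \<omega>"
    by (simp add: cprob_def cyl_def mass_def W_eq)
  also have "\<dots> = cprob M X Y S \<omega>"
    using cons by (intro cprob_stable nn Mn S) auto
  finally have eq: "cprob n x y S \<omega> = cyl M X Y S \<omega> / mass M X Y" by (simp add: cprob_def)
  have b: "xlo k \<le> X i \<and> X i \<le> xhi k \<and> ylo k \<le> Y i \<and> Y i \<le> yhi k" if "i \<in> level (Suc M)" for i
  proof -
    have "i \<in> nodes" "i \<noteq> []" "length i = Suc M" using that by (auto simp: tree_level_def)
    then show ?thesis using pull_bounds[of z i k, OF zb] by (simp add: X_def Y_def k_def)
  qed
  have e: "0 \<le> xlo k" "0 \<le> xhi k" "0 \<le> ylo k" "0 \<le> yhi k" using env_bounds[of k] q_pos by linarith+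
  have lo: "cyl M (\<lambda>_. xlo k) (\<lambda>_. ylo k) S \<omega> \<le> cyl M X Y S \<omega>" "mass M (\<lambda>_. xlo k) (\<lambda>_. ylo k) \<le> mass M X Y"
    using b e by (auto intro!: cyl_mono)
  have hi: "cyl M X Y S \<omega> \<le> cyl M (\<lambda>_. xhi k) (\<lambda>_. yhi k) S \<omega>" "mass M X Y \<le> mass M (\<lambda>_. xhi k) (\<lambda>_. yhi k)"
    using b nn by (auto intro!: cyl_mono)
  note p = mass_pos[of X Y M, OF nn] mass_pos[of "\<lambda>_. xlo k" "\<lambda>_. ylo k" M, OF e(1,3)]
    cyl_nonneg[of X Y M S \<omega>, OF nn] cyl_nonneg[of "\<lambda>_. xhi k" "\<lambda>_. yhi k" M S \<omega>, OF e(2,4)]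
  show "cyl M (\<lambda>_. xlo k) (\<lambda>_. ylo k) S \<omega> / mass M (\<lambda>_. xhi k) (\<lambda>_. yhi k) \<le> cprob n x y S \<omega>"
    unfolding eq using lo hi p by (intro frac_le) auto
  show "cprob n x y S \<omega> \<le> cyl M (\<lambda>_. xhi k) (\<lambda>_. yhi k) S \<omega> / mass M (\<lambda>_. xlo k) (\<lambda>_. ylo k)"
    unfolding eq using lo hi p by (intro frac_le) auto
qed

lemma tendsto_W:
  assumes "f \<longlonglongrightarrow> x" "g \<longlonglongrightarrow> y"
  shows "(\<lambda>k. W M (\<lambda>_. f k) (\<lambda>_. g k) \<nu>) \<longlonglongrightarrow> W M (\<lambda>_. x) (\<lambda>_. y) \<nu>"
  unfolding W_def msg_def using assms by (auto intro!: tendsto_intros simp: if_distrib)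

lemma tendsto_cyl_mass:
  assumes "f \<longlonglongrightarrow> x" "g \<longlonglongrightarrow> y"
  shows "(\<lambda>k. cyl M (\<lambda>_. f k) (\<lambda>_. g k) S \<omega>) \<longlonglongrightarrow> cyl M (\<lambda>_. x) (\<lambda>_. y) S \<omega>"
    and "(\<lambda>k. mass M (\<lambda>_. f k) (\<lambda>_. g k)) \<longlonglongrightarrow> mass M (\<lambda>_. x) (\<lambda>_. y)"
  unfolding cyl_def mass_def by (intro tendsto_intros tendsto_W assms)+

end

section \<open>Gibbs measures: uniqueness of cylinder probabilities and existence\<close>

abbreviation spin_space :: "nat list set \<Rightarrow> (nat list \<Rightarrow> nat) measure" where
  "spin_space I \<equiv> Pi\<^sub>M I (\<lambda>_. count_space {0, 1})"

lemma space_spin_space: "space (spin_space I) = configs I"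
  by (simp add: space_PiM configs_def)

lemma cylinder_sets:
  assumes "finite T" "T \<subseteq> I"
  shows "{\<xi> \<in> space (spin_space I). restrict \<xi> T = \<eta>} \<in> sets (spin_space I)"
proof (cases "\<eta> \<in> configs T")
  case True
  then have "{\<eta>} = (\<Pi>\<^sub>E i\<in>T. {\<eta> i})"
    by (intro PiE_singleton[symmetric]) (auto simp: configs_def PiE_def)
  also have "\<dots> \<in> sets (spin_space T)"
    using assms True by (intro sets_PiM_I_finite) (auto simp: configs_def PiE_iff)
  finally have "(\<lambda>\<xi>. restrict \<xi> T) -` {\<eta>} \<inter> space (spin_space I) \<in> sets (spin_space I)"
    using measurable_restrict_subset[OF assms(2)] by (rule measurable_sets[rotated])
  moreover have "(\<lambda>\<xi>. restrict \<xi> T) -` {\<eta>} \<inter> space (spin_space I)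
      = {\<xi> \<in> space (spin_space I). restrict \<xi> T = \<eta>}" by auto
  ultimately show ?thesis by simp
next
  case False
  then have "{\<xi> \<in> space (spin_space I). restrict \<xi> T = \<eta>} = {}"
    unfolding space_spin_space using restrict_configs[OF _ assms(2)] by auto
  then show ?thesis by (simp only: sets.empty_sets)
qed

lemma measure_cylinder_Union:
  assumes "prob_space \<mu>" and sets: "sets \<mu> = sets (spin_space I)" and T: "finite T" "T \<subseteq> I" and E: "finite E"
  shows "(\<Sum>\<eta>\<in>E. measure \<mu> {\<xi> \<in> space \<mu>. restrict \<xi> T = \<eta>}) = measure \<mu> {\<xi> \<in> space \<mu>. restrict \<xi> T \<in> E}"
proof -
  interpret prob_space \<mu> by fact
  have sp: "space \<mu> = space (spin_space I)" by (rule sets_eq_imp_space_eq[OF sets])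
  have "measure \<mu> (\<Union>\<eta>\<in>E. {\<xi> \<in> space \<mu>. restrict \<xi> T = \<eta>})
      = (\<Sum>\<eta>\<in>E. measure \<mu> {\<xi> \<in> space \<mu>. restrict \<xi> T = \<eta>})"
    using E cylinder_sets[OF T]
    by (intro finite_measure_finite_Union) (auto simp: sets sp disjoint_family_on_def)
  moreover have "(\<Union>\<eta>\<in>E. {\<xi> \<in> space \<mu>. restrict \<xi> T = \<eta>}) = {\<xi> \<in> space \<mu>. restrict \<xi> T \<in> E}" by auto
  ultimately show ?thesis by simp
qed

lemma measure_eq_cylinders:
  assumes "prob_space \<mu>" "prob_space \<nu>" and s: "sets \<mu> = sets (spin_space I)" "sets \<nu> = sets (spin_space I)"
    and eq: "\<And>S \<omega>. finite S \<Longrightarrow> S \<subseteq> I \<Longrightarrow> \<omega> \<in> configs S \<Longrightarrow>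
      measure \<mu> {\<xi> \<in> space \<mu>. restrict \<xi> S = \<omega>} = measure \<nu> {\<xi> \<in> space \<nu>. restrict \<xi> S = \<omega>}"
  shows "\<mu> = \<nu>"
proof (rule measure_eqI_PiM_infinite[OF s])
  interpret \<mu>: prob_space \<mu> by fact
  interpret \<nu>: prob_space \<nu> by fact
  show "finite_measure \<mu>" by unfold_locales
  fix J :: "nat list set" and A :: "nat list \<Rightarrow> nat set"
  assume J: "finite J" "J \<subseteq> I" and A: "\<And>i. i \<in> J \<Longrightarrow> A i \<in> sets (count_space {0, 1})"
  have sub: "Pi\<^sub>E J A \<subseteq> configs J" unfolding configs_def using A by (intro PiE_mono) auto
  have fin: "finite (Pi\<^sub>E J A)" by (rule finite_subset[OF sub]) (simp add: J)
  have emb: "prod_emb I (\<lambda>_. count_space {0, 1}) J (Pi\<^sub>E J A) = {\<xi> \<in> space \<kappa>. restrict \<xi> J \<in> Pi\<^sub>E J A}"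
    if "sets \<kappa> = sets (spin_space I)" for \<kappa>
    using sets_eq_imp_space_eq[OF that] by (auto simp: prod_emb_def space_PiM)
  have "measure \<mu> {\<xi> \<in> space \<mu>. restrict \<xi> J \<in> Pi\<^sub>E J A} = measure \<nu> {\<xi> \<in> space \<nu>. restrict \<xi> J \<in> Pi\<^sub>E J A}"
    unfolding measure_cylinder_Union[OF assms(1) s(1) J fin, symmetric]
      measure_cylinder_Union[OF assms(2) s(2) J fin, symmetric]
    using eq[OF J] sub by (intro sum.cong refl) auto
  then show "emeasure \<mu> (prod_emb I (\<lambda>_. count_space {0, 1}) J (Pi\<^sub>E J A))
      = emeasure \<nu> (prod_emb I (\<lambda>_. count_space {0, 1}) J (Pi\<^sub>E J A))"
    unfolding \<mu>.emeasure_eq_measure \<nu>.emeasure_eq_measure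
    by (subst emb[OF s(1)], subst emb[OF s(2)]) (rule arg_cong)
qed

lemma gibbs_boundary_total:
  assumes "gibbs_measure \<Delta> lam \<theta> \<mu>" "finite T" "T \<subseteq> tree_nodes \<Delta>"
  shows "(\<Sum>\<eta>\<in>indep_configs \<Delta> T. measure \<mu> {\<xi> \<in> space \<mu>. restrict \<xi> T = \<eta>}) = 1"
proof -
  have p: "prob_space \<mu>" and s: "sets \<mu> = sets (spin_space (tree_nodes \<Delta>))"
    and ae: "AE \<omega> in \<mu>. \<omega> \<in> indep_configs \<Delta> (tree_nodes \<Delta>)"
    using assms(1) by (auto simp: gibbs_measure_def)
  interpret prob_space \<mu> by (rule p)
  have sp: "space \<mu> = space (spin_space (tree_nodes \<Delta>))" by (rule sets_eq_imp_space_eq[OF s])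
  let ?E = "{\<xi> \<in> space \<mu>. restrict \<xi> T \<in> indep_configs \<Delta> T}"
  have "?E = (\<Union>\<eta>\<in>indep_configs \<Delta> T. {\<xi> \<in> space \<mu>. restrict \<xi> T = \<eta>})" by auto
  also have "\<dots> \<in> sets \<mu>"
    using cylinder_sets[OF assms(2,3)] finite_indep_configs[OF assms(2)] by (intro sets.finite_UN) (auto simp: s sp)
  finally have E: "?E \<in> events" .
  have "AE \<omega> in \<mu>. \<omega> \<in> ?E"
    using ae AE_space
  proof eventually_elim
    case (elim \<omega>)
    then have "restrict \<omega> T \<in> configs T" using restrict_configs assms(3) by (auto simp: indep_configs_def)
    with elim assms(3) show ?case by (auto simp: indep_configs_def)
  qed
  then have "prob ?E = 1" using prob_eq_1[OF E] by simp
  then show ?thesis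
    using measure_cylinder_Union[OF p s assms(2,3) finite_indep_configs[OF assms(2)]] by simp
qed

context tree_weights
begin

text \<open>
  A Gibbs measure averages the finite-volume probabilities over the boundary, and all of these lie in an
  interval that shrinks to a point as the boundary recedes.
\<close>

lemma gibbs_cylinder:
  assumes g: "gibbs_measure (Suc d) lam \<theta> \<mu>" and eq: "xl_lim = xh_lim"
    and S: "S \<subseteq> tball (Suc M)" and \<omega>: "\<omega> \<in> configs S"
  shows "measure \<mu> {\<xi> \<in> space \<mu>. restrict \<xi> S = \<omega>} = cprob M (\<lambda>_. xl_lim) (\<lambda>_. tilt d xl_lim) S \<omega>"
proof -
  let ?m = "measure \<mu> {\<xi> \<in> space \<mu>. restrict \<xi> S = \<omega>}"
  let ?l = "\<lambda>k. cyl M (\<lambda>_. xlo k) (\<lambda>_. ylo k) S \<omega> / mass M (\<lambda>_. xhi k) (\<lambda>_. yhi k)"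
  let ?u = "\<lambda>k. cyl M (\<lambda>_. xhi k) (\<lambda>_. yhi k) S \<omega> / mass M (\<lambda>_. xlo k) (\<lambda>_. ylo k)"
  have b: "?l k \<le> ?m \<and> ?m \<le> ?u k" for k
  proof -
    define n where "n = M + k"
    let ?\<Lambda> = "tball (Suc n)" and ?bd = "boundary (Suc d) (tball (Suc n))"
    let ?w = "\<lambda>\<eta>. measure \<mu> {\<xi> \<in> space \<mu>. restrict \<xi> ?bd = \<eta>}"
    have fin: "finite ?\<Lambda>" "?\<Lambda> \<subseteq> nodes" using finite_tree_ball by (auto simp: tree_ball_def)
    have S\<Lambda>: "S \<subseteq> ?\<Lambda>" using S tree_ball_mono[of "Suc M" "Suc n" "Suc d"] by (auto simp: n_def)
    have m: "?m = (\<Sum>\<eta>\<in>indep_configs (Suc d) ?bd. cond_prob_config (Suc d) lam \<theta> ?\<Lambda> S \<omega> \<eta> * ?w \<eta>)"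
      using g fin S\<Lambda> \<omega> unfolding gibbs_measure_def by blast
    have bd: "?bd \<subseteq> nodes" by (auto simp: boundary_def)
    have tot: "(\<Sum>\<eta>\<in>indep_configs (Suc d) ?bd. ?w \<eta>) = 1"
      by (rule gibbs_boundary_total[OF g finite_boundary[OF fin] bd])
    have cp: "?l k \<le> cond_prob_config (Suc d) lam \<theta> ?\<Lambda> S \<omega> \<eta> \<and> cond_prob_config (Suc d) lam \<theta> ?\<Lambda> S \<omega> \<eta> \<le> ?u k"
      if \<eta>: "\<eta> \<in> indep_configs (Suc d) ?bd" for \<eta>
    proof -
      obtain x y where xy: "\<And>i. i \<in> level (Suc n) \<Longrightarrow> 0 \<le> x i \<and> x i \<le> gain r 0 \<and> q \<le> y i \<and> y i \<le> r"
        and c: "\<And>S \<omega>. cond_prob_config (Suc d) lam \<theta> ?\<Lambda> S \<omega> \<eta> = cprob n x y S \<omega>"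
        using cond_prob_ball[OF \<eta>] by blast
      have "n - M = k" "M \<le> n" by (simp_all add: n_def)
      then show ?thesis unfolding c using cprob_sandwich[of n x y M S \<omega>, OF xy _ S] by simp
    qed
    have "(\<Sum>\<eta>\<in>indep_configs (Suc d) ?bd. ?l k * ?w \<eta>) \<le> ?m" "?m \<le> (\<Sum>\<eta>\<in>indep_configs (Suc d) ?bd. ?u k * ?w \<eta>)"
      unfolding m by (intro sum_mono mult_right_mono conjunct1[OF cp] conjunct2[OF cp] measure_nonneg; assumption)+
    then show ?thesis unfolding sum_distrib_left[symmetric] tot by simp
  qed
  have pos: "mass M (\<lambda>_. xl_lim) (\<lambda>_. tilt d xl_lim) \<noteq> 0"
    using mass_pos[of "\<lambda>_. xl_lim" "\<lambda>_. tilt d xl_lim" M] lim_bounds(1) tilt_bounds(1)[of xl_lim d] q_pos by force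
  note hi = xhi_tendsto[folded eq] yhi_tendsto[folded eq] and lo = xlo_tendsto ylo_tendsto
  have "?l \<longlonglongrightarrow> cprob M (\<lambda>_. xl_lim) (\<lambda>_. tilt d xl_lim) S \<omega>"
    unfolding cprob_def by (intro tendsto_divide tendsto_cyl_mass hi lo pos)
  moreover have "?u \<longlonglongrightarrow> cprob M (\<lambda>_. xl_lim) (\<lambda>_. tilt d xl_lim) S \<omega>"
    unfolding cprob_def by (intro tendsto_divide tendsto_cyl_mass hi lo pos)
  ultimately show ?thesis
    using b LIMSEQ_le_const[of ?u _ ?m] LIMSEQ_le_const2[of ?l _ ?m] by (meson antisym)
qed

lemma gibbs_unique:
  assumes "gibbs_measure (Suc d) lam \<theta> \<mu>" "gibbs_measure (Suc d) lam \<theta> \<nu>" and eq: "xl_lim = xh_lim"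
  shows "\<mu> = \<nu>"
proof (rule measure_eq_cylinders)
  show "prob_space \<mu>" "prob_space \<nu>" "sets \<mu> = sets (spin_space nodes)" "sets \<nu> = sets (spin_space nodes)"
    using assms by (auto simp: gibbs_measure_def)
  fix S :: "nat list set" and \<omega> assume S: "finite S" "S \<subseteq> nodes" and \<omega>: "\<omega> \<in> configs S"
  obtain M where "S \<subseteq> tball M" by (rule finite_subset_tree_ball[OF S])
  then have "S \<subseteq> tball (Suc M)" using tree_ball_mono[of M "Suc M" "Suc d"] by auto
  then show "measure \<mu> {\<xi> \<in> space \<mu>. restrict \<xi> S = \<omega>} = measure \<nu> {\<xi> \<in> space \<nu>. restrict \<xi> S = \<omega>}"
    using gibbs_cylinder[OF assms(1) eq _ \<omega>] gibbs_cylinder[OF assms(2) eq _ \<omega>] by simp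
qed

end

text \<open>
  A family of nonnegative messages that is consistent at every node but the root determines a Gibbs measure.
\<close>

locale messages = tree_weights +
  fixes X Y :: "nat list \<Rightarrow> real"
  assumes X_nonneg: "\<And>i. 0 \<le> X i" and Y_nonneg: "\<And>i. 0 \<le> Y i"
    and cons: "\<And>i. i \<in> nodes \<Longrightarrow> i \<noteq> [] \<Longrightarrow> consistent X Y i"
begin

definition ball_pmf :: "nat \<Rightarrow> (nat list \<Rightarrow> nat) pmf" where
  "ball_pmf n = embed_pmf (\<lambda>\<nu>. if \<nu> \<in> configs (tball (Suc n)) then W n X Y \<nu> / mass n X Y else 0)"

lemma pmf_ball: "pmf (ball_pmf n) \<nu> = (if \<nu> \<in> configs (tball (Suc n)) then W n X Y \<nu> / mass n X Y else 0)"
  unfolding ball_pmf_def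
proof (rule pmf_embed_pmf)
  have m: "0 < mass n X Y" by (rule mass_pos[OF X_nonneg Y_nonneg])
  have w: "0 \<le> W n X Y \<nu>" for \<nu> by (rule W_nonneg[OF X_nonneg Y_nonneg])
  then show "0 \<le> (if \<nu> \<in> configs (tball (Suc n)) then W n X Y \<nu> / mass n X Y else 0)" for \<nu>
    using m by simp
  have "(\<integral>\<^sup>+ \<nu>. ennreal (if \<nu> \<in> configs (tball (Suc n)) then W n X Y \<nu> / mass n X Y else 0) \<partial>count_space UNIV)
      = (\<Sum>\<nu>\<in>configs (tball (Suc n)). ennreal (W n X Y \<nu> / mass n X Y))"
    by (subst nn_integral_count_space'[of "configs (tball (Suc n))"]) auto
  also have "\<dots> = ennreal (\<Sum>\<nu>\<in>configs (tball (Suc n)). W n X Y \<nu> / mass n X Y)"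
    using w m by (intro sum_ennreal) simp
  also have "\<dots> = 1" using m by (simp add: sum_divide_distrib[symmetric] mass_def)
  finally show "(\<integral>\<^sup>+ \<nu>. ennreal (if \<nu> \<in> configs (tball (Suc n)) then W n X Y \<nu> / mass n X Y else 0) \<partial>count_space UNIV) = 1" .
qed

lemma set_ball_pmf: "set_pmf (ball_pmf n) \<subseteq> configs (tball (Suc n))"
  by (auto simp: set_pmf_eq pmf_ball)

lemma prob_ball_pmf: "measure (ball_pmf n) {\<nu>. restrict \<nu> S = \<omega>} = cprob n X Y S \<omega>"
proof -
  let ?C = "configs (tball (Suc n))"
  have "measure (ball_pmf n) {\<nu>. restrict \<nu> S = \<omega>} = measure (ball_pmf n) {\<nu> \<in> ?C. restrict \<nu> S = \<omega>}"
    by (intro measure_prob_cong_0) (auto simp: pmf_ball)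
  also have "\<dots> = (\<Sum>\<nu>\<in>{\<nu> \<in> ?C. restrict \<nu> S = \<omega>}. W n X Y \<nu> / mass n X Y)"
    by (subst measure_measure_pmf_finite) (auto simp: pmf_ball)
  also have "\<dots> = (\<Sum>\<nu>\<in>?C. W n X Y \<nu> * of_bool (restrict \<nu> S = \<omega>) / mass n X Y)"
    by (subst sum.inter_filter) (auto intro!: sum.cong)
  finally show ?thesis by (simp only: cprob_def cyl_def sum_divide_distrib)
qed

lemma cprob_level_free:
  assumes "S \<subseteq> tball (Suc m)" "S \<subseteq> tball (Suc n)"
  shows "cprob m X Y S \<omega> = cprob n X Y S \<omega>"
proof -
  have "cprob n X Y S \<omega> = cprob m X Y S \<omega>" if "m \<le> n" "S \<subseteq> tball (Suc m)" for m n
    using that by (intro cprob_stable X_nonneg) (auto intro!: cons)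
  then show ?thesis using assms by (metis nat_le_linear)
qed

text \<open>
  Some ball that contains a given finite set; by \<open>cprob_level_free\<close> its choice is immaterial.
\<close>

definition radius :: "nat list set \<Rightarrow> nat" where
  "radius J = (SOME n. J \<subseteq> tball (Suc n))"

lemma radius:
  assumes "finite J" "J \<subseteq> nodes"
  shows "J \<subseteq> tball (Suc (radius J))"
proof -
  obtain n where "J \<subseteq> tball n" by (rule finite_subset_tree_ball[OF assms])
  then have "J \<subseteq> tball (Suc n)" using tree_ball_mono[of n "Suc n" "Suc d"] by auto
  then show ?thesis unfolding radius_def by (rule someI)
qed

definition marginal :: "nat list set \<Rightarrow> (nat list \<Rightarrow> nat) pmf" where
  "marginal J = map_pmf (\<lambda>\<nu>. restrict \<nu> J) (ball_pmf (radius J))"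

lemma pmf_marginal:
  assumes "finite J" "J \<subseteq> nodes" "J \<subseteq> tball (Suc n)"
  shows "pmf (marginal J) \<omega> = cprob n X Y J \<omega>"
proof -
  have "pmf (marginal J) \<omega> = measure (ball_pmf (radius J)) {\<nu>. restrict \<nu> J = \<omega>}"
    by (simp add: marginal_def pmf_map vimage_def)
  then show ?thesis using prob_ball_pmf cprob_level_free[OF radius[OF assms(1,2)] assms(3)] by simp
qed

lemma set_marginal: "finite J \<Longrightarrow> J \<subseteq> nodes \<Longrightarrow> set_pmf (marginal J) \<subseteq> configs J"
  using set_ball_pmf radius restrict_configs by (fastforce simp: marginal_def)

lemma marginal_restrict:
  assumes "J \<subseteq> H" "finite H" "H \<subseteq> nodes"
  shows "map_pmf (\<lambda>\<nu>. restrict \<nu> J) (marginal H) = marginal J"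
proof (rule pmf_eqI)
  fix \<omega>
  have J: "finite J" "J \<subseteq> nodes" using assms finite_subset by auto
  have "map_pmf (\<lambda>\<nu>. restrict \<nu> J) (marginal H) = map_pmf (\<lambda>\<nu>. restrict \<nu> J) (ball_pmf (radius H))"
    using assms(1) by (simp add: marginal_def map_pmf_comp Int_absorb1)
  then have "pmf (map_pmf (\<lambda>\<nu>. restrict \<nu> J) (marginal H)) \<omega> = cprob (radius H) X Y J \<omega>"
    by (simp add: pmf_map vimage_def prob_ball_pmf)
  also have "\<dots> = pmf (marginal J) \<omega>"
    using pmf_marginal[OF J] radius[OF assms(2,3)] assms(1) by (metis order_trans)
  finally show "pmf (map_pmf (\<lambda>\<nu>. restrict \<nu> J) (marginal H)) \<omega> = pmf (marginal J) \<omega>" .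
qed

text \<open>
  The marginals as measures with real spins, since Kolmogorov's extension theorem is stated for Polish
  spaces.
\<close>

definition real_marginal :: "nat list set \<Rightarrow> (nat list \<Rightarrow> real) measure" where
  "real_marginal J = distr (marginal J) (Pi\<^sub>M J (\<lambda>_. borel)) (\<lambda>\<nu>. \<lambda>i\<in>J. real (\<nu> i))"

sublocale polish_projective nodes real_marginal
proof (unfold polish_projective_def, rule projective_family.intro)
  fix J H :: "nat list set" assume JH: "J \<subseteq> H" "finite H" "H \<subseteq> nodes"
  have "real_marginal J = distr (map_pmf (\<lambda>\<nu>. restrict \<nu> J) (marginal H)) (Pi\<^sub>M J (\<lambda>_. borel)) (\<lambda>\<nu>. \<lambda>i\<in>J. real (\<nu> i))"
    by (simp add: marginal_restrict[OF JH] real_marginal_def)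
  also have "\<dots> = distr (marginal H) (Pi\<^sub>M J (\<lambda>_. borel)) (\<lambda>\<nu>. \<lambda>i\<in>J. real (\<nu> i))"
    by (simp add: map_pmf_rep_eq distr_distr space_PiM PiE_iff comp_def cong: restrict_cong)
  also have "\<dots> = distr (real_marginal H) (Pi\<^sub>M J (\<lambda>_. borel)) (\<lambda>f. restrict f J)"
    unfolding real_marginal_def using JH
    by (subst distr_distr) (auto intro!: measurable_restrict_subset simp: comp_def Int_absorb1 space_PiM PiE_iff)
  finally show "real_marginal J = distr (real_marginal H) (Pi\<^sub>M J (\<lambda>_. borel)) (\<lambda>f. restrict f J)" .
next
  fix J :: "nat list set" assume "finite J" "J \<subseteq> nodes"
  show "prob_space (real_marginal J)"
    unfolding real_marginal_def by (intro measure_pmf.prob_space_distr) (auto simp: space_PiM PiE_iff)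
qed

definition to_spin :: "real \<Rightarrow> nat" where
  "to_spin x = (if x = 1 then 1 else 0)"

lemma to_spin_measurable: "to_spin \<in> borel \<rightarrow>\<^sub>M count_space {0, 1}"
  unfolding to_spin_def by (intro measurable_If) auto

definition tree_measure :: "(nat list \<Rightarrow> nat) measure" where
  "tree_measure = distr lim (spin_space nodes) (\<lambda>f. \<lambda>i\<in>nodes. to_spin (f i))"

lemma spins_measurable: "(\<lambda>f. \<lambda>i\<in>I. to_spin (f i)) \<in> Pi\<^sub>M I (\<lambda>_. borel) \<rightarrow>\<^sub>M spin_space I"
  by (rule measurable_restrict, rule measurable_compose[OF _ to_spin_measurable])
    (rule measurable_component_singleton)

lemma spins_measurable_lim: "(\<lambda>f. \<lambda>i\<in>nodes. to_spin (f i)) \<in> lim \<rightarrow>\<^sub>M spin_space nodes"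
  using spins_measurable[of nodes] by (simp add: measurable_cong_sets[OF sets_lim refl])

lemma prob_space_tree_measure: "prob_space tree_measure"
  unfolding tree_measure_def by (rule P.prob_space_distr[OF spins_measurable_lim])

lemma sets_tree_measure: "sets tree_measure = sets (spin_space nodes)"
  by (simp add: tree_measure_def)

lemma space_tree_measure: "space tree_measure = configs nodes"
  unfolding tree_measure_def space_distr by (rule space_spin_space)

lemma measure_tree_measure:
  assumes S: "finite S" "S \<subseteq> nodes" "S \<subseteq> tball (Suc n)"
  shows "measure tree_measure {\<xi> \<in> space tree_measure. restrict \<xi> S = \<omega>} = cprob n X Y S \<omega>"
proof -
  let ?A = "{f \<in> space (Pi\<^sub>M S (\<lambda>_. borel :: real measure)). (\<lambda>i\<in>S. to_spin (f i)) = \<omega>}"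
  have "?A = (\<lambda>f. \<lambda>i\<in>S. to_spin (f i)) -` {\<xi> \<in> space (spin_space S). restrict \<xi> S = \<omega>} \<inter> space (Pi\<^sub>M S (\<lambda>_. borel))"
    by (auto simp: space_PiM to_spin_def)
  also have "\<dots> \<in> sets (Pi\<^sub>M S (\<lambda>_. borel))"
    by (rule measurable_sets[OF spins_measurable cylinder_sets[OF S(1)]]) simp
  finally have A: "?A \<in> sets (Pi\<^sub>M S (\<lambda>_. borel))" .
  have "measure tree_measure {\<xi> \<in> space tree_measure. restrict \<xi> S = \<omega>}
      = measure lim ((\<lambda>f. \<lambda>i\<in>nodes. to_spin (f i)) -` {\<xi> \<in> space (spin_space nodes). restrict \<xi> S = \<omega>} \<inter> space lim)"
    unfolding tree_measure_def
    by (subst measure_distr[OF spins_measurable_lim]) (use cylinder_sets[OF S(1,2)] in simp_all)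
  also have "(\<lambda>f. \<lambda>i\<in>nodes. to_spin (f i)) -` {\<xi> \<in> space (spin_space nodes). restrict \<xi> S = \<omega>} \<inter> space lim
      = prod_emb nodes (\<lambda>_. borel) S ?A"
  proof -
    have "restrict (\<lambda>i\<in>nodes. to_spin (f i)) S = (\<lambda>i\<in>S. to_spin (restrict f S i))" for f
      using S(2) by (auto simp: fun_eq_iff restrict_def)
    then show ?thesis by (auto simp: prod_emb_def space_PiM to_spin_def)
  qed
  also have "measure lim \<dots> = measure (real_marginal S) ?A"
    by (rule measure_lim_emb[OF S(2,1) A])
  also have "\<dots> = measure (marginal S) {\<nu>. (\<lambda>i\<in>S. to_spin (real (\<nu> i))) = \<omega>}"
  proof -
    have "(\<lambda>\<nu>. \<lambda>i\<in>S. real (\<nu> i)) -` ?A = {\<nu>. (\<lambda>i\<in>S. to_spin (real (\<nu> i))) = \<omega>}"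
      by (auto simp: space_PiM PiE_iff cong: restrict_cong)
    then show ?thesis
      unfolding real_marginal_def using A by (subst measure_distr) (auto simp: space_PiM PiE_iff)
  qed
  also have "\<dots> = measure (marginal S) {\<omega>}"
  proof (rule measure_prob_cong_0)
    have *: "(\<lambda>i\<in>S. to_spin (real (\<nu> i))) = \<nu>" if "\<nu> \<in> configs S" for \<nu>
    proof
      fix i show "(\<lambda>i\<in>S. to_spin (real (\<nu> i))) i = \<nu> i"
        using that configs_01[OF that, of i] by (cases "i \<in> S") (auto simp: to_spin_def configs_def PiE_def extensional_def)
    qed
    show "pmf (marginal S) \<nu> = 0" if "\<nu> \<in> {\<nu>. (\<lambda>i\<in>S. to_spin (real (\<nu> i))) = \<omega>} - {\<omega>}" for \<nu>
      using that *[of \<nu>] set_marginal[OF S(1,2)] by (auto simp: set_pmf_iff)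
    show "pmf (marginal S) \<nu> = 0" if "\<nu> \<in> {\<omega>} - {\<nu>. (\<lambda>i\<in>S. to_spin (real (\<nu> i))) = \<omega>}" for \<nu>
      using that *[of \<nu>] set_marginal[OF S(1,2)] by (auto simp: set_pmf_iff)
  qed
  also have "\<dots> = cprob n X Y S \<omega>"
    using pmf_marginal[OF S] by (simp add: measure_pmf_single)
  finally show ?thesis .
qed

lemma tree_measure_indep: "AE \<omega> in tree_measure. \<omega> \<in> indep_configs (Suc d) nodes"
proof -
  interpret T: prob_space tree_measure by (rule prob_space_tree_measure)
  have "AE \<xi> in tree_measure. \<forall>e\<in>tree_edges (Suc d). \<not> (\<xi> (fst e) = 1 \<and> \<xi> (snd e) = 1)"
  proof (subst AE_ball_countable)
    show "\<forall>e\<in>tree_edges (Suc d). AE \<xi> in tree_measure. \<not> (\<xi> (fst e) = 1 \<and> \<xi> (snd e) = 1)"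
    proof
      fix e assume e: "e \<in> tree_edges (Suc d)"
      obtain i j where ij: "e = (i, j)" by force
      have n: "i \<in> nodes" "j \<in> nodes" using e ij by (auto simp: tree_edges_def)
      let ?T = "{i, j}" and ?o = "\<lambda>k\<in>{i, j}. 1 :: nat"
      obtain n where T: "?T \<subseteq> tball n" using finite_subset_tree_ball[of ?T "Suc d"] n by auto
      have o: "?o \<notin> indep_configs (Suc d) ?T" using e ij by (auto simp: indep_configs_def)
      have "cyl n X Y ?T ?o = 0"
        unfolding cyl_def using W_indep[OF _ T] o by (intro sum.neutral) auto
      then have z: "measure tree_measure {\<xi> \<in> space tree_measure. restrict \<xi> ?T = ?o} = 0"
        using measure_tree_measure[of ?T n ?o] T n tree_ball_mono[of n "Suc n" "Suc d"] by (auto simp: cprob_def)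
      show "AE \<xi> in tree_measure. \<not> (\<xi> (fst e) = 1 \<and> \<xi> (snd e) = 1)"
      proof (rule AE_I)
        show "{\<xi> \<in> space tree_measure. \<not> \<not> (\<xi> (fst e) = 1 \<and> \<xi> (snd e) = 1)}
            \<subseteq> {\<xi> \<in> space tree_measure. restrict \<xi> ?T = ?o}"
          using ij by (auto simp: fun_eq_iff restrict_def)
        show "emeasure tree_measure {\<xi> \<in> space tree_measure. restrict \<xi> ?T = ?o} = 0"
          using z by (simp add: T.emeasure_eq_measure)
        show "{\<xi> \<in> space tree_measure. restrict \<xi> ?T = ?o} \<in> T.events"
          using cylinder_sets[of ?T nodes ?o] n
          unfolding sets_tree_measure space_tree_measure space_spin_space by blast
      qed
    qed
  qed simp
  then show ?thesis
    using AE_space by eventually_elim (auto simp: indep_configs_def space_tree_measure)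
qed

lemma gibbs_tree_measure: "gibbs_measure (Suc d) lam \<theta> tree_measure"
  unfolding gibbs_measure_def
proof (intro conjI allI impI prob_space_tree_measure sets_tree_measure tree_measure_indep)
  fix \<Lambda> S :: "nat list set" and \<omega>
  assume "finite \<Lambda> \<and> \<Lambda> \<subseteq> nodes \<and> S \<subseteq> \<Lambda> \<and> \<omega> \<in> configs S"
  then have \<Lambda>: "finite \<Lambda>" "\<Lambda> \<subseteq> nodes" and S: "S \<subseteq> \<Lambda>" by auto
  let ?bd = "boundary (Suc d) \<Lambda>"
  have bd: "finite ?bd" "?bd \<subseteq> nodes" using finite_boundary[OF \<Lambda>] by (auto simp: boundary_def)
  obtain n where n: "\<Lambda> \<union> ?bd \<subseteq> tball n" using finite_subset_tree_ball[of "\<Lambda> \<union> ?bd" "Suc d"] \<Lambda> bd by auto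
  then have n': "\<Lambda> \<union> ?bd \<subseteq> tball (Suc n)" using tree_ball_mono[of n "Suc n" "Suc d"] by auto
  have "finite S" "S \<subseteq> nodes" "S \<subseteq> tball (Suc n)" using S \<Lambda> n' finite_subset by auto
  then have "measure tree_measure {\<xi> \<in> space tree_measure. restrict \<xi> S = \<omega>} = cprob n X Y S \<omega>"
    by (rule measure_tree_measure)
  moreover have "measure tree_measure {\<xi> \<in> space tree_measure. restrict \<xi> ?bd = \<eta>} = cprob n X Y ?bd \<eta>" for \<eta>
    using bd n' by (intro measure_tree_measure) auto
  ultimately show "measure tree_measure {\<xi> \<in> space tree_measure. restrict \<xi> S = \<omega>}
      = (\<Sum>\<eta>\<in>indep_configs (Suc d) ?bd. cond_prob_config (Suc d) lam \<theta> \<Lambda> S \<omega> \<eta>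
        * measure tree_measure {\<xi> \<in> space tree_measure. restrict \<xi> ?bd = \<eta>})"
    using cprob_gibbs[OF n S, of X Y \<omega>] by simp
qed

end

section \<open>The uniqueness criterion and the two bounds\<close>

context tree_weights
begin

text \<open>
  The root has \<open>d + 1\<close> children, one more than any other node, and no parent.
\<close>

lemma root_sum:
  fixes g :: "nat \<Rightarrow> real"
  shows "(\<Sum>\<nu>\<in>configs (tball (Suc 0)). W 0 X Y \<nu> * g (\<nu> []))
    = g 0 * ns (ch []) X 0 + g 1 * (lam * (\<Prod>c\<in>ch []. Y c))"
proof -
  have lev: "level (Suc 0) = ch []"
  proof -
    have "level 0 = {[]}" by (auto simp: tree_level_def tree_nodes.root)
    then show ?thesis by (simp add: tree_level_Suc)
  qed
  have disj: "{[]} \<inter> ch [] = {}" by (auto dest: childrenD)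
  have ball: "tball (Suc 0) = {[]} \<union> ch []"
    by (simp add: tree_ball_Suc tree_ball_0 lev)
  have root: "(\<Sum>t\<in>{[]::nat list} \<rightarrow>\<^sub>E {0, 1::nat}. h (t [])) = h 0 + h 1" for h :: "nat \<Rightarrow> real"
    using sum_PiE_insert[of "{}" "[]::nat list" "\<lambda>t. h (t [])"] by simp
  let ?s = "\<lambda>b s. wt b (0 + (\<Sum>c\<in>ch []. s c)) * (\<Prod>c\<in>ch []. msg (X c) (Y c) b (s c))"
  have W: "W 0 X Y (merge {[]} (ch []) (t, s)) * g (merge {[]} (ch []) (t, s) []) = g (t []) * ?s (t []) s" for t s
  proof -
    let ?m = "merge {[]} (ch []) (t, s)"
    have m: "?m [] = t []" "?m c = s c" "tl c = []" if "c \<in> ch []" for c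
      using that childrenD[OF that] by (auto simp: merge_def)
    have m0: "?m [] = t []" by (simp add: merge_def)
    have "(\<Sum>c\<in>ch []. ?m c) = (\<Sum>c\<in>ch []. s c)"
      "(\<Prod>c\<in>ch []. msg (X c) (Y c) (?m (tl c)) (?m c)) = (\<Prod>c\<in>ch []. msg (X c) (Y c) (t []) (s c))"
      using m by (auto intro!: sum.cong prod.cong)
    then show ?thesis
      by (simp add: W_def tree_ball_0 lev node_weight_def par_def m0)
  qed
  have "(\<Sum>\<nu>\<in>configs (tball (Suc 0)). W 0 X Y \<nu> * g (\<nu> []))
      = (\<Sum>t\<in>{[]::nat list} \<rightarrow>\<^sub>E {0, 1}. g (t []) * (\<Sum>s\<in>ch [] \<rightarrow>\<^sub>E {0, 1}. ?s (t []) s))"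
    unfolding configs_def ball sum_PiE_Un[OF disj] W by (intro sum.cong refl) (rule sum_distrib_left[symmetric])
  also have "\<dots> = g 0 * (\<Sum>s\<in>ch [] \<rightarrow>\<^sub>E {0, 1}. ?s 0 s) + g 1 * (\<Sum>s\<in>ch [] \<rightarrow>\<^sub>E {0, 1}. ?s 1 s)"
    by (rule root)
  also have "\<dots> = g 0 * ns (ch []) X 0 + g 1 * (lam * (\<Prod>c\<in>ch []. Y c))"
    unfolding node_sum_vacant node_sum_occupied[OF finite_children] by simp
  finally show ?thesis .
qed

text \<open>
  The odds of the root being occupied when \<open>b\<close> is the message of its children and \<open>a\<close> that of its
  grandchildren.
\<close>

definition root_odds :: "real \<Rightarrow> real \<Rightarrow> real" where
  "root_odds a b = lam * tilt d a ^ Suc d / bs (Suc d) 0 b"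

text \<open>
  A solution of period at most two of the recursion gives a consistent family of messages that depends only on
  the parity of the level.
\<close>

lemma cycle_gibbs:
  assumes ab: "0 \<le> a" "0 \<le> b" "a = gain (tilt d a) b" "b = gain (tilt d b) a"
  obtains \<mu> where "gibbs_measure (Suc d) lam \<theta> \<mu>"
    and "measure \<mu> {\<xi> \<in> space \<mu>. restrict \<xi> {[]} = (\<lambda>i\<in>{[]}. 1)} = root_odds a b / (1 + root_odds a b)"
proof -
  define X :: "nat list \<Rightarrow> real" where "X i = (if even (length i) then a else b)" for i
  define Y where "Y i = (if even (length i) then tilt d b else tilt d a)" for i :: "nat list"
  have len: "length c = Suc (length i)" if "c \<in> ch i" for c i using childrenD[OF that] by simp
  have chX: "ns (ch i) X j = bs (card (ch i)) j (if even (length i) then b else a)" for i j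
  proof -
    have "ns (ch i) X j = ns (ch i) (\<lambda>_. if even (length i) then b else a) j"
      by (rule nbr_sum_cong) (simp add: X_def len)
    then show ?thesis by (simp add: nbr_sum_const)
  qed
  have chY: "(\<Prod>c\<in>ch i. Y c) = (if even (length i) then tilt d a else tilt d b) ^ card (ch i)" for i
  proof -
    have "(\<Prod>c\<in>ch i. Y c) = (\<Prod>c\<in>ch i. if even (length i) then tilt d a else tilt d b)"
      by (rule prod.cong) (simp_all add: Y_def len)
    then show ?thesis by simp
  qed
  interpret M: messages \<theta> q r d lam X Y
  proof
    show "0 \<le> X i" for i using ab by (simp add: X_def)
    show "0 \<le> Y i" for i using ab tilt_bounds[of a d] tilt_bounds[of b d] q_pos by (simp add: Y_def)
    show "consistent X Y i" if "i \<noteq> []" for i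
    proof -
      have "card (ch i) = d" using that by (simp add: card_children)
      then show ?thesis
        using ab(3,4)[symmetric] unfolding consistent_def chX chY by (simp add: X_def Y_def gain_def tilt_def)
    qed
  qed
  show thesis
  proof (rule that)
    show "gibbs_measure (Suc d) lam \<theta> M.tree_measure" by (rule M.gibbs_tree_measure)
    have root: "[] \<in> nodes" by (rule tree_nodes.root)
    have card: "card (ch []) = Suc d" by (simp add: card_children)
    let ?F = "bs (Suc d) 0 b" and ?R = "lam * tilt d a ^ Suc d"
    have F: "0 < ?F" by (rule bs_pos[OF ab(2)])
    have eq: "restrict \<nu> {[]} = (\<lambda>i\<in>{[]}. 1) \<longleftrightarrow> \<nu> [] = 1" for \<nu> :: "nat list \<Rightarrow> nat"
      by (auto simp: fun_eq_iff)
    have "cyl 0 X Y {[]} (\<lambda>i\<in>{[]}. 1) = ?R"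
      using root_sum[of X Y "\<lambda>s. of_bool (s = 1)"] unfolding cyl_def eq by (simp add: chY card)
    moreover have "mass 0 X Y = ?F + ?R"
      using root_sum[of X Y "\<lambda>_. 1"] by (simp add: mass_def chX chY card)
    ultimately have "cprob 0 X Y {[]} (\<lambda>i\<in>{[]}. 1) = root_odds a b / (1 + root_odds a b)"
      using F by (simp add: cprob_def root_odds_def divide_simps)
    then show "measure M.tree_measure {\<xi> \<in> space M.tree_measure. restrict \<xi> {[]} = (\<lambda>i\<in>{[]}. 1)}
        = root_odds a b / (1 + root_odds a b)"
      using M.measure_tree_measure[of "{[]}" 0] root by (simp add: tree_ball_def)
  qed
qed

lemma root_odds_less:
  assumes "0 \<le> a" "a < b"
  shows "root_odds a b < root_odds b a"
proof -
  have t: "tilt d a \<le> tilt d b" "0 < tilt d a"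
    using tilt_mono[of a b d] tilt_bounds(1)[of a d] q_pos assms by auto
  have "a * bs d 1 a \<le> a * bs d 1 b" "a * bs d 1 b < b * bs d 1 b" "bs d 0 a \<le> bs d 0 b"
    using assms bs_mono[of a b d] bs_pos[of b d 1] by (auto intro!: mult_left_mono)
  then have "bs (Suc d) 0 a < bs (Suc d) 0 b" by (simp add: binom_sum_Suc)
  moreover have "0 < bs (Suc d) 0 a" using assms by (intro bs_pos)
  ultimately show ?thesis
    unfolding root_odds_def using t lam_pos
    by (intro frac_less2 mult_left_mono power_mono mult_pos_pos zero_less_power) auto
qed

lemma root_odds_pos: "0 \<le> a \<Longrightarrow> 0 \<le> b \<Longrightarrow> 0 < root_odds a b"
  unfolding root_odds_def using lam_pos tilt_bounds(1)[of a d] q_pos bs_pos[of b "Suc d" 0]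
  by (intro divide_pos_pos mult_pos_pos zero_less_power) auto

text \<open>
  If the two limits agree, the boundary is forgotten. If they differ, then placing them on even and odd levels
  or the other way round gives two Gibbs measures, which the spin of the root tells apart.
\<close>

theorem uniqueness_iff: "uniqueness_regime (Suc d) lam \<theta> \<longleftrightarrow> xl_lim = xh_lim"
proof
  have nn: "0 \<le> xl_lim" "0 \<le> xh_lim" using lim_bounds by auto
  show "uniqueness_regime (Suc d) lam \<theta>" if "xl_lim = xh_lim"
  proof -
    obtain \<mu> where "gibbs_measure (Suc d) lam \<theta> \<mu>"
      using cycle_gibbs[OF nn lim_fixed] by blast
    then show ?thesis unfolding uniqueness_regime_def using gibbs_unique[OF _ _ that] by blast
  qed
  show "xl_lim = xh_lim" if u: "uniqueness_regime (Suc d) lam \<theta>"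
  proof (rule ccontr)
    assume "xl_lim \<noteq> xh_lim"
    then have lt: "xl_lim < xh_lim" using lim_bounds by simp
    obtain \<mu> where \<mu>: "gibbs_measure (Suc d) lam \<theta> \<mu>"
      "measure \<mu> {\<xi> \<in> space \<mu>. restrict \<xi> {[]} = (\<lambda>i\<in>{[]}. 1)}
        = root_odds xl_lim xh_lim / (1 + root_odds xl_lim xh_lim)"
      using cycle_gibbs[OF nn lim_fixed] by blast
    obtain \<nu> where \<nu>: "gibbs_measure (Suc d) lam \<theta> \<nu>"
      "measure \<nu> {\<xi> \<in> space \<nu>. restrict \<xi> {[]} = (\<lambda>i\<in>{[]}. 1)}
        = root_odds xh_lim xl_lim / (1 + root_odds xh_lim xl_lim)"
      using cycle_gibbs[OF nn(2,1) lim_fixed(2,1)] by blast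
    have "\<mu> = \<nu>" using u \<mu>(1) \<nu>(1) unfolding uniqueness_regime_def by blast
    then have "root_odds xl_lim xh_lim / (1 + root_odds xl_lim xh_lim)
        = root_odds xh_lim xl_lim / (1 + root_odds xh_lim xl_lim)" using \<mu>(2) \<nu>(2) by simp
    then have "root_odds xl_lim xh_lim = root_odds xh_lim xl_lim"
      using root_odds_pos[OF nn] root_odds_pos[OF nn(2,1)] by (simp add: frac_eq_eq algebra_simps)
    then show False using root_odds_less[OF nn(1) lt] by simp
  qed
qed

end

text \<open>
  A vacant node has at most \<open>\<Delta>\<close> occupied neighbours, so the prolongation of \<open>\<theta>\<close> beyond \<open>\<Delta>\<close> never
  enters the potential.
\<close>

lemma uniqueness_regime_cong:
  assumes "1 \<le> \<Delta>" and eq: "\<And>k. k \<le> \<Delta> \<Longrightarrow> \<theta> k = \<theta>' k"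
  shows "uniqueness_regime \<Delta> lam \<theta> = uniqueness_regime \<Delta> lam \<theta>'"
proof -
  have pot: "potential \<Delta> lam \<theta> i (restrict \<omega> (closed_nbhd \<Delta> i)) = potential \<Delta> lam \<theta>' i (restrict \<omega> (closed_nbhd \<Delta> i))"
    if i: "i \<in> tree_nodes \<Delta>" and 01: "\<And>j. j \<in> closed_nbhd \<Delta> i \<Longrightarrow> \<omega> j \<le> 1" for i and \<omega> :: "nat list \<Rightarrow> nat"
  proof (cases "\<omega> i = 0")
    case True
    let ?N = "{j. (i, j) \<in> tree_edges \<Delta>}"
    have fin: "finite ?N" using tree_degree[OF assms(1) i] assms(1) by (intro card_ge_0_finite) simp
    have "(\<Sum>j\<in>closed_nbhd \<Delta> i. restrict \<omega> (closed_nbhd \<Delta> i) j) = (\<Sum>j\<in>closed_nbhd \<Delta> i. \<omega> j)"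
      by (intro sum.cong) auto
    also have "\<dots> = (\<Sum>j\<in>?N. \<omega> j)"
      using True fin unfolding closed_nbhd_def by (simp add: sum.insert_if)
    also have "\<dots> \<le> (\<Sum>j\<in>?N. 1)"
      using 01 by (intro sum_mono) (auto simp: closed_nbhd_def)
    also have "\<dots> = \<Delta>" using tree_degree[OF assms(1) i] by simp
    finally show ?thesis using eq by (simp add: potential_def Let_def)
  next
    case False
    then show ?thesis by (simp add: potential_def Let_def closed_nbhd_def)
  qed
  have ham: "hamiltonian \<Delta> lam \<theta> \<Lambda> (merge \<Lambda> (boundary \<Delta> \<Lambda>) (\<nu>, \<eta>))
      = hamiltonian \<Delta> lam \<theta>' \<Lambda> (merge \<Lambda> (boundary \<Delta> \<Lambda>) (\<nu>, \<eta>))"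
    if "\<nu> \<in> configs \<Lambda>" "\<eta> \<in> indep_configs \<Delta> (boundary \<Delta> \<Lambda>)" for \<Lambda> \<nu> \<eta>
    unfolding hamiltonian_def
  proof (intro sum.cong refl pot)
    fix i assume i: "i \<in> {i \<in> tree_nodes \<Delta>. closed_nbhd \<Delta> i \<inter> \<Lambda> \<noteq> {}}"
    then show "i \<in> tree_nodes \<Delta>" by simp
    fix j assume "j \<in> closed_nbhd \<Delta> i"
    then have "j \<in> \<Lambda> \<union> boundary \<Delta> \<Lambda>" using closed_nbhd_boundary[of i \<Delta> \<Lambda>] i by blast
    then show "merge \<Lambda> (boundary \<Delta> \<Lambda>) (\<nu>, \<eta>) j \<le> 1"
      using configs_01[OF merge_configs[OF that(1) indep_configs_subset[OF that(2)]], of j] by auto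
  qed
  have "cond_prob_config \<Delta> lam \<theta> \<Lambda> S \<omega> \<eta> = cond_prob_config \<Delta> lam \<theta>' \<Lambda> S \<omega> \<eta>"
    if "\<eta> \<in> indep_configs \<Delta> (boundary \<Delta> \<Lambda>)" for \<Lambda> S \<omega> \<eta>
    unfolding cond_prob_config_def using ham[OF _ that] by (intro arg_cong2[where f = "(/)"] sum.cong refl) auto
  then have "gibbs_measure \<Delta> lam \<theta> = gibbs_measure \<Delta> lam \<theta>'"
    by (auto simp: gibbs_measure_def fun_eq_iff)
  then show ?thesis by (simp add: uniqueness_regime_def)
qed

lemma log_convex_extension:
  assumes "3 \<le> \<Delta>" "\<forall>k\<le>\<Delta>. 0 < \<theta> k" "log_convex \<Delta> \<theta>"
  defines "\<theta>' \<equiv> \<lambda>k. if k \<le> \<Delta> then \<theta> k else \<theta> \<Delta> * (\<theta> \<Delta> / \<theta> (\<Delta> - 1)) ^ (k - \<Delta>)"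
  shows "weights \<theta>' (\<theta> 1 / \<theta> 0) (\<theta> \<Delta> / \<theta> (\<Delta> - 1))"
proof -
  let ?r = "\<theta> \<Delta> / \<theta> (\<Delta> - 1)"
  have pos: "0 < \<theta> k" if "k \<le> \<Delta>" for k using assms(2) that by blast
  have r: "0 < ?r" using pos[of \<Delta>] pos[of "\<Delta> - 1"] by simp
  have pos': "0 < \<theta>' k" for k using pos r by (simp add: \<theta>'_def)
  have tail: "\<theta>' (Suc k) = ?r * \<theta>' k" if k: "\<Delta> - 1 \<le> k" for k
  proof -
    consider "k = \<Delta> - 1" | "k = \<Delta>" | "\<Delta> < k" using k by linarith
    then show ?thesis
    proof cases
      case 1
      then have "Suc k = \<Delta>" using assms(1) by simp
      then show ?thesis using 1 pos[of "\<Delta> - 1"] by (simp add: \<theta>'_def)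
    next
      case 3
      then have "Suc k - \<Delta> = Suc (k - \<Delta>)" by simp
      with 3 show ?thesis by (simp add: \<theta>'_def)
    qed (simp add: \<theta>'_def)
  qed
  have step: "\<theta>' (Suc k) / \<theta>' k \<le> \<theta>' (Suc (Suc k)) / \<theta>' (Suc k)" for k
  proof (cases "Suc k < \<Delta>")
    case True
    have "\<forall>i\<in>{1..\<Delta> - 1}. \<theta> i / \<theta> (i - 1) \<le> \<theta> (i + 1) / \<theta> i"
      using assms(3) by (simp add: log_convex_def)
    from this[rule_format, of "Suc k"] True show ?thesis by (simp add: \<theta>'_def)
  next
    case False
    then have "\<theta>' (Suc k) = ?r * \<theta>' k" "\<theta>' (Suc (Suc k)) = ?r * \<theta>' (Suc k)" by (intro tail; simp)+
    then have "\<theta>' (Suc k) / \<theta>' k = ?r" "\<theta>' (Suc (Suc k)) / \<theta>' (Suc k) = ?r"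
      using pos'[of k] pos'[of "Suc k"] by (simp_all add: field_simps)
    then show ?thesis by simp
  qed
  have ratio: "\<theta>' (Suc k) / \<theta>' k \<le> ?r" for k
  proof -
    have "incseq (\<lambda>k. \<theta>' (Suc k) / \<theta>' k)" by (rule incseq_SucI) (rule step)
    then have "\<theta>' (Suc k) / \<theta>' k \<le> \<theta>' (Suc (k + \<Delta>)) / \<theta>' (k + \<Delta>)" by (rule incseqD) simp
    also have "\<dots> = ?r" using tail[of "k + \<Delta>"] pos'[of "k + \<Delta>"] by simp
    finally show ?thesis .
  qed
  show ?thesis
  proof
    fix k
    show "0 < \<theta>' k" by (rule pos')
    show "(\<theta>' (Suc k))\<^sup>2 \<le> \<theta>' k * \<theta>' (Suc (Suc k))"
      using step[of k] pos'[of k] pos'[of "Suc k"] by (simp add: divide_simps power2_eq_square mult_ac)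
    show "\<theta>' (Suc k) \<le> ?r * \<theta>' k"
      using ratio[of k] pos'[of k] by (simp only: pos_divide_le_eq)
    show "\<theta>' (Suc 0) = \<theta> 1 / \<theta> 0 * \<theta>' 0"
      using assms(1) pos[of 0] by (simp add: \<theta>'_def)
  qed
qed

lemma psi_ge:
  assumes "k + 2 \<le> \<Delta>" "0 < \<theta> k"
  shows "real (\<Delta> - 1 - k) * \<theta> (Suc k) \<le> psi \<Delta> \<theta> * \<theta> k"
proof -
  let ?f = "\<lambda>k. (real \<Delta> - (real k + 1)) * (\<theta> (k + 1) / \<theta> k)"
  have "?f k \<le> psi \<Delta> \<theta>"
    unfolding psi_def using assms(1) by (intro Max_ge) auto
  then have "?f k * \<theta> k \<le> psi \<Delta> \<theta> * \<theta> k" using assms(2) by (intro mult_right_mono) auto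
  moreover have "?f k * \<theta> k = real (\<Delta> - 1 - k) * \<theta> (Suc k)"
  proof -
    have "real \<Delta> - (real k + 1) = real (\<Delta> - 1 - k)" using assms(1) by (simp add: of_nat_diff)
    then show ?thesis using assms(2) by simp
  qed
  ultimately show ?thesis by simp
qed

text \<open>
  Both bounds reduce to \<open>uniqueness_iff\<close> for the prolonged sequence: below the first the recursion contracts,
  and above the second it repels from its fixed point.
\<close>

theorem theorem5:
  fixes \<Delta> :: nat and \<theta> :: "nat \<Rightarrow> real"
  assumes "\<Delta> \<ge> 3"
    and "\<forall>k\<le>\<Delta>. 0 < \<theta> k"
    and "log_convex \<Delta> \<theta>"
  shows "(\<forall>lam. 0 < lam \<and> lam < lambda_lower \<Delta> \<theta> \<longrightarrow> uniqueness_regime \<Delta> lam \<theta>) \<and>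
         (\<forall>lam. lam > lambda_upper \<Delta> \<theta> \<longrightarrow> \<not> uniqueness_regime \<Delta> lam \<theta>)"
proof -
  define d where "d = \<Delta> - 1"
  have \<Delta>: "\<Delta> = Suc d" and d2: "2 \<le> d" using assms(1) by (simp_all add: d_def)
  define q where "q = \<theta> 1 / \<theta> 0"
  define r where "r = \<theta> \<Delta> / \<theta> (\<Delta> - 1)"
  define \<theta>' where "\<theta>' = (\<lambda>k. if k \<le> \<Delta> then \<theta> k else \<theta> \<Delta> * r ^ (k - \<Delta>))"
  have same: "\<theta> k = \<theta>' k" if "k \<le> \<Delta>" for k using that by (simp add: \<theta>'_def)
  have pos: "0 < \<theta> k" if "k \<le> \<Delta>" for k using assms(2) that by blast
  interpret weights \<theta>' q r
    unfolding \<theta>'_def q_def r_def by (rule log_convex_extension[OF assms])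
  have tw: "tree_weights \<theta>' q r d lam" if "0 < lam" for lam
    by unfold_locales (use d2 that in auto)
  have psi: "real (d - k) * \<theta>' (Suc k) \<le> psi \<Delta> \<theta> * \<theta>' k" if "k < d" for k
    using psi_ge[of k \<Delta> \<theta>] that pos[of k] by (simp add: \<Delta> same[symmetric])
  have psi0: "0 < psi \<Delta> \<theta>"
  proof -
    have "0 < real d * \<theta>' (Suc 0)" using d2 pos by simp
    with psi[of 0] d2 have "0 < psi \<Delta> \<theta> * \<theta>' 0" by simp
    then show ?thesis using pos[of 0] same[of 0] by (simp add: zero_less_mult_iff)
  qed
  have t0: "\<theta> 0 = \<theta>' 0" "0 < \<theta> 0" using same pos by auto
  have unique: "uniqueness_regime \<Delta> lam \<theta>" if lam: "0 < lam" "lam < lambda_lower \<Delta> \<theta>" for lam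
  proof -
    interpret tree_weights \<theta>' q r d lam by (rule tw[OF lam(1)])
    define K where "K = psi \<Delta> \<theta> * inverse (\<theta> 0) * r ^ (d - 1) * (r + real d * (r - q))"
    have K: "0 < K"
      unfolding K_def using psi0 t0 r_pos q_le_r
      by (intro mult_pos_pos add_pos_nonneg mult_nonneg_nonneg) auto
    have "lambda_lower \<Delta> \<theta> = inverse (2 * K)"
      by (simp add: lambda_lower_def K_def q_def r_def \<Delta> mult.assoc)
    with lam K have "2 * (lam * K) < 1" by (simp add: field_simps)
    moreover have "0 < lam * K" using lam K by simp
    ultimately have "lam * K < 1" by linarith
    then have "lam * psi \<Delta> \<theta> / \<theta>' 0 * r ^ (d - 1) * (r + real d * (r - q)) < 1"
      by (simp add: K_def t0 divide_inverse mult_ac)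
    then have "xl_lim = xh_lim"
      using small_lam_lim_eq[of "psi \<Delta> \<theta>"] psi less_imp_le[OF psi0] by blast
    then show ?thesis using uniqueness_iff uniqueness_regime_cong[of \<Delta> \<theta> \<theta>' lam, OF _ same] by (simp add: \<Delta>)
  qed
  have nonunique: "\<not> uniqueness_regime \<Delta> lam \<theta>" if lam: "lambda_upper \<Delta> \<theta> < lam" for lam
  proof -
    have u: "lambda_upper \<Delta> \<theta> = 3 * \<theta>' 0 / real (Suc d) * exp (3 * r / q) * (1 / q) ^ Suc d"
      by (simp add: lambda_upper_def q_def r_def \<Delta> t0)
    have "0 < lambda_upper \<Delta> \<theta>" unfolding u using pos t0 q_pos by simp
    with lam interpret tree_weights \<theta>' q r d lam by (intro tw) simp
    have "3 * \<theta>' 0 / real (Suc d) * exp (3 * r / q) = lambda_upper \<Delta> \<theta> * q ^ Suc d"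
      unfolding u using q_pos by (simp add: power_divide)
    also have "\<dots> < lam * q ^ Suc d" using lam q_pos by (intro mult_strict_right_mono zero_less_power)
    finally have "xl_lim < xh_lim" by (rule large_lam_lim_less)
    then show ?thesis using uniqueness_iff uniqueness_regime_cong[of \<Delta> \<theta> \<theta>' lam, OF _ same] by (simp add: \<Delta>)
  qed
  show ?thesis using unique nonunique by blast
qed

end
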